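(* Let either $d=2$ and $\omega\in(0,1)$, or $d=3$ and $\omega\in(\frac12,1)$. Put $\mathbf{F}_+:=\mathbb{H}^{2-\omega}_{\Sigma 0}(\mathbb{T}^d)$, $\mathbf{F}:=\mathbb{H}^1_{\Sigma 0}(\mathbb{T}^d)$, $\mathbf{F}_-:=\mathbb{H}^{-\omega}_{\Sigma 0}(\mathbb{T}^d)$, $\mathcal{A}:=\Delta\restriction\mathbf{F}_+:\mathbf{F}_+\to\mathbf{F}_-$, and $\mathscr{P}(v,w):=-\mathfrak{L}(v\cdot\partial w)$ for $v,w\in\mathbf{F}$. Let $B:=1$; let $\mu=\mu_\omega$ with $$\mu_\omega(t):=\Big(\frac{1+\omega}{2et}\Big)^{\frac{1+\omega}{2}}e^t\ \text{ for }0<t\le\frac{1+\omega}{2},\qquad \mu_\omega(t):=1\ \text{ for }t>\frac{1+\omega}{2};$$ let $N=N_\omega\in(0,+\infty)$ be any majorant of $\sup_{t\in[0,+\infty)}\int_0^tds\,e^{-s}\mu_\omega(t-s)$ (which is finite); and let $K=K_\omega\in(0,+\infty)$ be any constant with $$\frac{1}{(2\pi)^{d/2}}\sqrt{\sup_{k\in\mathbb{Z}^d_0}\mathcal{K}_\omega(k)}\le K_\omega,\qquad \mathcal{K}_\omega(k):=\sum_{h\in\mathbb{Z}^d\setminus\{0,k\}}\frac{1}{|h|^{2\omega}|k-h|^2}$$ (the supremum being finite). Then all the following conditions hold: (1) $\mathbf{F}_+,\mathbf{F},\mathbf{F}_-$ are Banach spaces with $\mathbf{F}_+\hookrightarrow\mathbf{F}\hookrightarrow\mathbf{F}_-$,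 where $\hookrightarrow$ means that one space is a dense linear subspace of the other with continuous natural inclusion; (2) $\mathcal{A}:\mathbf{F}_+\to\mathbf{F}_-$ is linear, and the norm of $\mathbf{F}_+$ is equivalent to the graph norm $v\mapsto\|v\|_{-\omega}+\|\mathcal{A}v\|_{-\omega}$; (3) $\mathcal{A}$, viewed as a densely defined operator in $\mathbf{F}_-$, generates a strongly continuous semigroup $(e^{t\mathcal{A}})_{t\ge0}$ on $\mathbf{F}_-$; (4) $e^{t\mathcal{A}}(\mathbf{F})\subset\mathbf{F}$ for $t\in[0,+\infty)$, the map $(v,t)\mapsto e^{t\mathcal{A}}v$ is continuous from $\mathbf{F}\times[0,+\infty)$ to $\mathbf{F}$ (giving a strongly continuous semigroup on $\mathbf{F}$), and $\|e^{t\mathcal{A}}v\|_1\le e^{-Bt}\|v\|_1$ for all $t\ge 0$, $v\in\mathbf{F}$; (5) $e^{t\mathcal{A}}(\mathbf{F}_-)\subset\mathbf{F}$ for $t\in(0,+\infty)$, the map $(v,t)\mapsto e^{t\mathcal{A}}v$ is continuous from $\mathbf{F}_-\times(0,+\infty)$ to $\mathbf{F}$, $\mu\in C((0,+\infty),(0,+\infty))$, $\|e^{t\mathcal{A}}v\|_1\le\mu(t)e^{-Bt}\|v\|_{-\omega}$ for $t>0$, $v\in\mathbf{F}_-$, $\mu(t)=O(1/t^\varepsilon)$ for $t\to0^+$ with some $\varepsilon\in[0,1)$, and $\int_0^tds\,e^{-Bs}\mu(t-s)\le N$ for all $t\in[0,+\infty)$; (6) $\mathscr{P}$ is a well defined continuous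 bilinear map $\mathbf{F}\times\mathbf{F}\to\mathbf{F}_-$, and $\|\mathscr{P}(v,w)\|_{-\omega}\le K\|v\|_1\|w\|_1$ for all $v,w\in\mathbf{F}$.
   Context: $\mathbb{T}^d:=(\mathbb{R}/2\pi\mathbb{Z})^d$, $\mathbb{Z}^d_0:=\mathbb{Z}^d\setminus\{0\}$, and $e_k(x):=(2\pi)^{-d/2}e^{ik\cdot x}$ for $k\in\mathbb{Z}^d$. A vector field is a $d$-tuple $v=(v^1,\dots,v^d)$ of real (periodic) distributions on $\mathbb{T}^d$; its Fourier coefficients are $v_k=(\langle v^r,e_{-k}\rangle)_{r=1,\dots,d}\in\mathbb{C}^d$, so that $v=\sum_{k\in\mathbb{Z}^d}v_ke_k$ and $\overline{v_k}=v_{-k}$. For $c\in\mathbb{C}^d$, $|c|$ is the standard Hermitian norm, and $a\cdot b=\sum_r a^rb^r$. For $n\in\mathbb{R}$, $\mathbb{H}^n_0(\mathbb{T}^d)$ is the space of vector fields $v$ with zero mean ($v_0=0$) and $\sum_{k\in\mathbb{Z}^d_0}|k|^{2n}|v_k|^2<+\infty$, with the Hilbert norm $\|v\|_n:=\big(\sum_{k\in\mathbb{Z}^d_0}|k|^{2n}|v_k|^2\big)^{1/2}$. $\mathbb{H}^n_{\Sigma 0}(\mathbb{T}^d)$ is its closed subspace of divergence free elements ($k\cdot v_k=0$ for all $k$), with the same norm. $\Delta v=-\sum_{k}|k|^2v_ke_k$. The Leray projection is $\mathfrak{L}v:=\sum_{k\in\mathbb{Z}^d}(\mathfrak{L}_kv_k)e_k$,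 with $\mathfrak{L}_0c=c$ and $\mathfrak{L}_kc=c-\frac{k\cdot c}{|k|^2}k$ for $k\ne0$. $v\cdot\partial w$ is the vector field with components $(v\cdot\partial w)^r=\sum_{s=1}^dv^s\partial_sw^r$. *)

theory Defs
  imports "HOL-Analysis.Analysis" "HOL-Library.Landau_Symbols"
begin

text \<open>
  The dimension \<open>d\<close> is \<open>CARD('d)\<close>.  Functions on the torus \<open>(\<real>/2\<pi>\<int>)\<^sup>d\<close> are represented by
  \<open>2\<pi>\<close>-periodic functions on \<open>\<real>\<^sup>d\<close>, integrals over the torus by integrals over one period cell.
\<close>

definition period_cell :: "(real ^ 'd::finite) set" where
  "period_cell = cbox 0 (\<chi> i. 2 * pi)"

definition periodic_fun :: "(real ^ 'd::finite \<Rightarrow> 'b) \<Rightarrow> bool" where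
  "periodic_fun f \<longleftrightarrow> (\<forall>x i. f (x + (2 * pi) *\<^sub>R axis i 1) = f x)"

definition pderivative :: "'d::finite \<Rightarrow> (real ^ 'd \<Rightarrow> complex) \<Rightarrow> real ^ 'd \<Rightarrow> complex" where
  "pderivative i f x = frechet_derivative f (at x) (axis i 1)"

text \<open>\<open>C\<^sup>\<infinity>\<close>: all iterated partial derivatives are everywhere differentiable (hence also continuous).\<close>

definition test_funs :: "(real ^ 'd::finite \<Rightarrow> complex) set" where
  "test_funs = {\<phi>. periodic_fun \<phi> \<and> (\<forall>is. foldr pderivative is \<phi> differentiable_on UNIV)}"

text \<open>
  Real distributions are the complex linear functionals on the test functions that are continuous
  and invariant under complex conjugation.  Continuity for the Frechet topology of \<open>C\<^sup>\<infinity>\<close> is the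
  bound by some \<open>C\<^sup>m\<close> norm; there \<open>M\<close> ranges over the upper bounds of all partial derivatives of
  order at most \<open>m\<close>.  Functionals are set to \<open>0\<close> outside the test functions, so that equality
  of distributions is equality on test functions.
\<close>

definition is_real_distr :: "((real ^ 'd::finite \<Rightarrow> complex) \<Rightarrow> complex) \<Rightarrow> bool" where
  "is_real_distr T \<longleftrightarrow>
     (\<forall>\<phi>. \<phi> \<notin> test_funs \<longrightarrow> T \<phi> = 0) \<and>
     (\<forall>\<phi>\<in>test_funs. \<forall>\<psi>\<in>test_funs. \<forall>a b. T (\<lambda>x. a * \<phi> x + b * \<psi> x) = a * T \<phi> + b * T \<psi>) \<and>
     (\<forall>\<phi>\<in>test_funs. T (\<lambda>x. cnj (\<phi> x)) = cnj (T \<phi>)) \<and>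
     (\<exists>C m. \<forall>\<phi>\<in>test_funs. \<forall>M.
        (\<forall>is x. length is \<le> m \<longrightarrow> norm (foldr pderivative is \<phi> x) \<le> M) \<longrightarrow> norm (T \<phi>) \<le> C * M)"

lemma is_real_distr_zero: "is_real_distr (\<lambda>\<phi>. 0)"
  unfolding is_real_distr_def by (auto intro: exI[of _ 0])

lemma is_real_distr_add:
  assumes "is_real_distr S" "is_real_distr T"
  shows "is_real_distr (\<lambda>\<phi>. S \<phi> + T \<phi>)"
proof -
  obtain C m where S: "\<And>\<phi> M. \<phi> \<in> test_funs \<Longrightarrow>
      (\<forall>is x. length is \<le> m \<longrightarrow> norm (foldr pderivative is \<phi> x) \<le> M) \<Longrightarrow> norm (S \<phi>) \<le> C * M"
    using assms(1) unfolding is_real_distr_def by blast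
  obtain D n where T: "\<And>\<phi> M. \<phi> \<in> test_funs \<Longrightarrow>
      (\<forall>is x. length is \<le> n \<longrightarrow> norm (foldr pderivative is \<phi> x) \<le> M) \<Longrightarrow> norm (T \<phi>) \<le> D * M"
    using assms(2) unfolding is_real_distr_def by blast
  have "norm (S \<phi> + T \<phi>) \<le> (C + D) * M"
    if "\<phi> \<in> test_funs"
      and M: "\<forall>is x. length is \<le> max m n \<longrightarrow> norm (foldr pderivative is \<phi> x) \<le> M" for \<phi> M
  proof -
    have "norm (S \<phi>) \<le> C * M" "norm (T \<phi>) \<le> D * M"
      using that by (auto intro!: S T)
    then show ?thesis
      using norm_triangle_ineq[of "S \<phi>" "T \<phi>"] by (simp add: distrib_right)
  qed
  then have "\<exists>C m. \<forall>\<phi>\<in>test_funs. \<forall>M.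
        (\<forall>is x. length is \<le> m \<longrightarrow> norm (foldr pderivative is \<phi> x) \<le> M) \<longrightarrow>
        norm (S \<phi> + T \<phi>) \<le> C * M"
    by blast
  then show ?thesis
    using assms unfolding is_real_distr_def by (simp add: algebra_simps)
qed

lemma is_real_distr_scale:
  assumes "is_real_distr T"
  shows "is_real_distr (\<lambda>\<phi>. of_real c * T \<phi>)"
proof -
  obtain C m where T: "\<And>\<phi> M. \<phi> \<in> test_funs \<Longrightarrow>
      (\<forall>is x. length is \<le> m \<longrightarrow> norm (foldr pderivative is \<phi> x) \<le> M) \<Longrightarrow> norm (T \<phi>) \<le> C * M"
    using assms(1) unfolding is_real_distr_def by blast
  have "norm (of_real c * T \<phi>) \<le> (\<bar>c\<bar> * C) * M"
    if "\<phi> \<in> test_funs"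
      and M: "\<forall>is x. length is \<le> m \<longrightarrow> norm (foldr pderivative is \<phi> x) \<le> M" for \<phi> M
    using T[OF that] by (simp add: norm_mult mult.assoc mult_left_mono)
  then have "\<exists>C m. \<forall>\<phi>\<in>test_funs. \<forall>M.
        (\<forall>is x. length is \<le> m \<longrightarrow> norm (foldr pderivative is \<phi> x) \<le> M) \<longrightarrow>
        norm (of_real c * T \<phi>) \<le> C * M"
    by blast
  then show ?thesis
    using assms unfolding is_real_distr_def by (simp add: algebra_simps)
qed

typedef (overloaded) ('d::finite) distr =
    "{T :: (real ^ 'd \<Rightarrow> complex) \<Rightarrow> complex. is_real_distr T}"
  morphisms pairing Abs_distr
  using is_real_distr_zero by auto

lemma is_real_distr_pairing: "is_real_distr (pairing T)"
  using pairing[of T] by simp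

instantiation distr :: (finite) real_vector
begin

definition zero_distr :: "'a distr" where
  "zero_distr = Abs_distr (\<lambda>\<phi>. 0)"
definition plus_distr :: "'a distr \<Rightarrow> 'a distr \<Rightarrow> 'a distr" where
  "plus_distr S T = Abs_distr (\<lambda>\<phi>. pairing S \<phi> + pairing T \<phi>)"
definition scaleR_distr :: "real \<Rightarrow> 'a distr \<Rightarrow> 'a distr" where
  "scaleR_distr c T = Abs_distr (\<lambda>\<phi>. of_real c * pairing T \<phi>)"
definition uminus_distr :: "'a distr \<Rightarrow> 'a distr" where
  "uminus_distr T = (- 1) *\<^sub>R T"
definition minus_distr :: "'a distr \<Rightarrow> 'a distr \<Rightarrow> 'a distr" where
  "minus_distr S T = S + (- T)"

lemma pairing_zero: "pairing 0 \<phi> = 0"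
  by (simp add: zero_distr_def Abs_distr_inverse is_real_distr_zero)

lemma pairing_add: "pairing (S + T) \<phi> = pairing S \<phi> + pairing T \<phi>"
  by (simp add: plus_distr_def Abs_distr_inverse is_real_distr_add is_real_distr_pairing)

lemma pairing_scaleR: "pairing (c *\<^sub>R T) \<phi> = of_real c * pairing T \<phi>"
  by (simp add: scaleR_distr_def Abs_distr_inverse is_real_distr_scale is_real_distr_pairing)

instance
  by standard
    (simp_all add: pairing_inject[symmetric] fun_eq_iff pairing_zero pairing_add pairing_scaleR
      uminus_distr_def minus_distr_def algebra_simps)

end

type_synonym 'd vfield = "'d distr ^ 'd"

definition kvec :: "int ^ 'd \<Rightarrow> real ^ 'd::finite" where
  "kvec k = (\<chi> j. real_of_int (k $ j))"

definition kvecC :: "int ^ 'd \<Rightarrow> complex ^ 'd::finite" where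
  "kvecC k = (\<chi> j. of_int (k $ j))"

text \<open>The product \<open>a \<cdot> b\<close> on \<open>\<complex>\<^sup>d\<close> is bilinear (no conjugation), unlike the inner product on this type.\<close>

definition cdot :: "complex ^ 'd \<Rightarrow> complex ^ 'd::finite \<Rightarrow> complex" where
  "cdot a b = (\<Sum>r\<in>UNIV. a $ r * b $ r)"

definition efun :: "int ^ 'd \<Rightarrow> real ^ 'd::finite \<Rightarrow> complex" where
  "efun k x = of_real ((2 * pi) powr (- real CARD('d) / 2)) * exp (\<i> * of_real (kvec k \<bullet> x))"

definition fcoeff :: "'d vfield \<Rightarrow> int ^ 'd \<Rightarrow> complex ^ 'd::finite" where
  "fcoeff v k = (\<chi> r. pairing (v $ r) (efun (- k)))"

text \<open>
  The vector field \<open>\<Sum>\<^sub>k c\<^sub>k e\<^sub>k\<close>, with (unconditional) weak convergence in the space of distributions.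
\<close>

definition fseries :: "(int ^ 'd \<Rightarrow> complex ^ 'd) \<Rightarrow> 'd::finite vfield" where
  "fseries c = (THE v. \<forall>r. \<forall>\<phi>\<in>test_funs.
     ((\<lambda>k. c k $ r * (LINT x:period_cell|lborel. efun k x * \<phi> x)) has_sum pairing (v $ r) \<phi>) UNIV)"

definition laplacian :: "'d::finite vfield \<Rightarrow> 'd vfield" where
  "laplacian v = fseries (\<lambda>k. - ((norm (kvec k))\<^sup>2 *\<^sub>R fcoeff v k))"

definition leray_symbol :: "int ^ 'd \<Rightarrow> complex ^ 'd \<Rightarrow> complex ^ 'd::finite" where
  "leray_symbol k c =
     (if k = 0 then c else c - (cdot (kvecC k) c / of_real ((norm (kvec k))\<^sup>2)) *s kvecC k)"

definition leray :: "'d::finite vfield \<Rightarrow> 'd vfield" where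
  "leray v = fseries (\<lambda>k. leray_symbol k (fcoeff v k))"

definition distr_deriv :: "'d \<Rightarrow> 'd distr \<Rightarrow> 'd::finite distr" where
  "distr_deriv s T = (THE D. \<forall>\<phi>\<in>test_funs. pairing D \<phi> = - pairing T (pderivative s \<phi>))"

text \<open>\<open>T\<close> is the distribution given by the function \<open>f\<close>, integrable on the torus.\<close>

definition represents :: "(real ^ 'd::finite \<Rightarrow> real) \<Rightarrow> 'd distr \<Rightarrow> bool" where
  "represents f T \<longleftrightarrow> set_integrable lborel period_cell f \<and>
     (\<forall>\<phi>\<in>test_funs. pairing T \<phi> = (LINT x:period_cell|lborel. of_real (f x) * \<phi> x))"

text \<open>
  The product of two distributions exists here if both are functions whose pointwise product is
  integrable.
\<close>

definition is_product :: "'d::finite distr \<Rightarrow> 'd distr \<Rightarrow> 'd distr \<Rightarrow> bool" where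
  "is_product S T R \<longleftrightarrow>
     (\<exists>f g. represents f S \<and> represents g T \<and> represents (\<lambda>x. f x * g x) R)"

definition distr_mult :: "'d::finite distr \<Rightarrow> 'd distr \<Rightarrow> 'd distr" where
  "distr_mult S T = (THE R. is_product S T R)"

definition advection :: "'d::finite vfield \<Rightarrow> 'd vfield \<Rightarrow> 'd vfield" where
  "advection v w = (\<chi> r. \<Sum>s\<in>UNIV. distr_mult (v $ s) (distr_deriv s (w $ r)))"

definition sobolev0 :: "real \<Rightarrow> ('d::finite vfield) set" where
  "sobolev0 n = {v. fcoeff v 0 = 0 \<and>
     (\<lambda>k. norm (kvec k) powr (2 * n) * (norm (fcoeff v k))\<^sup>2) summable_on (UNIV - {0})}"

definition sobolev_norm :: "real \<Rightarrow> 'd::finite vfield \<Rightarrow> real" where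
  "sobolev_norm n v =
     sqrt (\<Sum>\<^sub>\<infinity>k\<in>UNIV - {0}. norm (kvec k) powr (2 * n) * (norm (fcoeff v k))\<^sup>2)"

definition sobolev_div0 :: "real \<Rightarrow> ('d::finite vfield) set" where
  "sobolev_div0 n = {v \<in> sobolev0 n. \<forall>k. cdot (kvecC k) (fcoeff v k) = 0}"

definition norm_topology :: "'a::real_vector set \<Rightarrow> ('a \<Rightarrow> real) \<Rightarrow> 'a topology" where
  "norm_topology X nrm = Metric_space.mtopology X (\<lambda>x y. nrm (x - y))"

definition normed_space_on :: "'a::real_vector set \<Rightarrow> ('a \<Rightarrow> real) \<Rightarrow> bool" where
  "normed_space_on X nrm \<longleftrightarrow> subspace X \<and>
     (\<forall>x\<in>X. 0 \<le> nrm x \<and> (nrm x = 0 \<longleftrightarrow> x = 0)) \<and>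
     (\<forall>c. \<forall>x\<in>X. nrm (c *\<^sub>R x) = \<bar>c\<bar> * nrm x) \<and>
     (\<forall>x\<in>X. \<forall>y\<in>X. nrm (x + y) \<le> nrm x + nrm y)"

definition banach_space_on :: "'a::real_vector set \<Rightarrow> ('a \<Rightarrow> real) \<Rightarrow> bool" where
  "banach_space_on X nrm \<longleftrightarrow>
     normed_space_on X nrm \<and> Metric_space.mcomplete X (\<lambda>x y. nrm (x - y))"

definition densely_embedded ::
    "'a::real_vector set \<Rightarrow> ('a \<Rightarrow> real) \<Rightarrow> 'a set \<Rightarrow> ('a \<Rightarrow> real) \<Rightarrow> bool" where
  "densely_embedded X nX Y nY \<longleftrightarrow> subspace X \<and> X \<subseteq> Y \<and>
     norm_topology Y nY closure_of X = Y \<and>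
     continuous_map (norm_topology X nX) (norm_topology Y nY) (\<lambda>x. x)"

definition linear_map_on ::
    "'a::real_vector set \<Rightarrow> 'b::real_vector set \<Rightarrow> ('a \<Rightarrow> 'b) \<Rightarrow> bool" where
  "linear_map_on X Y L \<longleftrightarrow> L ` X \<subseteq> Y \<and>
     (\<forall>x\<in>X. \<forall>y\<in>X. L (x + y) = L x + L y) \<and> (\<forall>c. \<forall>x\<in>X. L (c *\<^sub>R x) = c *\<^sub>R L x)"

definition bilinear_map_on ::
    "'a::real_vector set \<Rightarrow> 'b::real_vector set \<Rightarrow> 'c::real_vector set \<Rightarrow>
     ('a \<Rightarrow> 'b \<Rightarrow> 'c) \<Rightarrow> bool" where
  "bilinear_map_on X Y Z b \<longleftrightarrow>
     (\<forall>x\<in>X. linear_map_on Y Z (\<lambda>y. b x y)) \<and> (\<forall>y\<in>Y. linear_map_on X Z (\<lambda>x. b x y))"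

definition equivalent_norms_on :: "'a set \<Rightarrow> ('a \<Rightarrow> real) \<Rightarrow> ('a \<Rightarrow> real) \<Rightarrow> bool" where
  "equivalent_norms_on X n1 n2 \<longleftrightarrow>
     (\<exists>c>0. \<exists>C>0. \<forall>x\<in>X. c * n1 x \<le> n2 x \<and> n2 x \<le> C * n1 x)"

definition sc_semigroup ::
    "'a::real_vector set \<Rightarrow> ('a \<Rightarrow> real) \<Rightarrow> (real \<Rightarrow> 'a \<Rightarrow> 'a) \<Rightarrow> bool" where
  "sc_semigroup X nrm U \<longleftrightarrow>
     (\<forall>t\<ge>0. linear_map_on X X (U t) \<and> (\<exists>C. \<forall>x\<in>X. nrm (U t x) \<le> C * nrm x)) \<and>
     (\<forall>x\<in>X. U 0 x = x) \<and>
     (\<forall>s\<ge>0. \<forall>t\<ge>0. \<forall>x\<in>X. U (s + t) x = U s (U t x)) \<and>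
     (\<forall>x\<in>X. continuous_map (top_of_set {0..}) (norm_topology X nrm) (\<lambda>t. U t x))"

text \<open>
  \<open>U\<close> is a strongly continuous semigroup on \<open>X\<close> whose infinitesimal generator is exactly the
  operator \<open>A\<close> with domain \<open>D\<close>.
\<close>

definition generates ::
    "'a::real_vector set \<Rightarrow> ('a \<Rightarrow> real) \<Rightarrow> 'a set \<Rightarrow> ('a \<Rightarrow> 'a) \<Rightarrow> (real \<Rightarrow> 'a \<Rightarrow> 'a) \<Rightarrow> bool" where
  "generates X nrm D A U \<longleftrightarrow> sc_semigroup X nrm U \<and> D \<subseteq> X \<and>
     (\<forall>x\<in>X. \<forall>y.
        limitin (norm_topology X nrm) (\<lambda>h. (1 / h) *\<^sub>R (U h x - x)) y (at_right 0)
        \<longleftrightarrow> x \<in> D \<and> y = A x)"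

text \<open>Only the values of \<open>\<mu>\<^sub>\<omega>\<close> on \<open>(0, \<infinity>)\<close> are meaningful.\<close>

definition mu_fun :: "real \<Rightarrow> real \<Rightarrow> real" where
  "mu_fun \<omega> t = (if t \<le> (1 + \<omega>) / 2
     then ((1 + \<omega>) / (2 * exp 1 * t)) powr ((1 + \<omega>) / 2) * exp t else 1)"

definition Ksum :: "real \<Rightarrow> int ^ 'd::finite \<Rightarrow> real" where
  "Ksum \<omega> k = (\<Sum>\<^sub>\<infinity>h\<in>UNIV - {0, k}. 1 / (norm (kvec h) powr (2 * \<omega>) * (norm (kvec (k - h)))\<^sup>2))"

end

theory Submission
  imports Defs
begin

text \<open>
  Everything is read on the Fourier side.  A vector field is determined by its coefficients \<open>v\<^sub>k\<close>, the
  spaces of order \<open>n\<close> are weighted \<open>\<ell>\<^sup>2\<close> spaces over the nonzero lattice points, and the Laplacian is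
  multiplication by \<open>- |k|\<^sup>2\<close>.  All statements about the linear part are then estimates for Fourier
  multipliers, and the statement about the quadratic part is an estimate for a convolution.

  The translation to coefficients rests on three facts.  An integrable function on the torus with
  vanishing Fourier coefficients is zero almost everywhere (\<open>AE_eq_0_if_coeffs_eq_0\<close>).  By
  integration by parts the coefficients of a test function decay faster than any power, so its Fourier
  series converges to it with all derivatives and a distribution may be applied term by term
  (\<open>distr_test_fun_has_sum\<close>).  Conversely, Hermitian families of polynomial growth are coefficients of real
  distributions (\<open>fcoeff_fseries\<close>).  Completeness of the spaces follows by taking limits of
  coefficients (\<open>banach_space_sobolev\<close>).

  The semigroup is \<open>v\<^sub>k \<mapsto> exp (- t |k|\<^sup>2) v\<^sub>k\<close>.  Its continuity, its generator and the density of the smoother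
  spaces come from dominated convergence for multipliers (\<open>fmult_tendsto_0\<close>).  It is the only semigroup
  with this generator, because each coefficient of an orbit in the domain solves a scalar linear
  equation (\<open>generates_unique\<close>); so all claims about \<open>e\<^sup>t\<^sup>A\<close> may be checked on symbols.  The decay
  \<open>e\<^sup>-\<^sup>t\<close> holds since \<open>|k| \<ge> 1\<close>, and \<open>\<mu>\<^sub>\<omega> t\<close> bounds \<open>|k|\<^sup>1\<^sup>+\<^sup>\<omega> exp (- t (|k|\<^sup>2 - 1))\<close> for all nonzero \<open>k\<close>
  (\<open>heat_symbol_mu\<close>).

  For the quadratic part, fields of order 1 have square integrable components and derivatives.
  Completeness of \<open>L\<^sup>2\<close> (\<open>riesz_fischer\<close>) turns them into functions whose products are integrable, with
  coefficients given by the convolution \<open>(v \<cdot> \<partial>w)\<^sub>k = (2\<pi>)\<^sup>-\<^sup>d\<^sup>/\<^sup>2 \<i> \<Sum>\<^sub>p (v\<^sub>k\<^sub>-\<^sub>p \<cdot> p) w\<^sub>p\<close>.  Two applications of the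
  Cauchy-Schwarz inequality, the first one at fixed \<open>p\<close>, bound its norm of order \<open>- \<omega>\<close> by the square root of
  the supremum of the sums \<open>Ksum \<omega> p\<close> (\<open>convolution_estimate\<close>).  These sums are bounded because
  \<open>2 \<omega> + 2 > d\<close>.  The Leray projection does not increase the norm, and the mean of \<open>v \<cdot> \<partial>w\<close>
  vanishes because \<open>v\<close> is divergence free.
\<close>

section \<open>Lattice sums\<close>

lemma kvec_nth [simp]: "kvec k $ j = real_of_int (k $ j)"
  by (simp add: kvec_def)

lemma kvec_add: "kvec (k + h) = kvec k + kvec h"
  by (simp add: vec_eq_iff)

lemma kvec_diff: "kvec (k - h) = kvec k - kvec h"
  by (simp add: vec_eq_iff)

lemma kvec_uminus: "kvec (- k) = - kvec k"
  by (simp add: vec_eq_iff)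

lemma kvec_0 [simp]: "kvec 0 = 0"
  by (simp add: vec_eq_iff)

lemma kvec_eq_0_iff [simp]: "kvec k = 0 \<longleftrightarrow> k = 0"
  by (simp add: vec_eq_iff)

lemma norm_kvec_minus_commute: "norm (kvec (k - h)) = norm (kvec (h - k))"
  by (simp add: kvec_diff norm_minus_commute)

lemma norm_kvec_uminus [simp]: "norm (kvec (- k)) = norm (kvec k)"
  by (simp add: kvec_uminus)

lemma abs_component_le_norm_kvec: "\<bar>real_of_int (k $ j)\<bar> \<le> norm (kvec k)"
  using component_le_norm_cart[of "kvec k" j] by simp

lemma norm_kvec_ge_1:
  assumes "k \<noteq> 0" shows "1 \<le> norm (kvec k)"
proof -
  obtain j where "k $ j \<noteq> 0" using assms by (auto simp: vec_eq_iff)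
  then have "1 \<le> \<bar>real_of_int (k $ j)\<bar>" by linarith
  then show ?thesis using abs_component_le_norm_kvec[of k j] by linarith
qed

lemma summable_int_powr:
  assumes "p > 1"
  shows "(\<lambda>n::int. (1 + \<bar>real_of_int n\<bar>) powr (- p)) summable_on UNIV"
proof -
  have *: "summable (\<lambda>n. (real n) powr (- p))"
    using assms by (simp add: summable_real_powr_iff)
  have s1: "summable (\<lambda>n. (1 + real n) powr (- p))"
    using * summable_Suc_iff[of "\<lambda>n. (real n) powr (- p)"] by (simp add: add.commute)
  have s2: "summable (\<lambda>n. (2 + real n) powr (- p))"
    using s1 summable_Suc_iff[of "\<lambda>n. (1 + real n) powr (- p)"] by (simp add: add.assoc)
  have a: "(\<lambda>n::int. (1 + \<bar>real_of_int n\<bar>) powr (- p)) summable_on range int"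
    by (subst summable_on_reindex) (auto simp: o_def intro!: summable_nonneg_imp_summable_on s1)
  have b: "(\<lambda>n::int. (1 + \<bar>real_of_int n\<bar>) powr (- p)) summable_on range (\<lambda>n. - int (Suc n))"
    using s2 by (subst summable_on_reindex)
      (auto simp: o_def inj_on_def add.assoc intro!: summable_nonneg_imp_summable_on)
  have "range int \<union> range (\<lambda>n. - int (Suc n)) = UNIV"
  proof -
    have "x \<in> range int \<union> range (\<lambda>n. - int (Suc n))" for x :: int
      by (cases x rule: int_cases) auto
    then show ?thesis by blast
  qed
  moreover have "range int \<inter> range (\<lambda>n. - int (Suc n)) = {}" by auto
  ultimately show ?thesis
    using summable_on_Un_disjoint[OF a b] by simp
qed

text \<open>
  Comparing \<open>|k|\<close> with the coordinates, \<open>|k|\<^sup>-\<^sup>s\<close> is dominated by a product of one-dimensional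
  summable functions, each with exponent \<open>s / d > 1\<close>.
\<close>

lemma summable_norm_kvec_powr:
  assumes "s > real CARD('d)"
  shows "(\<lambda>k::int^'d::finite. norm (kvec k) powr (- s)) summable_on UNIV"
proof -
  define p where "p = s / real CARD('d)"
  have d: "real CARD('d) > 0" by simp
  have p: "p > 1" using assms d by (simp add: p_def)
  define g where "g n = (1 + \<bar>real_of_int n\<bar>) powr (- p)" for n :: int
  have g0: "g n \<ge> 0" for n by (simp add: g_def)
  have gs: "g summable_on UNIV" unfolding g_def by (rule summable_int_powr[OF p])
  define S where "S = infsum g UNIV"
  have bnd: "norm (kvec k) powr (- s) \<le> 2 powr s * (\<Prod>j\<in>UNIV. g (k $ j))" for k :: "int^'d"
  proof (cases "k = 0")
    case False
    define R where "R = norm (kvec k)"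
    have R: "R \<ge> 1" unfolding R_def by (rule norm_kvec_ge_1[OF False])
    have 1: "(2 * R) powr (- p) \<le> g (k $ j)" for j
      unfolding g_def using abs_component_le_norm_kvec[of k j] R p
      by (intro powr_mono2') (auto simp: R_def[symmetric])
    have "(2 * R) powr (- s) = (\<Prod>j\<in>(UNIV::'d set). (2 * R) powr (- p))"
      using R by (simp add: powr_realpow[symmetric] powr_powr p_def)
    also have "\<dots> \<le> (\<Prod>j\<in>UNIV. g (k $ j))"
      by (intro prod_mono) (use 1 in auto)
    finally have "2 powr (- s) * R powr (- s) \<le> (\<Prod>j\<in>UNIV. g (k $ j))"
      using R by (simp add: powr_mult)
    then have "2 powr s * (2 powr (- s) * R powr (- s)) \<le> 2 powr s * (\<Prod>j\<in>UNIV. g (k $ j))"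
      by (intro mult_left_mono) auto
    moreover have "2 powr s * 2 powr (- s) = (1::real)"
      by (simp add: powr_add[symmetric])
    ultimately show ?thesis
      by (simp add: R_def mult.assoc[symmetric])
  qed (use g0[of 0] in simp)
  have "(\<Sum>k\<in>F. norm (kvec k) powr (- s)) \<le> 2 powr s * S ^ CARD('d)" if F: "finite F" for F :: "(int^'d) set"
  proof -
    define A where "A = (\<Union>j. (\<lambda>k. k $ j) ` F)"
    have A: "finite A" unfolding A_def using F by auto
    have "(\<Sum>k\<in>F. norm (kvec k) powr (- s)) \<le> (\<Sum>k\<in>F. 2 powr s * (\<Prod>j\<in>UNIV. g (k $ j)))"
      by (intro sum_mono bnd)
    also have "\<dots> = 2 powr s * (\<Sum>f\<in>vec_nth ` F. \<Prod>j\<in>UNIV. g (f j))"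
      by (subst sum.reindex) (auto simp: inj_on_def vec_nth_inject sum_distrib_left)
    also have "\<dots> \<le> 2 powr s * (\<Sum>f\<in>PiE UNIV (\<lambda>_::'d. A). \<Prod>j\<in>UNIV. g (f j))"
      using A by (intro mult_left_mono sum_mono2 finite_PiE prod_nonneg) (auto simp: A_def g0)
    also have "\<dots> = 2 powr s * (\<Sum>x\<in>A. g x) ^ CARD('d)"
      using A by (subst prod_sum_PiE[symmetric]) auto
    also have "\<dots> \<le> 2 powr s * S ^ CARD('d)"
      unfolding S_def using A g0
      by (intro mult_left_mono power_mono finite_sum_le_infsum[OF gs] sum_nonneg) auto
    finally show ?thesis .
  qed
  then show ?thesis
    by (intro nonneg_bdd_above_summable_on bdd_aboveI2) auto
qed

text \<open>
  The smaller of \<open>|h|\<close> and \<open>|k - h|\<close> may replace both, which separates the two factors.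
\<close>

lemma Ksum_term_le:
  assumes "\<omega> \<ge> 0" "h \<noteq> 0" "h \<noteq> k"
  shows "1 / (norm (kvec h) powr (2 * \<omega>) * (norm (kvec (k - h)))\<^sup>2)
    \<le> norm (kvec h) powr (- (2 * \<omega> + 2)) + norm (kvec (k - h)) powr (- (2 * \<omega> + 2))"
proof -
  have pos: "0 < norm (kvec h)" "0 < norm (kvec (k - h))"
    using assms by auto
  have sq: "x powr (2 * \<omega>) * y\<^sup>2 = x powr (2 * \<omega>) * y powr 2" if "y > 0" for x y :: real
    using that by simp
  have le: "1 / (x powr (2 * \<omega>) * y powr 2) \<le> min x y powr (- (2 * \<omega> + 2))" if "x > 0" "y > 0" for x y :: real
  proof -
    have "min x y powr (2 * \<omega>) * min x y powr 2 \<le> x powr (2 * \<omega>) * y powr 2"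
      using that assms by (intro mult_mono powr_mono2) auto
    moreover have "min x y powr (2 * \<omega>) * min x y powr 2 > 0" using that by auto
    ultimately have "1 / (x powr (2 * \<omega>) * y powr 2) \<le> 1 / (min x y powr (2 * \<omega>) * min x y powr 2)"
      by (intro divide_left_mono) auto
    then show ?thesis
      by (simp only: powr_add[symmetric] powr_minus_divide)
  qed
  show ?thesis
    unfolding sq[OF pos(2)] using le[OF pos] powr_ge_zero
    by (cases "norm (kvec h) \<le> norm (kvec (k - h))") (auto simp: min_def intro: order_trans)
qed

lemma reflected_summable_infsum:
  fixes f :: "int^'d::finite \<Rightarrow> real"
  assumes "f summable_on UNIV"
  shows "(\<lambda>h. f (k - h)) summable_on UNIV" "(\<Sum>\<^sub>\<infinity>h. f (k - h)) = infsum f UNIV"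
proof -
  have bij: "bij_betw (\<lambda>h. k - h) UNIV (UNIV :: (int^'d) set)"
    by (rule bij_betwI[of _ _ _ "\<lambda>h. k - h"]) auto
  show "(\<lambda>h. f (k - h)) summable_on UNIV"
    using assms summable_on_reindex_bij_betw[OF bij, of f] by simp
  show "(\<Sum>\<^sub>\<infinity>h. f (k - h)) = infsum f UNIV"
    using infsum_reindex_bij_betw[OF bij, of f] by simp
qed

lemma Ksum_summable_and_bound:
  fixes k :: "int^'d::finite"
  assumes "\<omega> \<ge> 0" and s: "2 * \<omega> + 2 > real CARD('d)"
  shows "(\<lambda>h. 1 / (norm (kvec h) powr (2 * \<omega>) * (norm (kvec (k - h)))\<^sup>2)) summable_on (UNIV - {0, k})"
    and "Ksum \<omega> k \<le> 2 * (\<Sum>\<^sub>\<infinity>h::int^'d. norm (kvec h) powr (- (2 * \<omega> + 2)))"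
proof -
  let ?f = "\<lambda>h::int^'d. norm (kvec h) powr (- (2 * \<omega> + 2))"
  have f: "?f summable_on UNIV" by (rule summable_norm_kvec_powr[OF s])
  note r = reflected_summable_infsum[OF f, of k]
  have s: "(\<lambda>h. ?f h + ?f (k - h)) summable_on UNIV"
    by (intro summable_on_add f r)
  have s': "(\<lambda>h. ?f h + ?f (k - h)) summable_on (UNIV - {0, k})"
    by (rule summable_on_subset_banach[OF s]) auto
  show *: "(\<lambda>h. 1 / (norm (kvec h) powr (2 * \<omega>) * (norm (kvec (k - h)))\<^sup>2)) summable_on (UNIV - {0, k})"
    by (rule summable_on_comparison_test[OF s']) (use Ksum_term_le[OF assms(1)] in blast, simp)
  have "Ksum \<omega> k \<le> (\<Sum>\<^sub>\<infinity>h\<in>UNIV - {0,k}. ?f h + ?f (k - h))"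
    unfolding Ksum_def by (rule infsum_mono[OF * s']) (use Ksum_term_le[OF assms(1)] in blast)
  also have "\<dots> \<le> (\<Sum>\<^sub>\<infinity>h. ?f h + ?f (k - h))"
    by (rule infsum_mono2[OF s' s]) auto
  also have "\<dots> = 2 * infsum ?f UNIV"
    using infsum_add[OF f r(1)] r(2) by simp
  finally show "Ksum \<omega> k \<le> 2 * infsum ?f UNIV" .
qed

text \<open>
  The estimate behind the bound of the quadratic term.  The output is tested against itself, and the
  frequency \<open>p\<close> of the second factor is kept fixed while Cauchy-Schwarz is applied in \<open>k\<close>:
  this is why the supremum of \<open>Ksum\<close> appears, as \<open>Ksum \<omega> p\<close> sums the squares of
  \<open>|k|\<^sup>-\<^sup>\<omega> |k - p|\<^sup>-\<^sup>1\<close>.  A second Cauchy-Schwarz inequality in \<open>p\<close> finishes the proof.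
\<close>

lemma convolution_estimate:
  fixes a b :: "int^'d::finite \<Rightarrow> real"
  assumes \<omega>: "\<omega> \<ge> 0" "2 * \<omega> + 2 > real CARD('d)"
    and K: "\<And>k::int^'d. k \<noteq> 0 \<Longrightarrow> Ksum \<omega> k \<le> K0"
    and a: "\<And>G. finite G \<Longrightarrow> L2_set a G \<le> A" and b: "\<And>G. finite G \<Longrightarrow> L2_set b G \<le> B"
    and nn: "\<And>k. a k \<ge> 0" "\<And>k. b k \<ge> 0" and b0: "b 0 = 0"
    and F: "finite F" "0 \<notin> F" and P: "finite P"
  shows "L2_set (\<lambda>k. norm (kvec k) powr (- \<omega>) * (\<Sum>p\<in>P. a (k - p) / norm (kvec (k - p)) * b p)) F
    \<le> sqrt K0 * A * B"
proof -
  define u where "u k = norm (kvec k) powr (- \<omega>) * (\<Sum>p\<in>P. a (k - p) / norm (kvec (k - p)) * b p)" for k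
  define X where "X = L2_set u F"
  have u0: "u k \<ge> 0" for k
    unfolding u_def by (intro mult_nonneg_nonneg sum_nonneg divide_nonneg_nonneg nn) auto
  have A0: "A \<ge> 0" using a[of "{}"] by simp
  have B0: "B \<ge> 0" using b[of "{}"] by simp
  have K00: "K0 \<ge> 0"
  proof -
    have "0 \<le> Ksum \<omega> (axis undefined 1 :: int^'d)"
      unfolding Ksum_def by (intro infsum_nonneg) auto
    also have "\<dots> \<le> K0" by (rule K) (simp add: axis_eq_0_iff)
    finally show ?thesis .
  qed
  have kp: "L2_set (\<lambda>k. norm (kvec k) powr (- \<omega>) / norm (kvec (k - p))) F \<le> sqrt K0"
    if "p \<noteq> 0" for p
  proof -
    have "(\<Sum>k\<in>F. (norm (kvec k) powr (- \<omega>) / norm (kvec (k - p)))\<^sup>2)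
        = (\<Sum>k\<in>F. 1 / (norm (kvec k) powr (2 * \<omega>) * (norm (kvec (p - k)))\<^sup>2))"
      by (intro sum.cong refl)
        (simp add: power_divide norm_kvec_minus_commute[of p] powr_minus divide_simps power2_eq_square
          powr_add[symmetric])
    also have "\<dots> = (\<Sum>k\<in>F - {p}. 1 / (norm (kvec k) powr (2 * \<omega>) * (norm (kvec (p - k)))\<^sup>2))"
      by (intro sum.mono_neutral_right) (use F in auto)
    also have "\<dots> \<le> Ksum \<omega> p"
      unfolding Ksum_def using F
      by (intro finite_sum_le_infsum Ksum_summable_and_bound \<omega>) auto
    also have "\<dots> \<le> K0" using K[OF that] .
    finally show ?thesis unfolding L2_set_def by (rule real_sqrt_le_mono)
  qed
  have "X\<^sup>2 = (\<Sum>k\<in>F. u k * u k)"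
    unfolding X_def L2_set_def by (simp add: sum_nonneg power2_eq_square)
  also have "\<dots> = (\<Sum>k\<in>F. \<Sum>p\<in>P. b p * ((u k * a (k - p)) * (norm (kvec k) powr (- \<omega>) / norm (kvec (k - p)))))"
    by (subst (2) u_def) (simp add: sum_distrib_left sum_distrib_right algebra_simps)
  also have "\<dots> = (\<Sum>p\<in>P. b p * (\<Sum>k\<in>F. (u k * a (k - p)) * (norm (kvec k) powr (- \<omega>) / norm (kvec (k - p)))))"
    by (subst sum.swap) (simp add: sum_distrib_left)
  also have "\<dots> \<le> (\<Sum>p\<in>P. b p * (L2_set (\<lambda>k. u k * a (k - p)) F * sqrt K0))"
  proof (rule sum_mono)
    fix p assume "p \<in> P"
    show "b p * (\<Sum>k\<in>F. (u k * a (k - p)) * (norm (kvec k) powr (- \<omega>) / norm (kvec (k - p))))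
      \<le> b p * (L2_set (\<lambda>k. u k * a (k - p)) F * sqrt K0)"
    proof (cases "p = 0")
      case False
      have "(\<Sum>k\<in>F. (u k * a (k - p)) * (norm (kvec k) powr (- \<omega>) / norm (kvec (k - p))))
        \<le> (\<Sum>k\<in>F. \<bar>u k * a (k - p)\<bar> * \<bar>norm (kvec k) powr (- \<omega>) / norm (kvec (k - p))\<bar>)"
        by (intro sum_mono) (metis abs_ge_self abs_mult)
      also have "\<dots> \<le> L2_set (\<lambda>k. u k * a (k - p)) F * L2_set (\<lambda>k. norm (kvec k) powr (- \<omega>) / norm (kvec (k - p))) F"
        by (rule L2_set_mult_ineq)
      also have "\<dots> \<le> L2_set (\<lambda>k. u k * a (k - p)) F * sqrt K0"
        by (intro mult_left_mono kp False) auto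
      finally show ?thesis by (intro mult_left_mono nn)
    qed (simp add: b0)
  qed
  also have "\<dots> = sqrt K0 * (\<Sum>p\<in>P. b p * L2_set (\<lambda>k. u k * a (k - p)) F)"
    by (simp add: sum_distrib_left mult_ac)
  also have "\<dots> \<le> sqrt K0 * (B * (X * A))"
  proof (intro mult_left_mono)
    have "(\<Sum>p\<in>P. b p * L2_set (\<lambda>k. u k * a (k - p)) F)
      = (\<Sum>p\<in>P. \<bar>b p\<bar> * \<bar>L2_set (\<lambda>k. u k * a (k - p)) F\<bar>)"
      by (simp add: nn)
    also have "\<dots> \<le> L2_set b P * L2_set (\<lambda>p. L2_set (\<lambda>k. u k * a (k - p)) F) P"
      by (rule L2_set_mult_ineq)
    also have "\<dots> \<le> B * (X * A)"
    proof (intro mult_mono b P B0 L2_set_nonneg)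
      have "(\<Sum>p\<in>P. (L2_set (\<lambda>k. u k * a (k - p)) F)\<^sup>2) = (\<Sum>p\<in>P. \<Sum>k\<in>F. (u k)\<^sup>2 * (a (k - p))\<^sup>2)"
        unfolding L2_set_def by (simp add: sum_nonneg power_mult_distrib)
      also have "\<dots> = (\<Sum>k\<in>F. (u k)\<^sup>2 * (\<Sum>p\<in>P. (a (k - p))\<^sup>2))"
        by (subst sum.swap) (simp add: sum_distrib_left)
      also have "\<dots> \<le> (\<Sum>k\<in>F. (u k)\<^sup>2 * A\<^sup>2)"
      proof (intro sum_mono mult_left_mono)
        fix k
        have "(\<Sum>p\<in>P. (a (k - p))\<^sup>2) = (\<Sum>h\<in>(\<lambda>p. k - p) ` P. (a h)\<^sup>2)"
          by (subst sum.reindex) (auto simp: inj_on_def)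
        also have "\<dots> = (L2_set a ((\<lambda>p. k - p) ` P))\<^sup>2"
          unfolding L2_set_def by (simp add: sum_nonneg)
        also have "\<dots> \<le> A\<^sup>2" using P by (intro power_mono a) auto
        finally show "(\<Sum>p\<in>P. (a (k - p))\<^sup>2) \<le> A\<^sup>2" .
      qed auto
      also have "\<dots> = (X * A)\<^sup>2"
        by (simp add: X_def L2_set_def sum_nonneg power_mult_distrib sum_distrib_right)
      finally have "sqrt (\<Sum>p\<in>P. (L2_set (\<lambda>k. u k * a (k - p)) F)\<^sup>2) \<le> sqrt ((X * A)\<^sup>2)"
        by (rule real_sqrt_le_mono)
      then show "L2_set (\<lambda>p. L2_set (\<lambda>k. u k * a (k - p)) F) P \<le> X * A"
        using A0 by (simp add: L2_set_def[of _ P] X_def)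
    qed
    finally show "(\<Sum>p\<in>P. b p * L2_set (\<lambda>k. u k * a (k - p)) F) \<le> B * (X * A)" .
  qed (use K00 in auto)
  finally have "X * X \<le> (sqrt K0 * A * B) * X"
    by (simp add: power2_eq_square mult_ac)
  moreover have "X \<ge> 0" by (simp add: X_def)
  moreover have "sqrt K0 * A * B \<ge> 0" using K00 A0 B0 by simp
  ultimately have "X \<le> sqrt K0 * A * B"
    by (cases "X = 0") (auto simp: mult_le_cancel_right)
  then show ?thesis unfolding X_def u_def .
qed

section \<open>Integration over the torus and Fourier coefficients of functions\<close>

abbreviation torus_integral :: "(real^'d::finite \<Rightarrow> complex) \<Rightarrow> complex" where
  "torus_integral f \<equiv> LINT x:period_cell|lborel. f x"

lemma mem_period_cell: "x \<in> period_cell \<longleftrightarrow> (\<forall>i. 0 \<le> x $ i \<and> x $ i \<le> 2 * pi)"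
  by (simp add: period_cell_def mem_box_cart)

lemma compact_period_cell: "compact period_cell"
  by (simp add: period_cell_def)

lemma sets_period_cell [measurable, simp]: "period_cell \<in> sets borel"
  by (simp add: period_cell_def)

lemma measure_period_cell: "measure lborel (period_cell :: (real^'d::finite) set) = (2 * pi) ^ CARD('d)"
  by (subst period_cell_def, subst content_cbox_cart) (auto simp: box_ne_empty Basis_vec_def inner_axis)

lemma emeasure_period_cell_finite: "emeasure lborel (period_cell :: (real^'d::finite) set) < \<infinity>"
  using emeasure_compact_finite[OF compact_period_cell] by simp

lemma set_integrable_period_cell:
  fixes f :: "real^'d::finite \<Rightarrow> 'b::euclidean_space"
  assumes "continuous_on UNIV f" shows "set_integrable lborel period_cell f"
  unfolding set_integrable_def
  by (intro borel_integrable_compact compact_period_cell continuous_on_subset[OF assms]) auto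

lemma torus_integral_eq_integral:
  assumes "continuous_on UNIV f" shows "torus_integral f = integral period_cell f"
  using set_borel_integral_eq_integral(2)[OF set_integrable_period_cell[OF assms]] .

lemma periodic_fun_shift:
  assumes "periodic_fun f" shows "f (x + (2 * pi) *\<^sub>R kvec k) = f x"
proof -
  have P: "f (y + (2 * pi) *\<^sub>R axis i 1) = f y" for y i
    using assms by (simp add: periodic_fun_def)
  have nat: "f (y + (2 * pi * real n) *\<^sub>R axis i 1) = f y" for n :: nat and y i
  proof (induction n arbitrary: y)
    case (Suc n)
    have "f (y + (2 * pi * real (Suc n)) *\<^sub>R axis i 1)
        = f ((y + (2 * pi) *\<^sub>R axis i 1) + (2 * pi * real n) *\<^sub>R axis i 1)"
      by (simp add: algebra_simps)
    then show ?case by (simp only: Suc P)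
  qed simp
  have int: "f (y + (2 * pi * real_of_int n) *\<^sub>R axis i 1) = f y" for n :: int and y i
  proof (cases "n \<ge> 0")
    case True
    then show ?thesis using nat[of y "nat n" i] by simp
  next
    case False
    then show ?thesis
      using nat[of "y + (2 * pi * real_of_int n) *\<^sub>R axis i 1" "nat (- n)" i]
      by (simp add: algebra_simps)
  qed
  have "f (x + (\<Sum>i\<in>I. (2 * pi * real_of_int (k $ i)) *\<^sub>R axis i 1)) = f x" if "finite I" for I
    using that
  proof (induction I)
    case (insert i I)
    then show ?case
      using int[of "x + (\<Sum>i\<in>I. (2 * pi * real_of_int (k $ i)) *\<^sub>R axis i 1)" "k $ i" i]
      by (simp add: algebra_simps)
  qed simp
  from this[of UNIV] have "f (x + (\<Sum>i\<in>UNIV. (2 * pi * real_of_int (k $ i)) *\<^sub>R axis i 1)) = f x"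
    by simp
  moreover have "(\<Sum>i\<in>UNIV. (2 * pi * real_of_int (k $ i)) *\<^sub>R axis i 1) = (2 * pi) *\<^sub>R kvec k"
    by (simp add: vec_eq_iff axis_def sum.delta if_distrib cong: if_cong)
  ultimately show ?thesis by simp
qed

lemma periodic_fun_reduce:
  assumes "periodic_fun f" obtains y where "y \<in> period_cell" "f x = f y"
proof -
  define k where "k = (\<chi> i. \<lfloor>x $ i / (2 * pi)\<rfloor>)"
  define y where "y = x - (2 * pi) *\<^sub>R kvec k"
  have "0 \<le> y $ i \<and> y $ i \<le> 2 * pi" for i
  proof -
    have "real_of_int (k $ i) \<le> x $ i / (2 * pi)" "x $ i / (2 * pi) \<le> real_of_int (k $ i) + 1"
      unfolding k_def vec_lambda_beta by linarith+
    then have "real_of_int (k $ i) * (2 * pi) \<le> x $ i" "x $ i \<le> (real_of_int (k $ i) + 1) * (2 * pi)"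
      by (simp_all add: field_simps)
    then show ?thesis by (simp add: y_def algebra_simps)
  qed
  then have "y \<in> period_cell" by (simp add: mem_period_cell)
  moreover have "f x = f y" using periodic_fun_shift[OF assms, of y k] by (simp add: y_def)
  ultimately show ?thesis using that by blast
qed

lemma periodic_fun_bounded:
  fixes f :: "real^'d::finite \<Rightarrow> complex"
  assumes "periodic_fun f" "continuous_on UNIV f"
  obtains M where "\<And>x. norm (f x) \<le> M"
proof -
  have "bounded (f ` period_cell)"
    by (intro compact_imp_bounded compact_continuous_image compact_period_cell
        continuous_on_subset[OF assms(2)]) auto
  then obtain M where "\<And>y. y \<in> period_cell \<Longrightarrow> norm (f y) \<le> M"
    unfolding bounded_iff by blast
  then have "norm (f x) \<le> M" for x
    using periodic_fun_reduce[OF assms(1), of x] by metis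
  then show ?thesis using that by blast
qed

text \<open>
  The part of the shifted cell that sticks out on one side is the part missing on the other, moved
  by one period.
\<close>

lemma integral_period_cell_shift:
  fixes f :: "real^'d::finite \<Rightarrow> complex"
  assumes per: "periodic_fun f" and cont: "continuous_on UNIV f" and t: "0 \<le> t" "t \<le> 2 * pi"
  shows "integral period_cell (\<lambda>x. f (x + t *\<^sub>R axis j 1)) = integral period_cell f"
proof -
  define Bx where "Bx l u = cbox (\<chi> i. if i = j then l else 0) (\<chi> i. if i = j then u else 2 * pi)"
    for l u :: real
  have int: "f integrable_on cbox a b" for a b
    by (rule integrable_continuous[OF continuous_on_subset[OF cont]]) auto
  have split: "integral (Bx l u) f = integral (Bx l m) f + integral (Bx m u) f"
    if "l \<le> m" "m \<le> u" for l m u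
  proof -
    have eq: "Bx l u \<inter> {x. x \<bullet> axis j 1 \<le> m} = Bx l m" "Bx l u \<inter> {x. x \<bullet> axis j 1 \<ge> m} = Bx m u"
      using that by (auto simp: Bx_def mem_box_cart inner_axis split: if_splits) force+
    show ?thesis
      using integral_split[OF int, of "axis j 1" "\<chi> i. if i = j then l else 0" "\<chi> i. if i = j then u else 2 * pi" m]
      by (simp add: Bx_def[symmetric] eq axis_in_Basis_iff)
  qed
  have sh: "integral (Bx l u) (\<lambda>x. f (x + s *\<^sub>R axis j 1)) = integral (Bx (l + s) (u + s)) f" for l u s
  proof -
    have "Bx l u = cbox ((\<chi> i. if i = j then l + s else 0) - s *\<^sub>R axis j 1)
        ((\<chi> i. if i = j then u + s else 2 * pi) - s *\<^sub>R axis j 1)"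
      unfolding Bx_def by (rule arg_cong2[of _ _ _ _ cbox]) (auto simp: vec_eq_iff axis_def)
    then show ?thesis
      using integral_shift_cbox[of "\<chi> i. if i = j then l + s else 0" "s *\<^sub>R axis j 1"
          "\<chi> i. if i = j then u + s else 2 * pi" f] by (simp add: Bx_def[of "l+s"])
  qed
  have cell: "period_cell = Bx 0 (2 * pi)"
    unfolding Bx_def period_cell_def by (rule arg_cong2[of _ _ _ _ cbox]) (auto simp: vec_eq_iff)
  have per': "(\<lambda>x. f (x + (2 * pi) *\<^sub>R axis j 1)) = f"
    using per by (auto simp: periodic_fun_def)
  have "integral (Bx (2 * pi) (t + 2 * pi)) f = integral (Bx 0 t) f"
    using sh[of 0 t "2 * pi"] unfolding per' by simp
  moreover have "integral (Bx t (2 * pi + t)) f = integral (Bx t (2 * pi)) f + integral (Bx (2 * pi) (t + 2 * pi)) f"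
    using split[of t "2 * pi" "2 * pi + t"] t by (simp add: add.commute)
  moreover have "integral (Bx 0 (2 * pi)) f = integral (Bx 0 t) f + integral (Bx t (2 * pi)) f"
    using split[of 0 t "2 * pi"] t by simp
  ultimately show ?thesis
    unfolding cell sh by (simp add: add.commute)
qed

lemma pderivative_along_axis:
  assumes "f differentiable (at (x + s *\<^sub>R axis j 1))"
  shows "((\<lambda>s. f (x + s *\<^sub>R axis j 1)) has_vector_derivative pderivative j f (x + s *\<^sub>R axis j 1)) (at s within S)"
proof -
  have 1: "(f has_derivative frechet_derivative f (at (x + s *\<^sub>R axis j 1))) (at (x + s *\<^sub>R axis j 1))"
    using assms frechet_derivative_works by blast
  have 2: "((\<lambda>s. x + s *\<^sub>R axis j 1) has_derivative (\<lambda>h. h *\<^sub>R axis j 1)) (at s within S)"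
    by (auto intro!: derivative_eq_intros)
  have lin: "linear (frechet_derivative f (at (x + s *\<^sub>R axis j 1)))"
    using 1 by (rule has_derivative_linear)
  have "((\<lambda>s. f (x + s *\<^sub>R axis j 1)) has_derivative
      (\<lambda>h. frechet_derivative f (at (x + s *\<^sub>R axis j 1)) (h *\<^sub>R axis j 1))) (at s within S)"
    using has_derivative_compose[OF 2 1] .
  then show ?thesis
    unfolding has_vector_derivative_def pderivative_def by (simp add: linear_scale[OF lin])
qed

text \<open>
  The integral of \<open>\<partial>\<^sub>jf\<close> along each full period in the direction \<open>j\<close> vanishes; averaging over all
  translates in that direction leaves the integral over the cell unchanged.
\<close>

lemma torus_integral_pderivative:
  fixes f :: "real^'d::finite \<Rightarrow> complex"
  assumes per: "periodic_fun f" and diff: "\<And>x. f differentiable (at x)"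
    and perD: "periodic_fun (pderivative j f)" and cont: "continuous_on UNIV (pderivative j f)"
  shows "torus_integral (pderivative j f) = 0"
proof -
  let ?D = "pderivative j f"
  have line: "((\<lambda>s. ?D (x + s *\<^sub>R axis j 1)) has_integral 0) (cbox 0 (2 * pi))" for x
  proof -
    have "((\<lambda>s. ?D (x + s *\<^sub>R axis j 1)) has_integral
        (f (x + (2 * pi) *\<^sub>R axis j 1) - f (x + 0 *\<^sub>R axis j 1))) {0..2 * pi}"
      by (rule fundamental_theorem_of_calculus) (auto intro!: pderivative_along_axis diff)
    then show ?thesis using per by (simp add: periodic_fun_def)
  qed
  have contin: "continuous_on (cbox (0, 0) ((\<chi> i. 2 * pi), 2 * pi)) (\<lambda>(x, s). ?D (x + s *\<^sub>R axis j 1))"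
    unfolding case_prod_beta
    by (intro continuous_on_compose2[OF cont] continuous_intros) auto
  have "0 = integral period_cell (\<lambda>x. integral (cbox 0 (2 * pi)) (\<lambda>s. ?D (x + s *\<^sub>R axis j 1)))"
    by (simp add: integral_unique[OF line] del: box_real)
  also have "\<dots> = integral (cbox 0 (2 * pi)) (\<lambda>s. integral period_cell (\<lambda>x. ?D (x + s *\<^sub>R axis j 1)))"
    unfolding period_cell_def by (rule integral_swap_continuous[OF contin])
  also have "\<dots> = integral (cbox 0 (2 * pi)) (\<lambda>s. integral period_cell ?D)"
    by (rule integral_cong) (auto intro!: integral_period_cell_shift[OF perD cont])
  also have "\<dots> = (2 * pi) *\<^sub>R integral period_cell ?D"
    by (simp del: scaleR_conv_of_real)
  finally have "integral period_cell ?D = 0" by simp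
  then show ?thesis by (simp add: torus_integral_eq_integral[OF cont])
qed

lemma efun_has_derivative:
  "(efun k has_derivative (\<lambda>h. \<i> * of_real (kvec k \<bullet> h) * efun k x)) (at x within S)"
proof -
  have 1: "((\<lambda>x. \<i> * complex_of_real (kvec k \<bullet> x)) has_derivative (\<lambda>h. \<i> * of_real (kvec k \<bullet> h))) (at x within S)"
    by (auto intro!: derivative_eq_intros)
  show ?thesis
    unfolding efun_def
    by (rule has_derivative_eq_rhs[OF has_derivative_mult_right[OF has_derivative_compose[OF 1 DERIV_exp[unfolded has_field_derivative_def]]]])
      (auto simp: algebra_simps)
qed

lemma pderivative_eqI: "(f has_derivative f') (at x) \<Longrightarrow> pderivative j f x = f' (axis j 1)"
  unfolding pderivative_def using frechet_derivative_at by metis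

lemma pderivative_efun: "pderivative j (efun k) = (\<lambda>x. \<i> * of_int (k $ j) * efun k x)"
  using pderivative_eqI[OF efun_has_derivative] by (auto simp: fun_eq_iff inner_axis)

lemma continuous_on_efun [continuous_intros]: "continuous_on S (efun k)"
  by (rule has_derivative_continuous_on[OF efun_has_derivative])

lemma efun_measurable [measurable]: "efun k \<in> borel_measurable borel"
  by (intro borel_measurable_continuous_onI continuous_on_efun)

lemma efun_differentiable: "efun k differentiable (at x within S)"
  unfolding differentiable_def by (rule exI, rule efun_has_derivative)

lemma periodic_efun: "periodic_fun (efun k)"
proof -
  have "exp (\<i> * of_real (kvec k \<bullet> (x + (2 * pi) *\<^sub>R axis i 1))) = exp (\<i> * of_real (kvec k \<bullet> x))" for x i
    by (subst exp_eq, rule exI[of _ "k $ i"]) (simp add: inner_add_right inner_axis algebra_simps)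
  then show ?thesis by (simp add: periodic_fun_def efun_def)
qed

lemma norm_efun: "norm (efun k (x::real^'d::finite)) = (2 * pi) powr (- real CARD('d) / 2)"
  by (simp add: efun_def norm_mult norm_exp_eq_Re)

lemma efun_mult:
  "efun k (x::real^'d::finite) * efun h x = of_real ((2 * pi) powr (- real CARD('d) / 2)) * efun (k + h) x"
  by (simp add: efun_def kvec_add inner_add_left algebra_simps exp_add)

lemma cnj_efun: "cnj (efun k x) = efun (- k) x"
  by (simp add: efun_def kvec_uminus exp_cnj)

lemma efun_0: "efun 0 (x::real^'d::finite) = of_real ((2 * pi) powr (- real CARD('d) / 2))"
  by (simp add: efun_def)

lemma torus_integral_efun:
  "torus_integral (efun (k::int^'d::finite)) = (if k = 0 then of_real ((2 * pi) powr (real CARD('d) / 2)) else 0)"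
proof (cases "k = 0")
  case True
  have "torus_integral (efun (0::int^'d)) = of_real ((2 * pi) powr (- real CARD('d) / 2) * (2 * pi) powr real CARD('d))"
    unfolding efun_0 using emeasure_period_cell_finite[where 'd='d]
    by (simp add: set_lebesgue_integral_def measure_period_cell powr_realpow scaleR_conv_of_real mult.commute)
  also have "\<dots> = of_real ((2 * pi) powr (real CARD('d) / 2))"
    by (subst powr_add[symmetric]) simp
  finally show ?thesis using True by simp
next
  case False
  then obtain j where j: "k $ j \<noteq> 0" by (auto simp: vec_eq_iff)
  have "torus_integral (pderivative j (efun k)) = 0"
    by (intro torus_integral_pderivative periodic_efun efun_differentiable)
      (auto simp: pderivative_efun intro!: continuous_intros periodic_efun,
       use periodic_efun[of k] in \<open>simp add: periodic_fun_def\<close>)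
  then show ?thesis using j False by (simp add: pderivative_efun)
qed

lemma torus_integral_efun_mult:
  "torus_integral (\<lambda>x. efun k x * efun h x) = (if k + h = 0 then 1 else 0)"
  unfolding efun_mult by (simp add: torus_integral_efun of_real_mult[symmetric] powr_add[symmetric] del: of_real_mult)

definition torus_coeff :: "(real^'d::finite \<Rightarrow> complex) \<Rightarrow> int^'d \<Rightarrow> complex" where
  "torus_coeff f k = torus_integral (\<lambda>x. f x * efun (- k) x)"

lemma torus_coeff_efun: "torus_coeff (efun k) h = (if k = h then 1 else 0)"
  by (simp add: torus_coeff_def torus_integral_efun_mult)

text \<open>
  Integration by parts: the integral of \<open>\<partial>\<^sub>j (f e\<^sub>-\<^sub>k)\<close> vanishes by periodicity.
\<close>

lemma torus_coeff_pderivative: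
  fixes f :: "real^'d::finite \<Rightarrow> complex"
  assumes per: "periodic_fun f" and diff: "\<And>x. f differentiable (at x)"
    and perD: "periodic_fun (pderivative j f)" and cont: "continuous_on UNIV (pderivative j f)"
  shows "torus_coeff (pderivative j f) k = \<i> * of_int (k $ j) * torus_coeff f k"
proof -
  let ?g = "\<lambda>x. f x * efun (- k) x"
  have contf: "continuous_on UNIV f"
    using diff by (auto simp: continuous_on_eq_continuous_within intro: differentiable_imp_continuous_within)
  have der: "(?g has_derivative (\<lambda>h. f x * (\<i> * of_real (kvec (- k) \<bullet> h) * efun (- k) x)
      + frechet_derivative f (at x) h * efun (- k) x)) (at x)" for x
    by (intro has_derivative_mult efun_has_derivative frechet_derivative_works[THEN iffD1] diff)
  have D: "pderivative j ?g = (\<lambda>x. pderivative j f x * efun (- k) x - (\<i> * of_int (k $ j)) * (f x * efun (- k) x))"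
    using pderivative_eqI[OF der] by (auto simp: fun_eq_iff inner_axis pderivative_def algebra_simps)
  have "torus_integral (pderivative j ?g) = 0"
  proof (rule torus_integral_pderivative)
    show "?g differentiable (at x)" for x unfolding differentiable_def by (rule exI, rule der)
  qed (use per perD periodic_efun[of "-k"] in \<open>auto simp: D periodic_fun_def intro!: continuous_intros cont contf\<close>)
  moreover have "set_integrable lborel period_cell (\<lambda>x. pderivative j f x * efun (- k) x)"
    "set_integrable lborel period_cell (\<lambda>x. (\<i> * of_int (k $ j)) * (f x * efun (- k) x))"
    by (intro set_integrable_period_cell continuous_intros cont contf)+
  ultimately show ?thesis
    unfolding D torus_coeff_def by (simp add: set_integral_diff)
qed

section \<open>An integrable function is determined by its Fourier coefficients\<close>

lemma AE_open_cell: "AE x in lborel. x \<in> period_cell \<longleftrightarrow> x \<in> box (0::real^'d::finite) (\<chi> i. 2 * pi)"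
proof -
  have "negligible (cbox 0 (\<chi> i. 2 * pi) - box (0::real^'d) (\<chi> i. 2 * pi))"
    by (rule negligible_frontier_interval)
  then have "AE x in lebesgue. x \<notin> cbox 0 (\<chi> i. 2 * pi) - box (0::real^'d) (\<chi> i. 2 * pi)"
    unfolding negligible_iff_null_sets by (rule AE_not_in)
  then have "AE x in lborel. x \<notin> cbox 0 (\<chi> i. 2 * pi) - box (0::real^'d) (\<chi> i. 2 * pi)"
    by (simp only: AE_completion_iff)
  then show ?thesis
    by (rule AE_mp) (use box_subset_cbox[of 0 "\<chi> i. (2 * pi :: real)"] in \<open>auto simp: period_cell_def\<close>)
qed

text \<open>
  If all Fourier coefficients of \<open>g\<close> vanish, this class contains the constants.  It is closed under
  multiplication by trigonometric functions and under bounded pointwise limits, hence it grows to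
  contain functions that agree on the cell with indicators of boxes; over these boxes \<open>g\<close> then has
  integral zero.
\<close>

definition annihilated :: "(real^'d::finite \<Rightarrow> complex) \<Rightarrow> (real^'d \<Rightarrow> complex) set" where
  "annihilated g = {\<phi>. \<phi> \<in> borel_measurable borel \<and> (\<exists>M. \<forall>x. norm (\<phi> x) \<le> M) \<and>
     (\<forall>k. (LINT x|lborel. g x * (\<phi> x * efun k x)) = 0)}"

lemma integrable_mult_bounded:
  fixes g \<phi> :: "real^'d::finite \<Rightarrow> complex"
  assumes g: "integrable lborel g" and \<phi>: "\<phi> \<in> borel_measurable borel" "\<And>x. norm (\<phi> x) \<le> M"
  shows "integrable lborel (\<lambda>x. g x * \<phi> x)"
proof (rule Bochner_Integration.integrable_bound)
  show "integrable lborel (\<lambda>x. M * norm (g x))" using g by simp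
  show "AE x in lborel. norm (g x * \<phi> x) \<le> norm (M * norm (g x))"
  proof (rule AE_I2)
    fix x
    have "norm (g x) * norm (\<phi> x) \<le> norm (g x) * \<bar>M\<bar>"
      using \<phi>(2)[of x] by (intro mult_left_mono) auto
    then show "norm (g x * \<phi> x) \<le> norm (M * norm (g x))" by (simp add: norm_mult abs_mult mult.commute)
  qed
qed (use \<phi> borel_measurable_integrable[OF g] in auto)

lemma integrable_annihilated:
  assumes "integrable lborel g" "\<phi> \<in> annihilated g"
  shows "integrable lborel (\<lambda>x. g x * (\<phi> x * efun k x))"
proof -
  obtain M where M: "\<And>x. norm (\<phi> x) \<le> M" and [measurable]: "\<phi> \<in> borel_measurable borel"
    using assms(2) by (auto simp: annihilated_def)
  have "norm (\<phi> x * efun k x) \<le> M * (2 * pi) powr (- real CARD('a) / 2)" for x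
    unfolding norm_mult norm_efun by (intro mult_right_mono M) auto
  then show ?thesis by (intro integrable_mult_bounded[OF assms(1)]) auto
qed

lemma annihilated_lincomb:
  assumes g: "integrable lborel g" and f: "f \<in> annihilated g" and h: "h \<in> annihilated g"
  shows "(\<lambda>x. a * f x + b * h x) \<in> annihilated g"
proof -
  obtain M N where M: "\<And>x. norm (f x) \<le> M" and N: "\<And>x. norm (h x) \<le> N"
    using f h by (auto simp: annihilated_def)
  have "norm (a * f x + b * h x) \<le> norm a * M + norm b * N" for x
    by (rule order_trans[OF norm_triangle_ineq])
      (auto simp: norm_mult intro!: add_mono mult_left_mono M N)
  moreover have "(LINT x|lborel. g x * ((a * f x + b * h x) * efun k x)) = 0" for k
  proof -
    have "(LINT x|lborel. g x * ((a * f x + b * h x) * efun k x))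
       = (LINT x|lborel. a * (g x * (f x * efun k x)) + b * (g x * (h x * efun k x)))"
      by (intro Bochner_Integration.integral_cong refl) (simp add: algebra_simps)
    also have "\<dots> = a * (LINT x|lborel. g x * (f x * efun k x)) + b * (LINT x|lborel. g x * (h x * efun k x))"
      using integrable_annihilated[OF g f, of k] integrable_annihilated[OF g h, of k] by simp
    also have "\<dots> = 0" using f h by (simp add: annihilated_def)
    finally show ?thesis .
  qed
  ultimately show ?thesis using f h unfolding annihilated_def by (auto intro!: exI[of _ "norm a * M + norm b * N"])
qed

text \<open>Multiplication by \<open>cos\<close> of a coordinate only shifts the frequencies.\<close>

lemma annihilated_times_cos:
  assumes g: "integrable lborel g" and f: "f \<in> annihilated g"
  shows "(\<lambda>x. f x * of_real (cos (x $ j - a) - c)) \<in> annihilated g"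
proof -
  obtain M where M: "\<And>x. norm (f x) \<le> M" and [measurable]: "f \<in> borel_measurable borel"
    using f by (auto simp: annihilated_def)
  have M0: "M \<ge> 0" using M[of undefined] norm_ge_zero order_trans by blast
  have "norm (f x * of_real (cos (x $ j - a) - c)) \<le> M * (1 + \<bar>c\<bar>)" for x
    unfolding norm_mult norm_of_real
    by (intro mult_mono M M0 order_trans[OF abs_triangle_ineq4] add_right_mono) auto
  moreover have "(LINT x|lborel. g x * ((f x * of_real (cos (x $ j - a) - c)) * efun k x)) = 0" for k
  proof -
    have shift: "exp (\<i> * of_real (x $ j)) * efun k x = efun (k + axis j 1) x"
      "exp (- (\<i> * of_real (x $ j))) * efun k x = efun (k - axis j 1) x" for x
    proof -
      have "kvec (axis j 1) = axis j 1" by (simp add: vec_eq_iff axis_def)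
      then have "kvec (axis j 1) \<bullet> x = x $ j" by (simp add: inner_axis')
      then show "exp (\<i> * of_real (x $ j)) * efun k x = efun (k + axis j 1) x"
        "exp (- (\<i> * of_real (x $ j))) * efun k x = efun (k - axis j 1) x"
        by (auto simp: efun_def kvec_add kvec_diff inner_add_left inner_diff_left exp_add exp_diff
          exp_minus algebra_simps divide_simps)
    qed
    have "of_real (cos (x $ j - a)) = (exp (- (\<i> * of_real a)) * exp (\<i> * of_real (x $ j))
        + exp (\<i> * of_real a) * exp (- (\<i> * of_real (x $ j)))) / 2" for x
      unfolding cos_of_real[symmetric] cos_exp_eq exp_add[symmetric] by (simp add: algebra_simps)
    then have "f x * of_real (cos (x $ j - a) - c) * efun k x
      = exp (- (\<i> * of_real a)) / 2 * (f x * (exp (\<i> * of_real (x $ j)) * efun k x))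
      + exp (\<i> * of_real a) / 2 * (f x * (exp (- (\<i> * of_real (x $ j))) * efun k x)) - c * (f x * efun k x)" for x
      by (simp add: field_simps)
    then have eq: "g x * (f x * of_real (cos (x $ j - a) - c) * efun k x)
      = exp (- (\<i> * of_real a)) / 2 * (g x * (f x * efun (k + axis j 1) x))
      + exp (\<i> * of_real a) / 2 * (g x * (f x * efun (k - axis j 1) x)) - c * (g x * (f x * efun k x))" for x
      unfolding shift by (simp add: algebra_simps)
    have "integrable lborel (\<lambda>x. g x * (f x * efun k x))" for k
      by (rule integrable_annihilated[OF g f])
    moreover have "(LINT x|lborel. g x * (f x * efun k x)) = 0" for k
      using f by (simp add: annihilated_def)
    ultimately show ?thesis unfolding eq by simp
  qed
  ultimately show ?thesis unfolding annihilated_def by auto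
qed

lemma annihilated_times_poly:
  assumes g: "integrable lborel g" and f: "f \<in> annihilated g" and q: "real_polynomial_function q"
  shows "(\<lambda>x. f x * of_real (q (cos (x $ j - a) - c))) \<in> annihilated g"
proof -
  obtain b n where q: "q = (\<lambda>t. \<Sum>i\<le>n. b i * t ^ i)"
    using q unfolding real_polynomial_function_iff_sum by blast
  have pow: "(\<lambda>x. f x * of_real ((cos (x $ j - a) - c) ^ i)) \<in> annihilated g" for i
  proof (induction i)
    case (Suc i)
    from annihilated_times_cos[OF g this, of j a c] show ?case by (simp add: mult_ac)
  qed (use f in simp)
  have "(\<lambda>x. f x * of_real (\<Sum>i\<le>m. b i * (cos (x $ j - a) - c) ^ i)) \<in> annihilated g" for m
  proof (induction m)
    case 0
    show ?case using annihilated_lincomb[OF g pow[of 0] pow[of 0], of "b 0" 0] by (simp add: mult_ac)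
  next
    case (Suc m)
    from annihilated_lincomb[OF g this pow[of "Suc m"], of 1 "b (Suc m)"]
    show ?case by (simp add: algebra_simps)
  qed
  then show ?thesis unfolding q .
qed

lemma annihilated_limit:
  assumes g: "integrable lborel g" and s: "\<And>n. s n \<in> annihilated g" and M: "\<And>n x. norm (s n x) \<le> M"
    and lim: "\<And>x. (\<lambda>n. s n x) \<longlonglongrightarrow> f x"
  shows "f \<in> annihilated g"
proof -
  have [measurable]: "s n \<in> borel_measurable borel" for n using s by (simp add: annihilated_def)
  have [measurable]: "f \<in> borel_measurable borel" using lim by (rule borel_measurable_LIMSEQ_metric[rotated]) simp
  have [measurable]: "g \<in> borel_measurable borel" using borel_measurable_integrable[OF g] by simp
  have "norm (f x) \<le> M" for x
    by (rule tendsto_upperbound[OF tendsto_norm[OF lim]]) (auto simp: M)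
  moreover have "(LINT x|lborel. g x * (f x * efun k x)) = 0" for k
  proof -
    have "(\<lambda>n. LINT x|lborel. g x * (s n x * efun k x)) \<longlonglongrightarrow> (LINT x|lborel. g x * (f x * efun k x))"
    proof (rule integral_dominated_convergence)
      let ?c = "(2 * pi) powr (- real CARD('a) / 2)"
      show "integrable lborel (\<lambda>x. norm (g x) * (M * ?c))" using g by simp
      show "AE x in lborel. norm (g x * (s n x * efun k x)) \<le> norm (g x) * (M * ?c)" for n
        unfolding norm_mult norm_efun by (intro AE_I2 mult_left_mono mult_right_mono M) auto
      show "AE x in lborel. (\<lambda>n. g x * (s n x * efun k x)) \<longlonglongrightarrow> g x * (f x * efun k x)"
        by (intro AE_I2 tendsto_intros lim)
    qed measurable
    moreover have "(LINT x|lborel. g x * (s n x * efun k x)) = 0" for n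
      using s by (simp add: annihilated_def)
    ultimately show ?thesis by (simp add: LIMSEQ_const_iff)
  qed
  ultimately show ?thesis unfolding annihilated_def by auto
qed

text \<open>
  Polynomials converging boundedly to the Heaviside function, evaluated at
  \<open>cos (x\<^sub>j - a) - c\<close>, cut out an arc of the \<open>j\<close>-th circle.
\<close>

lemma annihilated_times_arc:
  assumes g: "integrable lborel g" and f: "f \<in> annihilated g" and c: "\<bar>c\<bar> \<le> 1"
  shows "(\<lambda>x. f x * of_bool (cos (x $ j - a) > c)) \<in> annihilated g"
proof -
  \<comment> \<open>For every \<open>t\<close>, \<open>ramp n t\<close> converges to the indicator of \<open>t > 0\<close>, also at \<open>t = 0\<close>.\<close>
  define ramp where "ramp n t = max 0 (min 1 (real n * t))" for n and t :: real
  have "\<exists>q. real_polynomial_function q \<and> (\<forall>t\<in>{-2..2}. \<bar>ramp n t - q t\<bar> < 1 / real (Suc n))" for n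
  proof -
    have "continuous_on {-2..2} (ramp n)" unfolding ramp_def by (intro continuous_intros)
    then show ?thesis
      using Stone_Weierstrass_real_polynomial_function[of "{-2..2::real}" "ramp n" "1 / real (Suc n)"]
      by (metis compact_Icc of_nat_0_less_iff zero_less_Suc zero_less_divide_1_iff)
  qed
  then obtain q where q: "\<And>n. real_polynomial_function (q n)"
    and qr: "\<And>n t. t \<in> {-2..2} \<Longrightarrow> \<bar>ramp n t - q n t\<bar> < 1 / real (Suc n)" by metis
  obtain M where M: "\<And>x. norm (f x) \<le> M" using f by (auto simp: annihilated_def)
  have M0: "M \<ge> 0" using M[of undefined] norm_ge_zero order_trans by blast
  have in2: "cos (x $ j - a) - c \<in> {-2..2}" for x
    using c cos_le_one[of "x $ j - a"] cos_ge_minus_one[of "x $ j - a"]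
    unfolding atLeastAtMost_iff by linarith
  show ?thesis
  proof (rule annihilated_limit[OF g])
    show "(\<lambda>x. f x * of_real (q n (cos (x $ j - a) - c))) \<in> annihilated g" for n
      by (rule annihilated_times_poly[OF g f q])
    show "norm (f x * of_real (q n (cos (x $ j - a) - c))) \<le> M * 2" for n x
    proof -
      have "1 / real (Suc n) \<le> 1" by simp
      moreover have "\<bar>ramp n t\<bar> \<le> 1" for t by (auto simp: ramp_def)
      ultimately have "\<bar>q n (cos (x $ j - a) - c)\<bar> \<le> 2"
        using qr[OF in2[of x], of n] by (smt (verit, best))
      then show ?thesis unfolding norm_mult norm_of_real by (intro mult_mono M M0) auto
    qed
    show "(\<lambda>n. f x * of_real (q n (cos (x $ j - a) - c))) \<longlonglongrightarrow> f x * of_bool (cos (x $ j - a) > c)" for x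
    proof -
      define t where "t = cos (x $ j - a) - c"
      have "(\<lambda>n. ramp n t) \<longlonglongrightarrow> of_bool (t > 0)"
      proof (cases "t > 0")
        case True
        obtain N where "1 < real N * t" using reals_Archimedean3[OF True] by blast
        have "ramp n t = 1" if "n \<ge> N" for n
        proof -
          have "real N * t \<le> real n * t" using that True by (intro mult_right_mono) auto
          then show ?thesis using \<open>1 < real N * t\<close> by (simp add: ramp_def)
        qed
        then show ?thesis using True
          by (intro tendsto_eventually) (auto simp: eventually_sequentially)
      next
        case False
        then have "real n * t \<le> 0" for n by (intro mult_nonneg_nonpos) auto
        then have "ramp n t = 0" for n unfolding ramp_def using min.coboundedI2 max.absorb1 by blast
        then show ?thesis using False by simp
      qed
      moreover have "(\<lambda>n. ramp n t - q n t) \<longlonglongrightarrow> 0"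
        by (rule Lim_null_comparison[OF _ lim_1_over_n[THEN LIMSEQ_Suc]])
          (use qr[OF in2[of x]] in \<open>auto simp: t_def intro!: always_eventually less_imp_le\<close>)
      ultimately have "(\<lambda>n. ramp n t - (ramp n t - q n t)) \<longlonglongrightarrow> of_bool (t > 0) - 0"
        by (rule tendsto_diff)
      then have "(\<lambda>n. q n t) \<longlonglongrightarrow> of_bool (t > 0)" by simp
      then have "(\<lambda>n. f x * of_real (q n t)) \<longlonglongrightarrow> f x * of_real (of_bool (t > 0))"
        by (intro tendsto_intros)
      then show ?thesis unfolding t_def by (cases "cos (x $ j - a) > c") simp_all
    qed
  qed
qed

text \<open>
  The arc around the midpoint of \<open>[l, u]\<close> does not wrap around within the cell: a point of
  \<open>(0, 2\<pi>)\<close> has distance less than \<open>2\<pi> - (u - l) / 2\<close> from the midpoint.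
\<close>

lemma arc_eq_interval:
  assumes "0 \<le> l" "l \<le> u" "u \<le> 2 * pi" "0 < x" "x < 2 * pi"
  shows "cos (x - (l + u) / 2) > cos ((u - l) / 2) \<longleftrightarrow> l < x \<and> x < u"
proof -
  define y where "y = \<bar>x - (l + u) / 2\<bar>"
  define b where "b = (u - l) / 2"
  have b: "0 \<le> b" "b \<le> pi" using assms by (auto simp: b_def)
  have y: "0 \<le> y" "y \<le> 2 * pi - b" using assms by (auto simp: y_def b_def field_simps abs_if)
  have "l < x \<and> x < u \<longleftrightarrow> y < b" by (auto simp: y_def b_def field_simps abs_if)
  moreover have "cos y > cos b \<longleftrightarrow> y < b"
  proof (cases "y \<le> pi")
    case True
    then show ?thesis using cos_mono_less_eq[of b y] b y by auto
  next
    case False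
    then have "cos (2 * pi - y) \<le> cos b" using b y by (intro cos_monotone_0_pi_le) auto
    then show ?thesis using False b by (simp add: cos_diff)
  qed
  moreover have "cos (x - (l + u) / 2) = cos y" by (simp add: y_def cos_abs_real)
  ultimately show ?thesis by (simp add: b_def)
qed

text \<open>
  Products of such arcs are the boxes inside the cell, so the integrals over all boxes vanish; boxes
  generate the Borel sets.
\<close>

theorem AE_eq_0_if_coeffs_eq_0:
  fixes h :: "real^'d::finite \<Rightarrow> complex"
  assumes h: "set_integrable lborel period_cell h" and coeff: "\<And>k. torus_coeff h k = 0"
  shows "AE x in lborel. x \<in> period_cell \<longrightarrow> h x = 0"
proof -
  let ?C = "box (0::real^'d) (\<chi> i. 2 * pi)"
  define g where "g x = indicator ?C x *\<^sub>R h x" for x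
  have hm: "(\<lambda>x. indicator period_cell x *\<^sub>R h x) \<in> borel_measurable borel"
    using borel_measurable_integrable h unfolding set_integrable_def by fastforce
  have AEg: "AE x in lborel. indicator period_cell x *\<^sub>R h x = g x"
    using AE_open_cell by (rule AE_mp) (auto simp: g_def indicator_def)
  have Csub: "?C \<subseteq> period_cell" by (simp add: period_cell_def box_subset_cbox)
  have "(\<lambda>x. indicator ?C x *\<^sub>R (indicator period_cell x *\<^sub>R h x)) \<in> borel_measurable borel"
    using hm by measurable
  moreover have "(\<lambda>x. indicator ?C x *\<^sub>R (indicator period_cell x *\<^sub>R h x)) = g"
    using Csub by (auto simp: g_def fun_eq_iff indicator_def)
  ultimately have gm [measurable]: "g \<in> borel_measurable borel" by simp
  have g: "integrable lborel g"
    using h integrable_cong_AE[OF _ _ AEg] hm unfolding set_integrable_def by simp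
  have one: "(\<lambda>x. 1) \<in> annihilated g"
  proof -
    have "(LINT x|lborel. g x * (1 * efun k x)) = torus_coeff h (- k)" for k
      unfolding torus_coeff_def set_lebesgue_integral_def
    proof (rule integral_cong_AE)
      show "AE x in lborel. g x * (1 * efun k x) = indicator period_cell x *\<^sub>R (h x * efun (- (- k)) x)"
        using AEg by (rule AE_mp) (auto intro!: AE_I2 simp: indicator_def)
      have "(\<lambda>x. (indicator period_cell x *\<^sub>R h x) * efun k x) \<in> borel_measurable borel"
        using hm by measurable
      then show "(\<lambda>x. indicator period_cell x *\<^sub>R (h x * efun (- (- k)) x)) \<in> borel_measurable lborel"
        by simp
    qed measurable
    then show ?thesis using coeff by (auto simp: annihilated_def intro: exI[of _ 1])
  qed
  have box0: "(LINT x:box l u|lborel. g x) = 0" if lu: "\<And>j. 0 \<le> l $ j" "\<And>j. l $ j \<le> u $ j" "\<And>j. u $ j \<le> 2 * pi" for l u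
  proof -
    let ?arc = "\<lambda>j x. of_bool (cos (x $ j - (l $ j + u $ j) / 2) > cos ((u $ j - l $ j) / 2)) :: complex"
    have "(\<lambda>x. \<Prod>j\<in>J. ?arc j x) \<in> annihilated g" if "finite J" for J
      using that
    proof (induction J)
      case (insert j J)
      from annihilated_times_arc[OF g insert.IH, of "cos ((u $ j - l $ j) / 2)" j "(l $ j + u $ j) / 2"]
      show ?case using insert(1,2) by (simp add: mult_ac)
    qed (use one in simp)
    from this[of UNIV] have "(LINT x|lborel. g x * ((\<Prod>j\<in>UNIV. ?arc j x) * efun 0 x)) = 0"
      by (simp add: annihilated_def)
    then have "(LINT x|lborel. g x * (\<Prod>j\<in>UNIV. ?arc j x)) * of_real ((2 * pi) powr (- real CARD('d) / 2)) = 0"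
      by (simp add: efun_0 mult.assoc[symmetric])
    then have "(LINT x|lborel. g x * (\<Prod>j\<in>UNIV. ?arc j x)) = 0" by simp
    moreover have "g x * (\<Prod>j\<in>UNIV. ?arc j x) = indicator (box l u) x *\<^sub>R g x" for x
    proof (cases "x \<in> ?C")
      case True
      then have "0 < x $ j" "x $ j < 2 * pi" for j by (auto simp: mem_box_cart)
      then have "?arc j x = of_bool (l $ j < x $ j \<and> x $ j < u $ j)" for j
        using arc_eq_interval[OF lu] by simp
      moreover have "(\<Prod>j\<in>UNIV. of_bool (l $ j < x $ j \<and> x $ j < u $ j)) = (of_bool (x \<in> box l u) :: complex)"
        by (auto simp: mem_box_cart prod_zero_iff)
      ultimately show ?thesis by (simp add: indicator_def)
    qed (simp add: g_def)
    ultimately show ?thesis by (simp add: set_lebesgue_integral_def)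
  qed
  have box: "(LINT x:box a b|lborel. g x) = 0" for a b
  proof -
    let ?l = "\<chi> j. max (a $ j) 0" and ?u = "\<chi> j. min (b $ j) (2 * pi)"
    have "indicator (box a b) x *\<^sub>R g x = indicator (box ?l ?u) x *\<^sub>R g x" for x
      by (auto simp: g_def indicator_def mem_box_cart)
    then have eq: "(LINT x:box a b|lborel. g x) = (LINT x:box ?l ?u|lborel. g x)"
      unfolding set_lebesgue_integral_def by (simp only:)
    show ?thesis
    proof (cases "\<forall>j. ?l $ j \<le> ?u $ j")
      case True
      then show ?thesis unfolding eq by (intro box0) auto
    next
      case False
      then obtain j where j: "?u $ j < ?l $ j" using not_le by blast
      have "x \<notin> box ?l ?u" for x
      proof
        assume "x \<in> box ?l ?u"
        then have "?l $ j < x $ j" "x $ j < ?u $ j" unfolding mem_box_cart by blast+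
        with j show False by linarith
      qed
      then have "box ?l ?u = {}" by blast
      then show ?thesis unfolding eq by (simp add: set_lebesgue_integral_def)
    qed
  qed
  have all: "(LINT x|lborel. g x) = 0"
  proof -
    have "(LINT x|lborel. g x * (1 * efun 0 x)) = 0" using one by (simp add: annihilated_def)
    then show ?thesis by (simp add: efun_0)
  qed
  have "(LINT x:A|lborel. g x) = 0" if "A \<in> sets lborel" for A
  proof -
    have G: "Int_stable (range (\<lambda>(a, b). box a b :: (real^'d) set))"
      by (auto simp: Int_stable_def box_Int_box)
    have A: "A \<in> sigma_sets UNIV (range (\<lambda>(a, b). box a b))"
      using that by (simp add: borel_eq_box)
    have sets: "B \<in> sets borel" if "B \<in> sigma_sets UNIV (range (\<lambda>(a, b). box a b :: (real^'d) set))" for B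
      using that by (simp add: borel_eq_box)
    have int: "integrable lborel (\<lambda>x. indicator B x *\<^sub>R g x)" if "B \<in> sets borel" for B
      using g that by (intro integrable_mult_indicator) auto
    show ?thesis
    proof (rule sigma_sets_induct_disjoint[OF G _ A])
      fix B assume B: "B \<in> sigma_sets UNIV (range (\<lambda>(a, b). box a b :: (real^'d) set))"
        and 0: "(LINT x:B|lborel. g x) = 0"
      have "indicator (UNIV - B) x *\<^sub>R g x = g x - indicator B x *\<^sub>R g x" for x
        by (simp add: indicator_def)
      then show "(LINT x:UNIV - B|lborel. g x) = 0"
        using 0 all g int[OF sets[OF B]] by (simp add: set_lebesgue_integral_def)
    next
      fix F :: "nat \<Rightarrow> (real^'d) set"
      assume F: "disjoint_family F" "range F \<subseteq> sigma_sets UNIV (range (\<lambda>(a, b). box a b))"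
        and 0: "\<And>i. (LINT x:F i|lborel. g x) = 0"
      have S: "F i \<in> sets borel" for i using F(2) sets by blast
      have "(LINT x:(\<Union>i. F i)|lborel. g x) = (\<Sum>i. (LINT x:F i|lborel. g x))"
        by (rule lebesgue_integral_countable_add)
          (use F S int in \<open>auto simp: disjoint_family_on_def set_integrable_def\<close>)
      then show "(LINT x:(\<Union>i. F i)|lborel. g x) = 0" by (simp add: 0)
    qed (use box in \<open>auto simp: set_lebesgue_integral_def\<close>)
  qed
  then have "AE x in lborel. g x = 0" by (rule sigma_finite_measure.density_zero[OF sigma_finite_lborel g])
  with AEg show ?thesis by eventually_elim (auto simp: indicator_def)
qed

text \<open>
  The open set where \<open>f\<close> does not vanish would meet the interior of the cell in a set of positive
  measure.
\<close>

lemma eq_0_if_coeffs_eq_0: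
  fixes f :: "real^'d::finite \<Rightarrow> complex"
  assumes per: "periodic_fun f" and cont: "continuous_on UNIV f" and coeff: "\<And>k. torus_coeff f k = 0"
  shows "f x = 0"
proof (rule ccontr)
  assume nz: "f x \<noteq> 0"
  obtain y where y: "y \<in> period_cell" "f x = f y" by (rule periodic_fun_reduce[OF per])
  let ?C = "box (0::real^'d) (\<chi> i. 2 * pi)"
  have o: "open {z. f z \<noteq> 0}"
    using open_vimage[OF open_delete[OF open_UNIV, of 0] cont] by (simp add: vimage_def)
  have ne: "?C \<noteq> {}" by (auto simp: box_ne_empty Basis_vec_def inner_axis)
  have "y \<in> closure ?C" using y(1) closure_box[OF ne] by (simp add: period_cell_def)
  then have ne2: "?C \<inter> {z. f z \<noteq> 0} \<noteq> {}"
    using o nz y(2) open_Int_closure_eq_empty[OF o, of ?C] by auto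
  have "open (?C \<inter> {z. f z \<noteq> 0})" using o by auto
  then have "\<not> negligible (?C \<inter> {z. f z \<noteq> 0})" using open_not_negligible ne2 by blast
  moreover have "AE x in lborel. x \<in> period_cell \<longrightarrow> f x = 0"
    by (rule AE_eq_0_if_coeffs_eq_0[OF set_integrable_period_cell[OF cont] coeff])
  then have "AE x in lborel. x \<notin> ?C \<inter> {z. f z \<noteq> 0}"
    by (rule AE_mp) (use box_subset_cbox[of 0 "\<chi> i. (2 * pi :: real)"] in \<open>auto simp: period_cell_def\<close>)
  then have "AE x in lebesgue. x \<notin> ?C \<inter> {z. f z \<noteq> 0}" by (simp only: AE_completion_iff)
  then have "negligible (?C \<inter> {z. f z \<noteq> 0})"
    using o by (simp add: negligible_iff_null_sets AE_iff_null_sets)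
  ultimately show False by blast
qed

section \<open>Fourier series of test functions\<close>

abbreviation derivs_bounded :: "nat \<Rightarrow> (real^'d::finite \<Rightarrow> complex) \<Rightarrow> real \<Rightarrow> bool" where
  "derivs_bounded m \<phi> M \<equiv> \<forall>is x. length is \<le> m \<longrightarrow> norm (foldr pderivative is \<phi> x) \<le> M"

lemma efun_shift [simp]: "efun k (x + (2 * pi) *\<^sub>R axis i 1) = efun k x"
  using periodic_efun[of k] by (simp add: periodic_fun_def)

lemma periodic_pderivative:
  fixes f :: "real^'d::finite \<Rightarrow> complex"
  assumes per: "periodic_fun f" and diff: "\<And>x. f differentiable (at x)"
  shows "periodic_fun (pderivative j f)"
  unfolding periodic_fun_def
proof (intro allI)
  fix x :: "real^'d" and i
  let ?c = "(2 * pi) *\<^sub>R axis i 1 :: real^'d"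
  have 1: "((\<lambda>y. y + ?c) has_derivative (\<lambda>h. h)) (at x)"
    by (auto intro!: derivative_eq_intros)
  have 2: "(f has_derivative frechet_derivative f (at (x + ?c))) (at (x + ?c))"
    using diff frechet_derivative_works by blast
  have "(\<lambda>y. f (y + ?c)) = f" using per by (simp add: periodic_fun_def)
  then have D: "(f has_derivative frechet_derivative f (at (x + ?c))) (at x)"
    using has_derivative_compose[OF 1 2] by simp
  show "pderivative j f (x + ?c) = pderivative j f x"
    unfolding pderivative_eqI[OF D] by (simp add: pderivative_def)
qed

lemma test_funs_periodic: "\<phi> \<in> test_funs \<Longrightarrow> periodic_fun \<phi>"
  by (simp add: test_funs_def)

lemma test_funs_foldr_differentiable:
  "\<phi> \<in> test_funs \<Longrightarrow> foldr pderivative is \<phi> differentiable (at x)"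
  by (simp add: test_funs_def differentiable_on_def)

lemma test_funs_differentiable: "\<phi> \<in> test_funs \<Longrightarrow> \<phi> differentiable (at x)"
  using test_funs_foldr_differentiable[of \<phi> "[]"] by simp

lemma test_funs_pderivative:
  assumes "\<phi> \<in> test_funs" shows "pderivative j \<phi> \<in> test_funs"
proof -
  have "foldr pderivative is (pderivative j \<phi>) differentiable_on UNIV" for "is"
    using assms unfolding test_funs_def by (auto dest!: spec[of _ "is @ [j]"])
  then show ?thesis
    using assms periodic_pderivative[OF test_funs_periodic test_funs_differentiable]
    by (simp add: test_funs_def)
qed

lemma test_funs_foldr: "\<phi> \<in> test_funs \<Longrightarrow> foldr pderivative is \<phi> \<in> test_funs"
  by (induction "is") (auto intro: test_funs_pderivative)

lemma test_funs_continuous: "\<phi> \<in> test_funs \<Longrightarrow> continuous_on S \<phi>"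
  by (meson test_funs_differentiable continuous_at_imp_continuous_on differentiable_imp_continuous_within)

lemma foldr_pderivative_lincomb:
  assumes "\<phi> \<in> test_funs" "\<psi> \<in> test_funs"
  shows "foldr pderivative is (\<lambda>x. a * \<phi> x + b * \<psi> x)
    = (\<lambda>x. a * foldr pderivative is \<phi> x + b * foldr pderivative is \<psi> x)"
proof (induction "is")
  case (Cons i "is")
  let ?f = "foldr pderivative is \<phi>" and ?g = "foldr pderivative is \<psi>"
  have "((\<lambda>x. a * ?f x + b * ?g x) has_derivative
      (\<lambda>h. a * frechet_derivative ?f (at x) h + b * frechet_derivative ?g (at x) h)) (at x)" for x
    by (intro has_derivative_add has_derivative_mult_right frechet_derivative_works[THEN iffD1]
        test_funs_foldr_differentiable assms)
  then have "pderivative i (\<lambda>x. a * ?f x + b * ?g x) x = a * pderivative i ?f x + b * pderivative i ?g x" for x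
    unfolding pderivative_eqI[OF \<open>\<And>x. (_ has_derivative _) (at x)\<close>] by (simp add: pderivative_def)
  then show ?case by (simp add: Cons fun_eq_iff)
qed simp

lemma foldr_pderivative_cnj:
  assumes "\<phi> \<in> test_funs"
  shows "foldr pderivative is (\<lambda>x. cnj (\<phi> x)) = (\<lambda>x. cnj (foldr pderivative is \<phi> x))"
proof (induction "is")
  case (Cons i "is")
  let ?f = "foldr pderivative is \<phi>"
  have "((\<lambda>x. cnj (?f x)) has_derivative (\<lambda>h. cnj (frechet_derivative ?f (at x) h))) (at x)" for x
    by (intro bounded_linear.has_derivative[OF bounded_linear_cnj] frechet_derivative_works[THEN iffD1]
        test_funs_foldr_differentiable assms)
  then have "pderivative i (\<lambda>x. cnj (?f x)) x = cnj (pderivative i ?f x)" for x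
    unfolding pderivative_eqI[OF \<open>\<And>x. (_ has_derivative _) (at x)\<close>] by (simp add: pderivative_def)
  then show ?case by (simp add: Cons fun_eq_iff)
qed simp

lemma foldr_pderivative_efun:
  "foldr pderivative is (efun k) = (\<lambda>x. (\<Prod>i\<leftarrow>is. \<i> * of_int (k $ i)) * efun k x)"
proof (induction "is")
  case (Cons i "is")
  have "((\<lambda>x. (\<Prod>i\<leftarrow>is. \<i> * of_int (k $ i)) * efun k x) has_derivative
    (\<lambda>h. (\<Prod>i\<leftarrow>is. \<i> * of_int (k $ i)) * (\<i> * of_real (kvec k \<bullet> h) * efun k x))) (at x)" for x
    by (intro has_derivative_mult_right efun_has_derivative)
  from pderivative_eqI[OF this] show ?case by (simp add: Cons fun_eq_iff inner_axis)
qed simp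

lemma test_funs_lincomb:
  assumes "\<phi> \<in> test_funs" "\<psi> \<in> test_funs"
  shows "(\<lambda>x. a * \<phi> x + b * \<psi> x) \<in> test_funs"
  using test_funs_periodic[OF assms(1)] test_funs_periodic[OF assms(2)]
  unfolding test_funs_def
  by (auto simp: foldr_pderivative_lincomb[OF assms] periodic_fun_def differentiable_on_def
      intro!: differentiable_add differentiable_mult test_funs_foldr_differentiable assms)

lemma test_funs_cnj:
  assumes "\<phi> \<in> test_funs" shows "(\<lambda>x. cnj (\<phi> x)) \<in> test_funs"
proof -
  have "(\<lambda>x. cnj (foldr pderivative is \<phi> x)) differentiable (at x)" for "is" x
    using bounded_linear.has_derivative[OF bounded_linear_cnj
        test_funs_foldr_differentiable[OF assms, unfolded frechet_derivative_works]]
    unfolding differentiable_def by blast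
  then show ?thesis
    using test_funs_periodic[OF assms] unfolding test_funs_def
    by (auto simp: foldr_pderivative_cnj[OF assms] periodic_fun_def differentiable_on_def)
qed

lemma efun_in_test_funs: "efun k \<in> test_funs"
  using periodic_efun
  by (auto simp: test_funs_def foldr_pderivative_efun differentiable_on_def
      intro!: differentiable_mult efun_differentiable)

lemma test_funs_scale: "\<phi> \<in> test_funs \<Longrightarrow> (\<lambda>x. a * \<phi> x) \<in> test_funs"
  using test_funs_lincomb[of \<phi> \<phi> a 0] by simp

lemma test_funs_sum_efun: "(\<lambda>x. \<Sum>k\<in>F. a k * efun k x) \<in> test_funs"
proof (induction F rule: infinite_finite_induct)
  case (insert k F)
  then show ?case using test_funs_lincomb[OF efun_in_test_funs insert.IH, of "a k" k 1] by simp
qed (use test_funs_scale[OF efun_in_test_funs, of 0] in auto)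

lemma test_funs_derivs_bounded:
  assumes "\<phi> \<in> test_funs" obtains M where "derivs_bounded m \<phi> M"
proof -
  have "\<exists>M. \<forall>x. norm (foldr pderivative is \<phi> x) \<le> M" for "is"
    using periodic_fun_bounded[OF test_funs_periodic[OF test_funs_foldr[OF assms]]
        test_funs_continuous[OF test_funs_foldr[OF assms]]] by metis
  then obtain B where B: "\<And>is x. norm (foldr pderivative is \<phi> x) \<le> B is" by metis
  have B0: "B is \<ge> 0" for "is" using B[of "is" undefined] norm_ge_zero order_trans by blast
  have fin: "finite {is :: 'a list. length is \<le> m}"
    using finite_lists_length_le[of "UNIV :: 'a set" m] by simp
  have "derivs_bounded m \<phi> (\<Sum>is | length is \<le> m. B is)"
  proof (intro allI impI)
    fix "is" :: "'a list" and x assume "length is \<le> m"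
    then have "B is \<le> (\<Sum>is | length is \<le> m. B is)"
      using member_le_sum[OF _ _ fin, of "is" B] B0 by simp
    then show "norm (foldr pderivative is \<phi> x) \<le> (\<Sum>is | length is \<le> m. B is)"
      using B[of "is" x] by linarith
  qed
  then show ?thesis using that by blast
qed

lemma norm_torus_coeff_le:
  fixes f :: "real^'d::finite \<Rightarrow> complex"
  assumes cont: "continuous_on UNIV f" and M: "\<And>x. norm (f x) \<le> M"
  shows "norm (torus_coeff f k) \<le> M * (2 * pi) powr (real CARD('d) / 2)"
proof -
  let ?c = "(2 * pi) powr (- real CARD('d) / 2)"
  have "norm (torus_coeff f k) \<le> (LINT x:(period_cell :: (real^'d) set)|lborel. M * ?c)"
    unfolding torus_coeff_def set_lebesgue_integral_def
  proof (rule Bochner_Integration.integral_norm_bound_integral)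
    show "integrable lborel (\<lambda>x. indicat_real period_cell x *\<^sub>R (f x * efun (- k) x))"
      using set_integrable_period_cell[of "\<lambda>x. f x * efun (- k) x"]
      by (simp add: set_integrable_def continuous_intros cont)
    show "integrable lborel (\<lambda>x::real^'d. indicat_real period_cell x *\<^sub>R (M * ?c))"
      using set_integrable_period_cell[of "\<lambda>x::real^'d. M * ?c"]
      by (simp add: set_integrable_def)
  qed (auto simp: indicator_def norm_mult norm_efun intro!: mult_right_mono M)
  also have "\<dots> = M * (?c * (2 * pi) powr real CARD('d))"
    using emeasure_period_cell_finite[where 'd='d]
    by (simp add: set_lebesgue_integral_def measure_period_cell powr_realpow mult_ac)
  also have "\<dots> = M * (2 * pi) powr (real CARD('d) / 2)"
    by (subst powr_add[symmetric]) simp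
  finally show ?thesis .
qed

lemma torus_coeff_foldr_pderivative:
  assumes "\<phi> \<in> test_funs"
  shows "torus_coeff (foldr pderivative is \<phi>) k = (\<Prod>i\<leftarrow>is. \<i> * of_int (k $ i)) * torus_coeff \<phi> k"
proof (induction "is")
  case (Cons i "is")
  have t: "foldr pderivative is \<phi> \<in> test_funs" by (rule test_funs_foldr[OF assms])
  note t' = test_funs_pderivative[OF t, of i]
  have "torus_coeff (pderivative i (foldr pderivative is \<phi>)) k = \<i> * of_int (k $ i) * torus_coeff (foldr pderivative is \<phi>) k"
    by (intro torus_coeff_pderivative test_funs_periodic t t' test_funs_continuous test_funs_differentiable)
  then show ?case by (simp add: Cons)
qed simp

text \<open>Differentiating \<open>m\<close> times in the direction of the largest component of \<open>k\<close>.\<close>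

lemma torus_coeff_decay:
  fixes \<phi> :: "real^'d::finite \<Rightarrow> complex"
  assumes \<phi>: "\<phi> \<in> test_funs" and M: "derivs_bounded m \<phi> M"
  shows "norm (torus_coeff \<phi> k) * norm (kvec k) ^ m
    \<le> real CARD('d) ^ m * (2 * pi) powr (real CARD('d) / 2) * M"
proof -
  obtain j where j: "\<And>i. \<bar>k $ i\<bar> \<le> \<bar>k $ j\<bar>"
    using Max_in[of "range (\<lambda>i. \<bar>k $ i\<bar>)"] Max_ge[of "range (\<lambda>i. \<bar>k $ i\<bar>)"]
    by (metis (mono_tags, lifting) UNIV_not_empty empty_is_image finite finite_imageI rangeE rangeI)
  have "norm (kvec k) \<le> (\<Sum>i\<in>UNIV. \<bar>kvec k $ i\<bar>)" by (rule norm_le_l1_cart)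
  also have "\<dots> \<le> (\<Sum>i\<in>(UNIV::'d set). \<bar>real_of_int (k $ j)\<bar>)"
    using j by (intro sum_mono) (simp add: of_int_abs[symmetric] del: of_int_abs)
  finally have k: "norm (kvec k) \<le> real CARD('d) * \<bar>real_of_int (k $ j)\<bar>" by simp
  let ?is = "replicate m j"
  have "norm (\<Prod>i\<leftarrow>?is. \<i> * of_int (k $ i) :: complex) = \<bar>real_of_int (k $ j)\<bar> ^ m"
    by (induction m) (auto simp: norm_mult)
  then have "norm (torus_coeff \<phi> k) * \<bar>real_of_int (k $ j)\<bar> ^ m = norm (torus_coeff (foldr pderivative ?is \<phi>) k)"
    by (simp only: torus_coeff_foldr_pderivative[OF \<phi>] norm_mult mult.commute)
  also have "\<dots> \<le> M * (2 * pi) powr (real CARD('d) / 2)"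
    by (intro norm_torus_coeff_le test_funs_continuous test_funs_foldr \<phi> M[rule_format]) simp
  finally have *: "norm (torus_coeff \<phi> k) * \<bar>real_of_int (k $ j)\<bar> ^ m \<le> M * (2 * pi) powr (real CARD('d) / 2)" .
  have "norm (torus_coeff \<phi> k) * norm (kvec k) ^ m
    \<le> norm (torus_coeff \<phi> k) * (real CARD('d) * \<bar>real_of_int (k $ j)\<bar>) ^ m"
    by (intro mult_left_mono power_mono k) auto
  also have "\<dots> = real CARD('d) ^ m * (norm (torus_coeff \<phi> k) * \<bar>real_of_int (k $ j)\<bar> ^ m)"
    by (simp add: power_mult_distrib mult_ac)
  also have "\<dots> \<le> real CARD('d) ^ m * (M * (2 * pi) powr (real CARD('d) / 2))"
    by (intro mult_left_mono *) auto
  finally show ?thesis by (simp add: mult_ac)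
qed

text \<open>Of the \<open>m + d + 1\<close> powers of \<open>|k|\<close> gained by differentiating, \<open>d + 1\<close> are spent on summability
  over the lattice.\<close>

lemma weighted_le_lattice_powr:
  fixes k :: "int^'d::finite"
  assumes "k \<noteq> 0" "x * norm (kvec k) ^ (m + (CARD('d) + 1)) \<le> C"
  shows "x * norm (kvec k) ^ m \<le> C * norm (kvec k) powr (- real (CARD('d) + 1))"
proof -
  define R n where "R = norm (kvec k)" and "n = CARD('d) + 1"
  have R: "R > 0" unfolding R_def using assms by simp
  have "R ^ n * R powr (- real n) = 1"
    using R by (simp add: powr_minus powr_realpow)
  then have "x * R ^ m = (x * R ^ (m + n)) * R powr (- real n)"
    by (simp add: power_add mult.assoc)
  also have "\<dots> \<le> C * R powr (- real n)"
    using assms by (intro mult_right_mono) (auto simp: R_def n_def)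
  finally show ?thesis unfolding R_def n_def .
qed

lemma summable_on_lattice_cofinite:
  fixes f :: "int^'d::finite \<Rightarrow> real"
  assumes le: "\<And>k. k \<noteq> 0 \<Longrightarrow> f k \<le> C * norm (kvec k) powr (- real (CARD('d) + 1))" and "\<And>k. f k \<ge> 0"
  shows "f summable_on UNIV"
proof -
  have "(\<lambda>k::int^'d. C * norm (kvec k) powr (- real (CARD('d) + 1))) summable_on (UNIV - {0})"
    by (intro summable_on_cmult_right summable_on_subset_banach[OF summable_norm_kvec_powr]) auto
  then have "f summable_on (UNIV - {0})"
    by (rule summable_on_comparison_test) (use assms in auto)
  then have "f summable_on (UNIV - {0}) \<union> {0}"
    by (intro summable_on_Un_disjoint) auto
  then show ?thesis by simp
qed

lemma torus_coeff_summable: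
  fixes \<phi> :: "real^'d::finite \<Rightarrow> complex"
  assumes \<phi>: "\<phi> \<in> test_funs"
  shows "(\<lambda>k. norm (torus_coeff \<phi> k) * norm (kvec k) ^ m) summable_on UNIV"
proof -
  obtain M where M: "derivs_bounded (m + (CARD('d) + 1)) \<phi> M"
    using test_funs_derivs_bounded[OF \<phi>] by blast
  show ?thesis
    by (rule summable_on_lattice_cofinite[OF weighted_le_lattice_powr[OF _ torus_coeff_decay[OF \<phi> M]]]) auto
qed

lemma torus_coeff_uniform_limit:
  fixes S :: "'i \<Rightarrow> real^'d::finite \<Rightarrow> complex"
  assumes lim: "uniform_limit UNIV S g F" and S: "\<And>n. continuous_on UNIV (S n)" and g: "continuous_on UNIV g"
  shows "((\<lambda>n. torus_coeff (S n) k) \<longlongrightarrow> torus_coeff g k) F"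
proof (rule tendstoI)
  fix e :: real assume e: "e > 0"
  let ?c = "(2 * pi) powr (real CARD('d) / 2)"
  have "e / (2 * ?c) > 0" using e by simp
  from uniform_limitD[OF lim this] show "\<forall>\<^sub>F n in F. dist (torus_coeff (S n) k) (torus_coeff g k) < e"
  proof eventually_elim
    case (elim n)
    have "set_integrable lborel period_cell (\<lambda>x. S n x * efun (- k) x)"
      "set_integrable lborel period_cell (\<lambda>x. g x * efun (- k) x)"
      by (intro set_integrable_period_cell continuous_intros S g)+
    then have "torus_coeff (S n) k - torus_coeff g k = torus_coeff (\<lambda>x. S n x - g x) k"
      unfolding torus_coeff_def by (simp add: left_diff_distrib set_integral_diff)
    then have "dist (torus_coeff (S n) k) (torus_coeff g k) = norm (torus_coeff (\<lambda>x. S n x - g x) k)"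
      by (simp add: dist_norm)
    also have "\<dots> \<le> e / (2 * ?c) * ?c"
      using elim by (intro norm_torus_coeff_le continuous_intros S g) (auto simp: dist_norm intro: less_imp_le)
    also have "\<dots> < e" using e by simp
    finally show ?case .
  qed
qed

lemma torus_coeff_sum_efun:
  assumes "finite F"
  shows "torus_coeff (\<lambda>x. \<Sum>k\<in>F. a k * efun k x) h = (if h \<in> F then a h else 0)"
proof -
  have "torus_coeff (\<lambda>x. \<Sum>k\<in>F. a k * efun k x) h = (\<Sum>k\<in>F. torus_integral (\<lambda>x. a k * (efun k x * efun (- h) x)))"
    unfolding torus_coeff_def sum_distrib_right mult.assoc set_lebesgue_integral_def scaleR_sum_right
    by (rule Bochner_Integration.integral_sum)
      (intro set_integrable_period_cell[unfolded set_integrable_def] continuous_intros)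
  also have "\<dots> = (\<Sum>k\<in>F. if k = h then a k else 0)"
    by (intro sum.cong refl) (simp add: torus_integral_efun_mult)
  finally show ?thesis using assms by simp
qed

lemma fourier_uniform_limit:
  fixes c :: "int^'d::finite \<Rightarrow> complex"
  assumes c: "(\<lambda>k. norm (c k)) summable_on UNIV"
  shows "uniform_limit UNIV (\<lambda>F x. \<Sum>k\<in>F. c k * efun k x) (\<lambda>x. \<Sum>\<^sub>\<infinity>k. c k * efun k x) (finite_subsets_at_top UNIV)"
proof (rule Weierstrass_m_test_general)
  show "norm (c k * efun k x) \<le> norm (c k) * (2 * pi) powr (- real CARD('d) / 2)" for k x
    by (simp add: norm_mult norm_efun)
  show "(\<lambda>k. norm (c k) * (2 * pi) powr (- real CARD('d) / 2)) summable_on UNIV"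
    using c by (rule summable_on_cmult_left)
qed

text \<open>
  The series converges uniformly to a continuous function with the same coefficients as \<open>\<phi>\<close>, and a
  continuous function is determined by its coefficients.
\<close>

theorem test_fun_fourier_series:
  fixes \<phi> :: "real^'d::finite \<Rightarrow> complex"
  assumes \<phi>: "\<phi> \<in> test_funs"
  shows "\<phi> x = (\<Sum>\<^sub>\<infinity>k. torus_coeff \<phi> k * efun k x)"
proof -
  let ?S = "\<lambda>F x. \<Sum>k\<in>F. torus_coeff \<phi> k * efun k x"
  define g where "g x = (\<Sum>\<^sub>\<infinity>k. torus_coeff \<phi> k * efun k x)" for x
  have lim: "uniform_limit UNIV ?S g (finite_subsets_at_top UNIV)"
    unfolding g_def using fourier_uniform_limit torus_coeff_summable[OF \<phi>, of 0] by simp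
  have contS: "continuous_on UNIV (?S F)" for F by (intro continuous_intros)
  have contg: "continuous_on UNIV g"
    by (rule uniform_limit_theorem[OF _ lim]) (auto simp: contS)
  have "torus_coeff g h = torus_coeff \<phi> h" for h
  proof (rule tendsto_unique[OF _ torus_coeff_uniform_limit[OF lim contS contg]])
    have "\<forall>\<^sub>F F in finite_subsets_at_top UNIV. torus_coeff (?S F) h = torus_coeff \<phi> h"
      using eventually_finite_subsets_at_top_finite
      unfolding eventually_finite_subsets_at_top
      by (intro exI[of _ "{h}"]) (auto simp: torus_coeff_sum_efun)
    then show "((\<lambda>F. torus_coeff (?S F) h) \<longlongrightarrow> torus_coeff \<phi> h) (finite_subsets_at_top UNIV)"
      by (rule tendsto_eventually)
  qed simp
  moreover have "set_integrable lborel period_cell (\<lambda>x. g x * efun (- h) x)"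
     "set_integrable lborel period_cell (\<lambda>x. \<phi> x * efun (- h) x)" for h
    by (intro set_integrable_period_cell continuous_intros contg test_funs_continuous \<phi>)+
  ultimately have "torus_coeff (\<lambda>x. \<phi> x - g x) h = 0" for h
    unfolding torus_coeff_def by (simp add: left_diff_distrib set_integral_diff)
  moreover have "periodic_fun (\<lambda>x. \<phi> x - g x)"
    using test_funs_periodic[OF \<phi>]
    unfolding g_def periodic_fun_def by simp
  ultimately have "\<phi> x - g x = 0"
    by (intro eq_0_if_coeffs_eq_0[of "\<lambda>x. \<phi> x - g x"] continuous_intros test_funs_continuous \<phi> contg)
  then show ?thesis by (simp add: g_def)
qed

lemma test_fun_norm_le_coeffs:
  fixes \<phi> :: "real^'d::finite \<Rightarrow> complex"
  assumes \<phi>: "\<phi> \<in> test_funs"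
  shows "norm (\<phi> x) \<le> (2 * pi) powr (- real CARD('d) / 2) * (\<Sum>\<^sub>\<infinity>k. norm (torus_coeff \<phi> k))"
proof -
  let ?c = "(2 * pi) powr (- real CARD('d) / 2)"
  have s: "(\<lambda>k. ?c * norm (torus_coeff \<phi> k)) summable_on UNIV"
    using torus_coeff_summable[OF \<phi>, of 0] by (intro summable_on_cmult_right) simp
  then have "norm (\<Sum>\<^sub>\<infinity>k. torus_coeff \<phi> k * efun k x) \<le> (\<Sum>\<^sub>\<infinity>k. norm (torus_coeff \<phi> k * efun k x))"
    by (intro norm_infsum_bound) (simp add: norm_mult norm_efun mult.commute)
  also have "\<dots> = ?c * (\<Sum>\<^sub>\<infinity>k. norm (torus_coeff \<phi> k))"
    by (simp add: norm_mult norm_efun infsum_cmult_left' mult.commute)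
  finally show ?thesis using test_fun_fourier_series[OF \<phi>, of x] by simp
qed

text \<open>
  The factors that iterated derivatives contribute to the Fourier coefficients.
\<close>

lemma norm_prod_list_le:
  "norm (\<Prod>i\<leftarrow>is. \<i> * of_int (k $ i) :: complex) \<le> norm (kvec k) ^ length is"
  by (induction "is") (auto simp: norm_mult intro!: mult_mono abs_component_le_norm_kvec)

text \<open>
  The partial sums of the Fourier series converge together with all derivatives, hence every
  distribution can be evaluated term by term.
\<close>

theorem distr_test_fun_has_sum:
  fixes \<phi> :: "real^'d::finite \<Rightarrow> complex"
  assumes T: "is_real_distr T" and \<phi>: "\<phi> \<in> test_funs"
  shows "((\<lambda>k. torus_coeff \<phi> k * T (efun k)) has_sum T \<phi>) UNIV"
proof -
  obtain C m where C: "\<And>\<psi> M. \<psi> \<in> test_funs \<Longrightarrow> derivs_bounded m \<psi> M \<Longrightarrow> norm (T \<psi>) \<le> C * M"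
    using T unfolding is_real_distr_def by blast
  have lin: "T (\<lambda>x. a * f x + b * g x) = a * T f + b * T g" if "f \<in> test_funs" "g \<in> test_funs" for f g a b
    using T that unfolding is_real_distr_def by blast
  let ?S = "\<lambda>F x. \<Sum>k\<in>F. torus_coeff \<phi> k * efun k x"
  have TS: "T (?S F) = (\<Sum>k\<in>F. torus_coeff \<phi> k * T (efun k))" if "finite F" for F
    using that
  proof (induction F)
    case empty
    show ?case using lin[OF \<phi> \<phi>, of 0 0] by simp
  next
    case (insert k F)
    then show ?case
      using lin[OF efun_in_test_funs test_funs_sum_efun, of "torus_coeff \<phi> k" k 1 "torus_coeff \<phi>" F] by simp
  qed
  let ?c = "(2 * pi) powr (- real CARD('d) / 2)"
  \<comment> \<open>Up to a constant, the tails of \<open>w\<close> dominate all derivatives of order at most \<open>m\<close> of the remainder.\<close>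
  define w where "w k = norm (torus_coeff \<phi> k) * (1 + norm (kvec k) ^ m)" for k
  have w: "w summable_on UNIV"
    using summable_on_add[OF torus_coeff_summable[OF \<phi>, of 0] torus_coeff_summable[OF \<phi>, of m]]
    by (simp add: w_def[abs_def] distrib_left)
  have est: "norm (T \<phi> - T (?S F)) \<le> \<bar>C\<bar> * (?c * (infsum w UNIV - sum w F))" if F: "finite F" for F
  proof -
    let ?\<psi> = "\<lambda>x. 1 * \<phi> x + (-1) * ?S F x"
    have \<psi>: "?\<psi> \<in> test_funs" by (intro test_funs_lincomb \<phi> test_funs_sum_efun)
    have b: "derivs_bounded m ?\<psi> (?c * (infsum w UNIV - sum w F))"
    proof (intro allI impI)
      fix "is" :: "'d list" and x :: "real^'d" assume len: "length is \<le> m"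
      have coeff: "torus_coeff ?\<psi> k = (if k \<in> F then 0 else torus_coeff \<phi> k)" for k
      proof -
        have "set_integrable lborel period_cell (\<lambda>x. \<phi> x * efun (- k) x)"
          "set_integrable lborel period_cell (\<lambda>x. ?S F x * efun (- k) x)"
          by (intro set_integrable_period_cell continuous_intros test_funs_continuous \<phi>)+
        then have "torus_coeff ?\<psi> k = torus_coeff \<phi> k - torus_coeff (?S F) k"
          unfolding torus_coeff_def by (simp add: left_diff_distrib set_integral_diff)
        then show ?thesis using F by (simp add: torus_coeff_sum_efun)
      qed
      have le: "norm (torus_coeff (foldr pderivative is ?\<psi>) k) \<le> (if k \<in> F then 0 else w k)" for k
      proof -
        have "norm (kvec k) ^ length is \<le> 1 + norm (kvec k) ^ m"
        proof (cases "k = 0")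
          case False
          then have "norm (kvec k) ^ length is \<le> norm (kvec k) ^ m"
            using len norm_kvec_ge_1[of k] by (intro power_increasing) auto
          then show ?thesis by simp
        qed (simp add: power_0_left)
        then have "norm (\<Prod>i\<leftarrow>is. \<i> * of_int (k $ i) :: complex) \<le> 1 + norm (kvec k) ^ m"
          using norm_prod_list_le[of k "is"] by linarith
        then have "norm (\<Prod>i\<leftarrow>is. \<i> * of_int (k $ i) :: complex) * norm (torus_coeff \<phi> k) \<le> w k"
          unfolding w_def by (subst mult.commute) (rule mult_left_mono, auto)
        then show ?thesis
          unfolding torus_coeff_foldr_pderivative[OF \<psi>] coeff norm_mult by simp
      qed
      have w': "w summable_on (UNIV - F)" by (rule summable_on_subset_banach[OF w]) auto
      have i: "(\<Sum>\<^sub>\<infinity>k. if k \<in> F then 0 else w k) = infsum w (UNIV - F)"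
        by (rule infsum_cong_neutral) auto
      have s: "(\<lambda>k. if k \<in> F then 0 else w k) summable_on UNIV"
        using w' by (rule summable_on_cong_neutral[THEN iffD1, rotated -1]) auto
      have "norm (foldr pderivative is ?\<psi> x) \<le> ?c * (\<Sum>\<^sub>\<infinity>k. norm (torus_coeff (foldr pderivative is ?\<psi>) k))"
        by (intro test_fun_norm_le_coeffs test_funs_foldr \<psi>)
      also have "\<dots> \<le> ?c * (\<Sum>\<^sub>\<infinity>k. if k \<in> F then 0 else w k)"
        using torus_coeff_summable[OF test_funs_foldr[OF \<psi>], of "is" 0]
        by (intro mult_left_mono infsum_mono s le) auto
      also have "\<dots> = ?c * (infsum w UNIV - sum w F)"
        unfolding i using infsum_Diff[of w UNIV F] w F by simp
      finally show "norm (foldr pderivative is ?\<psi> x) \<le> ?c * (infsum w UNIV - sum w F)" .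
    qed
    have "norm (T \<phi> - T (?S F)) = norm (T ?\<psi>)"
      using lin[OF \<phi> test_funs_sum_efun, of 1 "-1" "torus_coeff \<phi>" F] by simp
    also have "\<dots> \<le> C * (?c * (infsum w UNIV - sum w F))" using C[of ?\<psi> "?c * (infsum w UNIV - sum w F)"] \<psi> b by blast
    also have "\<dots> \<le> \<bar>C\<bar> * (?c * (infsum w UNIV - sum w F))"
    proof (intro mult_right_mono)
      show "0 \<le> ?c * (infsum w UNIV - sum w F)"
        using b[rule_format, of "[]" undefined] order_trans[OF norm_ge_zero] by simp
    qed simp
    finally show ?thesis .
  qed
  have "((\<lambda>F. \<bar>C\<bar> * (?c * (infsum w UNIV - sum w F))) \<longlongrightarrow> \<bar>C\<bar> * (?c * (infsum w UNIV - infsum w UNIV))) (finite_subsets_at_top UNIV)"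
    using has_sum_infsum[OF w] unfolding has_sum_def by (intro tendsto_intros)
  then have lim0: "((\<lambda>F. \<bar>C\<bar> * (?c * (infsum w UNIV - sum w F))) \<longlongrightarrow> 0) (finite_subsets_at_top UNIV)"
    by simp
  have "((\<lambda>F. T \<phi> - T (?S F)) \<longlongrightarrow> 0) (finite_subsets_at_top UNIV)"
    by (rule Lim_null_comparison[OF _ lim0], rule eventually_finite_subsets_at_top_weakI, rule est)
  then have "((\<lambda>F. T \<phi> - (T \<phi> - T (?S F))) \<longlongrightarrow> T \<phi> - 0) (finite_subsets_at_top UNIV)"
    by (intro tendsto_intros)
  then have "((\<lambda>F. T (?S F)) \<longlongrightarrow> T \<phi>) (finite_subsets_at_top UNIV)" by simp
  then show ?thesis
    unfolding has_sum_def
    by (rule Lim_transform_eventually) (auto intro!: eventually_finite_subsets_at_top_weakI TS)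
qed

section \<open>Distributions and their Fourier coefficients\<close>

definition dcoeff :: "'d::finite distr \<Rightarrow> int^'d \<Rightarrow> complex" where
  "dcoeff T k = pairing T (efun (- k))"

lemma fcoeff_nth: "fcoeff v k $ r = dcoeff (v $ r) k"
  by (simp add: fcoeff_def dcoeff_def)

lemma bij_uminus: "bij (uminus :: 'a::group_add \<Rightarrow> 'a)"
  by (rule bij_betwI[of _ _ _ uminus]) auto

lemma torus_integral_efun_times: "torus_integral (\<lambda>x. efun k x * \<phi> x) = torus_coeff \<phi> (- k)"
  by (simp add: torus_coeff_def mult.commute)

lemma pairing_has_sum:
  assumes "\<phi> \<in> test_funs"
  shows "((\<lambda>k. dcoeff T k * torus_coeff \<phi> (- k)) has_sum pairing T \<phi>) UNIV"
proof -
  have "((\<lambda>k. torus_coeff \<phi> (- k) * pairing T (efun (- k))) has_sum pairing T \<phi>) UNIV"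
    using distr_test_fun_has_sum[OF is_real_distr_pairing assms, of T]
      has_sum_reindex_bij_betw[OF bij_uminus, of "\<lambda>k. torus_coeff \<phi> k * pairing T (efun k)"] by simp
  then show ?thesis by (simp add: dcoeff_def mult.commute)
qed

lemma pairing_outside: "\<phi> \<notin> test_funs \<Longrightarrow> pairing T \<phi> = 0"
  using is_real_distr_pairing[of T] unfolding is_real_distr_def by blast

text \<open>
  A test function is the sum of its Fourier series in \<open>C\<^sup>\<infinity>\<close>, so a distribution is known as soon as
  its values on the exponentials are.
\<close>

lemma distr_eqI:
  assumes "\<And>k. dcoeff S k = dcoeff T k" shows "S = T"
proof -
  have "pairing S \<phi> = pairing T \<phi>" for \<phi>
    using pairing_has_sum[of \<phi> S] pairing_has_sum[of \<phi> T]
    by (cases "\<phi> \<in> test_funs") (auto simp: assms pairing_outside dest: has_sum_unique)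
  then show ?thesis by (simp add: pairing_inject[symmetric] fun_eq_iff)
qed

lemma distr_eqI_test_funs:
  assumes "\<And>\<phi>. \<phi> \<in> test_funs \<Longrightarrow> pairing S \<phi> = pairing T \<phi>" shows "S = T"
  using assms by (intro distr_eqI) (simp add: dcoeff_def efun_in_test_funs)

lemma vfield_eqI:
  assumes "\<And>k. fcoeff v k = fcoeff w k" shows "v = w"
  unfolding vec_eq_iff by (intro allI distr_eqI) (metis assms fcoeff_nth)

lemma dcoeff_add: "dcoeff (S + T) k = dcoeff S k + dcoeff T k"
  by (simp add: dcoeff_def pairing_add)

lemma dcoeff_scaleR: "dcoeff (c *\<^sub>R S) k = of_real c * dcoeff S k"
  by (simp add: dcoeff_def pairing_scaleR)

lemma dcoeff_0: "dcoeff 0 k = 0"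
  by (simp add: dcoeff_def pairing_zero)

lemma dcoeff_sum: "dcoeff (\<Sum>i\<in>I. T i) k = (\<Sum>i\<in>I. dcoeff (T i) k)"
  by (induction I rule: infinite_finite_induct) (auto simp: dcoeff_0 dcoeff_add)

lemma fcoeff_add: "fcoeff (v + w) k = fcoeff v k + fcoeff w k"
  by (simp add: vec_eq_iff fcoeff_nth dcoeff_add)

lemma fcoeff_scaleR: "fcoeff (c *\<^sub>R v) k = c *\<^sub>R fcoeff v k"
  by (simp add: vec_eq_iff fcoeff_nth dcoeff_scaleR) (simp add: scaleR_conv_of_real)

lemma fcoeff_uminus: "fcoeff (- v) k = - fcoeff v k"
  using fcoeff_scaleR[of "-1" v k] by simp

lemma fcoeff_diff: "fcoeff (v - w) k = fcoeff v k - fcoeff w k"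
  using fcoeff_add[of v "- w" k] by (simp add: fcoeff_uminus)

lemma fcoeff_0: "fcoeff 0 k = 0"
  by (simp add: vec_eq_iff fcoeff_nth dcoeff_0)

lemma dcoeff_uminus_index: "dcoeff T (- k) = cnj (dcoeff T k)"
proof -
  have "pairing T (\<lambda>x. cnj (efun (- k) x)) = cnj (pairing T (efun (- k)))"
    using is_real_distr_pairing[of T] efun_in_test_funs unfolding is_real_distr_def by blast
  then show ?thesis by (simp add: dcoeff_def cnj_efun)
qed

lemma dcoeff_growth:
  fixes T :: "'d::finite distr"
  shows "\<exists>C m. \<forall>k. norm (dcoeff T k) \<le> C * (1 + norm (kvec k)) ^ m"
proof -
  obtain C m where C: "\<And>\<psi> M. \<psi> \<in> test_funs \<Longrightarrow> derivs_bounded m \<psi> M \<Longrightarrow> norm (pairing T \<psi>) \<le> C * M"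
    using is_real_distr_pairing[of T] unfolding is_real_distr_def by blast
  let ?c = "(2 * pi) powr (- real CARD('d) / 2)"
  have "norm (dcoeff T k) \<le> (C * ?c) * (1 + norm (kvec k)) ^ m" for k
  proof -
    have "derivs_bounded m (efun (- k)) (?c * (1 + norm (kvec k)) ^ m)"
    proof (intro allI impI)
      fix "is" :: "'d list" and x :: "real^'d" assume len: "length is \<le> m"
      have "norm (\<Prod>i\<leftarrow>is. \<i> * of_int ((- k) $ i) :: complex) \<le> norm (kvec (- k)) ^ length is"
        by (rule norm_prod_list_le)
      also have "\<dots> \<le> (1 + norm (kvec k)) ^ length is"
        by (intro power_mono) auto
      also have "\<dots> \<le> (1 + norm (kvec k)) ^ m"
        using len by (intro power_increasing) auto
      finally have "norm (\<Prod>i\<leftarrow>is. \<i> * of_int ((- k) $ i) :: complex) * ?c \<le> (1 + norm (kvec k)) ^ m * ?c"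
        by (intro mult_right_mono) auto
      then show "norm (foldr pderivative is (efun (- k)) x) \<le> ?c * (1 + norm (kvec k)) ^ m"
        unfolding foldr_pderivative_efun norm_mult norm_efun by (simp add: mult.commute)
    qed
    then have "norm (pairing T (efun (- k))) \<le> C * (?c * (1 + norm (kvec k)) ^ m)"
      using C[of "efun (- k)" "?c * (1 + norm (kvec k)) ^ m"] efun_in_test_funs by blast
    then show ?thesis by (simp add: dcoeff_def mult.assoc)
  qed
  then show ?thesis by blast
qed

text \<open>
  The growth of \<open>c\<close> is compensated by the decay of the coefficients of \<open>\<phi>\<close>, at the cost of \<open>m + d + 1\<close>
  derivatives of \<open>\<phi>\<close>.
\<close>

lemma coeff_pairing_bound:
  fixes c :: "int^'d::finite \<Rightarrow> complex"
  assumes "\<And>k. norm (c k) \<le> C * (1 + norm (kvec k)) ^ m"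
  shows "\<exists>A. \<forall>\<phi>\<in>test_funs. \<forall>M. derivs_bounded (m + (CARD('d) + 1)) \<phi> M \<longrightarrow>
    (\<lambda>k. norm (c k * torus_coeff \<phi> (- k))) summable_on UNIV \<and>
    (\<Sum>\<^sub>\<infinity>k. norm (c k * torus_coeff \<phi> (- k))) \<le> A * M"
proof -
  define n where "n = m + (CARD('d) + 1)"
  define g where "g k = (if k = 0 then 1 else norm (kvec k) powr (- real (CARD('d) + 1)))" for k :: "int^'d"
  have g: "g summable_on UNIV"
    by (rule summable_on_lattice_cofinite[of _ 1]) (auto simp: g_def)
  define A where "A = C * 2 ^ m * real CARD('d) ^ n * (2 * pi) powr (real CARD('d) / 2)"
  have C0: "C \<ge> 0" using order_trans[OF norm_ge_zero assms[of 0]] by simp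
  have main: "norm (c k * torus_coeff \<phi> (- k)) \<le> A * M * g k"
    if \<phi>: "\<phi> \<in> test_funs" and M: "derivs_bounded n \<phi> M" for \<phi> M k
  proof -
    let ?t = "norm (torus_coeff \<phi> (- k))"
    let ?B = "real CARD('d) ^ n * (2 * pi) powr (real CARD('d) / 2) * M"
    have M0: "M \<ge> 0" using M[rule_format, of "[]" undefined] order_trans[OF norm_ge_zero] by simp
    have 1: "?t * (1 + norm (kvec k)) ^ m \<le> 2 ^ m * ?B * g k"
    proof (cases "k = 0")
      case True
      have "?t \<le> M * (2 * pi) powr (real CARD('d) / 2)"
        using M[rule_format, of "[]"] by (intro norm_torus_coeff_le test_funs_continuous \<phi>) simp
      also have "\<dots> \<le> (2 ^ m * real CARD('d) ^ n) * (M * (2 * pi) powr (real CARD('d) / 2))"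
      proof -
        have "1 \<le> real CARD('d) ^ n" by (rule one_le_power) simp
        moreover have "(1::real) \<le> 2 ^ m" by (rule one_le_power) simp
        ultimately have "1 * 1 \<le> (2::real) ^ m * real CARD('d) ^ n" by (intro mult_mono) auto
        then have "1 * (M * (2 * pi) powr (real CARD('d) / 2)) \<le> (2 ^ m * real CARD('d) ^ n) * (M * (2 * pi) powr (real CARD('d) / 2))"
          using M0 by (intro mult_right_mono) auto
        then show ?thesis by simp
      qed
      finally show ?thesis using True by (simp add: g_def mult_ac)
    next
      case False
      have "?t * norm (kvec (- k)) ^ n \<le> ?B" by (rule torus_coeff_decay[OF \<phi>]) (use M in blast)
      then have tB: "?t * norm (kvec k) ^ m \<le> ?B * g k"
        using weighted_le_lattice_powr[OF False, of ?t m ?B] False by (simp add: g_def n_def)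
      moreover have "(1 + norm (kvec k)) ^ m \<le> 2 ^ m * norm (kvec k) ^ m"
        using norm_kvec_ge_1[OF False] unfolding power_mult_distrib[symmetric] by (intro power_mono) auto
      then have "?t * (1 + norm (kvec k)) ^ m \<le> ?t * (2 ^ m * norm (kvec k) ^ m)"
        by (intro mult_left_mono) auto
      moreover have "?t * (2 ^ m * norm (kvec k) ^ m) = 2 ^ m * (?t * norm (kvec k) ^ m)"
        by simp
      ultimately have "?t * (1 + norm (kvec k)) ^ m \<le> 2 ^ m * (?B * g k)"
        using mult_left_mono[OF tB zero_le_power[OF zero_le_numeral[of "num.Bit0 num.One"]], of m] by linarith
      then show ?thesis by (simp add: mult.assoc)
    qed
    have "norm (c k * torus_coeff \<phi> (- k)) \<le> (C * (1 + norm (kvec k)) ^ m) * ?t"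
      unfolding norm_mult by (intro mult_right_mono assms) auto
    also have "\<dots> = C * (?t * (1 + norm (kvec k)) ^ m)" by simp
    also have "\<dots> \<le> C * (2 ^ m * ?B * g k)" using 1 C0 by (rule mult_left_mono)
    finally show ?thesis by (simp add: A_def mult_ac)
  qed
  show ?thesis
  proof (intro exI[of _ "A * infsum g UNIV"] ballI allI impI)
    fix \<phi> :: "real^'d \<Rightarrow> complex" and M
    assume \<phi>: "\<phi> \<in> test_funs" and M: "derivs_bounded (m + (CARD('d) + 1)) \<phi> M"
    have le: "norm (c k * torus_coeff \<phi> (- k)) \<le> A * M * g k" for k
      using main[of \<phi> M k] \<phi> M unfolding n_def by blast
    have gs: "(\<lambda>k. A * M * g k) summable_on UNIV" using g by (rule summable_on_cmult_right)
    have s: "(\<lambda>k. norm (c k * torus_coeff \<phi> (- k))) summable_on UNIV"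
      by (rule summable_on_comparison_test[OF gs le]) auto
    have "(\<Sum>\<^sub>\<infinity>k. norm (c k * torus_coeff \<phi> (- k))) \<le> (\<Sum>\<^sub>\<infinity>k. A * M * g k)"
      by (rule infsum_mono[OF s gs le])
    then show "(\<lambda>k. norm (c k * torus_coeff \<phi> (- k))) summable_on UNIV \<and>
       (\<Sum>\<^sub>\<infinity>k. norm (c k * torus_coeff \<phi> (- k))) \<le> A * infsum g UNIV * M"
      using s by (simp add: infsum_cmult_right' mult_ac)
  qed
qed

lemma torus_coeff_lincomb:
  assumes "\<phi> \<in> test_funs" "\<psi> \<in> test_funs"
  shows "torus_coeff (\<lambda>x. a * \<phi> x + b * \<psi> x) k = a * torus_coeff \<phi> k + b * torus_coeff \<psi> k"
proof -
  have "set_integrable lborel period_cell (\<lambda>x. a * (\<phi> x * efun (- k) x))"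
    "set_integrable lborel period_cell (\<lambda>x. b * (\<psi> x * efun (- k) x))"
    by (intro set_integrable_period_cell continuous_intros test_funs_continuous assms)+
  then show ?thesis
    unfolding torus_coeff_def distrib_right mult.assoc by (simp add: set_integral_add)
qed

lemma torus_coeff_cnj: "torus_coeff (\<lambda>x. cnj (\<phi> x)) k = cnj (torus_coeff \<phi> (- k))"
proof -
  have "cnj (torus_coeff \<phi> (- k)) = (LINT x|lborel. cnj (indicat_real period_cell x *\<^sub>R (\<phi> x * efun k x)))"
    unfolding torus_coeff_def set_lebesgue_integral_def 
    by (subst integral_bounded_linear'[OF bounded_linear_cnj bounded_linear_cnj]) simp_all
  then show ?thesis
    unfolding torus_coeff_def set_lebesgue_integral_def
    by (simp add: cnj_efun scaleR_conv_of_real)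
qed

text \<open>The distribution is \<open>\<phi> \<mapsto> \<Sum>\<^sub>k c\<^sub>k \<phi>\<^sub>-\<^sub>k\<close>; the Hermitian symmetry of \<open>c\<close> makes it commute with
  complex conjugation.\<close>

lemma distr_of_coeffs:
  fixes c :: "int^'d::finite \<Rightarrow> complex"
  assumes growth: "\<And>k. norm (c k) \<le> C * (1 + norm (kvec k)) ^ m" and herm: "\<And>k. c (- k) = cnj (c k)"
  shows "\<exists>T. \<forall>k. dcoeff T k = c k"
proof -
  define S where "S \<phi> = (if \<phi> \<in> test_funs then \<Sum>\<^sub>\<infinity>k. c k * torus_coeff \<phi> (- k) else 0)" for \<phi>
  let ?n = "m + (CARD('d) + 1)"
  from coeff_pairing_bound[of c C m, OF growth] obtain A where A:
    "\<forall>\<phi>\<in>test_funs. \<forall>M. derivs_bounded ?n \<phi> M \<longrightarrow>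
      (\<lambda>k. norm (c k * torus_coeff \<phi> (- k))) summable_on UNIV \<and>
      (\<Sum>\<^sub>\<infinity>k. norm (c k * torus_coeff \<phi> (- k))) \<le> A * M" ..
  have summ: "(\<lambda>k. norm (c k * torus_coeff \<phi> (- k))) summable_on UNIV" if t: "\<phi> \<in> test_funs" for \<phi>
  proof -
    obtain M where M: "derivs_bounded ?n \<phi> M" by (rule test_funs_derivs_bounded[OF t])
    from bspec[OF A t, THEN spec, of M] M show ?thesis by (rule mp[THEN conjunct1])
  qed
  have "is_real_distr S"
    unfolding is_real_distr_def
  proof (intro conjI ballI allI impI)
    fix \<phi> \<psi> :: "real^'d \<Rightarrow> complex" and a b
    assume t: "\<phi> \<in> test_funs" "\<psi> \<in> test_funs"
    note s = abs_summable_summable[OF summ[OF t(1)]] abs_summable_summable[OF summ[OF t(2)]]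
    have "S (\<lambda>x. a * \<phi> x + b * \<psi> x) = (\<Sum>\<^sub>\<infinity>k. a * (c k * torus_coeff \<phi> (- k)) + b * (c k * torus_coeff \<psi> (- k)))"
      using test_funs_lincomb[OF t] by (simp add: S_def torus_coeff_lincomb[OF t] algebra_simps)
    also have "\<dots> = a * S \<phi> + b * S \<psi>"
      using s t by (subst infsum_add) (auto simp: S_def infsum_cmult_right' intro: summable_on_cmult_right)
    finally show "S (\<lambda>x. a * \<phi> x + b * \<psi> x) = a * S \<phi> + b * S \<psi>" .
  next
    fix \<phi> :: "real^'d \<Rightarrow> complex" assume t: "\<phi> \<in> test_funs"
    have "S (\<lambda>x. cnj (\<phi> x)) = (\<Sum>\<^sub>\<infinity>k. c k * cnj (torus_coeff \<phi> k))"
      using test_funs_cnj[OF t] by (simp add: S_def torus_coeff_cnj)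
    also have "\<dots> = (\<Sum>\<^sub>\<infinity>k. c (- k) * cnj (torus_coeff \<phi> (- k)))"
      using infsum_reindex_bij_betw[OF bij_uminus, of "\<lambda>k. c k * cnj (torus_coeff \<phi> k)"] by simp
    also have "\<dots> = cnj (S \<phi>)" using t by (simp add: S_def infsum_cnj[symmetric] herm)
    finally show "S (\<lambda>x. cnj (\<phi> x)) = cnj (S \<phi>)" .
  next
    show "\<exists>C m. \<forall>\<phi>\<in>test_funs. \<forall>M. derivs_bounded m \<phi> M \<longrightarrow> norm (S \<phi>) \<le> C * M"
    proof (rule exI[of _ A], rule exI[of _ ?n], intro ballI allI impI)
      fix \<phi> :: "real^'d \<Rightarrow> complex" and M assume t: "\<phi> \<in> test_funs" and M: "derivs_bounded ?n \<phi> M"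
      have "norm (S \<phi>) \<le> (\<Sum>\<^sub>\<infinity>k. norm (c k * torus_coeff \<phi> (- k)))"
        using norm_infsum_bound[OF summ[OF t]] t by (simp add: S_def)
      also from bspec[OF A t, THEN spec, of M] M have "\<dots> \<le> A * M" by (rule mp[THEN conjunct2])
      finally show "norm (S \<phi>) \<le> A * M" .
    qed
  qed (auto simp: S_def)
  then have "pairing (Abs_distr S) = S" by (simp add: Abs_distr_inverse)
  moreover have "S (efun (- h)) = c h" for h
  proof -
    have "(\<Sum>\<^sub>\<infinity>k. c k * torus_coeff (efun (- h)) (- k)) = (\<Sum>\<^sub>\<infinity>k\<in>{h}. c k * torus_coeff (efun (- h)) (- k))"
      by (rule infsum_cong_neutral) (auto simp: torus_coeff_efun)
    then show ?thesis by (simp add: S_def efun_in_test_funs torus_coeff_efun)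
  qed
  ultimately show ?thesis by (intro exI[of _ "Abs_distr S"]) (simp add: dcoeff_def)
qed

text \<open>
  These conditions characterize the coefficient families of real vector fields.
\<close>

definition admissible :: "(int^'d::finite \<Rightarrow> complex^'d) \<Rightarrow> bool" where
  "admissible c \<longleftrightarrow> (\<exists>C m. \<forall>k. norm (c k) \<le> C * (1 + norm (kvec k)) ^ m) \<and>
     (\<forall>k r. c (- k) $ r = cnj (c k $ r))"

lemma admissible_fcoeff: "admissible (fcoeff (v :: 'd::finite vfield))"
proof -
  have "\<exists>C m. \<forall>k. norm (dcoeff (v $ r) k) \<le> C * (1 + norm (kvec k)) ^ m" for r
    by (rule dcoeff_growth)
  then obtain C m where C: "\<And>r k. norm (dcoeff (v $ r) k) \<le> C r * (1 + norm (kvec k)) ^ m r"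
    by metis
  have C0: "C r \<ge> 0" for r using order_trans[OF norm_ge_zero C[of r 0]] by simp
  have "norm (fcoeff v k) \<le> (\<Sum>r\<in>UNIV. C r) * (1 + norm (kvec k)) ^ (\<Sum>r\<in>UNIV. m r)" for k
  proof -
    have "norm (fcoeff v k) \<le> (\<Sum>r\<in>UNIV. norm (fcoeff v k $ r))"
      unfolding norm_vec_def by (rule L2_set_le_sum) simp
    also have "\<dots> \<le> (\<Sum>r\<in>UNIV. C r * (1 + norm (kvec k)) ^ (\<Sum>r\<in>UNIV. m r))"
      unfolding fcoeff_nth
      by (intro sum_mono order_trans[OF C] mult_left_mono power_increasing C0)
        (auto intro: member_le_sum)
    finally show ?thesis by (simp add: sum_distrib_right)
  qed
  then show ?thesis unfolding admissible_def by (auto simp: fcoeff_nth dcoeff_uminus_index)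
qed

lemma ex_vfield_fcoeff:
  assumes "admissible c" shows "\<exists>v. \<forall>k. fcoeff v k = c k"
proof -
  obtain C m where C: "\<And>k. norm (c k) \<le> C * (1 + norm (kvec k)) ^ m"
    and herm: "\<And>k r. c (- k) $ r = cnj (c k $ r)"
    using assms unfolding admissible_def by metis
  have "\<exists>T. \<forall>k. dcoeff T k = c k $ r" for r
    by (rule distr_of_coeffs[of _ C m]) (auto simp: herm intro: order_trans[OF Finite_Cartesian_Product.norm_nth_le C])
  then obtain T where "\<And>r k. dcoeff (T r) k = c k $ r" by metis
  then have "fcoeff (\<chi> r. T r) k = c k" for k by (simp add: vec_eq_iff fcoeff_nth)
  then show ?thesis by blast
qed

text \<open>
  For such families the definite description in \<open>fseries\<close> has exactly one solution.
\<close>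

lemma fcoeff_fseries:
  assumes "admissible c" shows "fcoeff (fseries c) k = c k"
proof -
  obtain v where v: "\<And>k. fcoeff v k = c k" using ex_vfield_fcoeff[OF assms] by blast
  have "fseries c = v"
    unfolding fseries_def
  proof (rule the_equality)
    show "\<forall>r. \<forall>\<phi>\<in>test_funs. ((\<lambda>k. c k $ r * torus_integral (\<lambda>x. efun k x * \<phi> x)) has_sum pairing (v $ r) \<phi>) UNIV"
      using pairing_has_sum[of _ "v $ _"] by (auto simp: torus_integral_efun_times v[symmetric] fcoeff_nth)
    fix w
    assume w: "\<forall>r. \<forall>\<phi>\<in>test_funs. ((\<lambda>k. c k $ r * torus_integral (\<lambda>x. efun k x * \<phi> x)) has_sum pairing (w $ r) \<phi>) UNIV"
    have "pairing (w $ r) \<phi> = pairing (v $ r) \<phi>" if "\<phi> \<in> test_funs" for r \<phi>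
    proof (rule has_sum_unique)
      show "((\<lambda>k. c k $ r * torus_coeff \<phi> (- k)) has_sum pairing (w $ r) \<phi>) UNIV"
        using w that by (simp add: torus_integral_efun_times)
      show "((\<lambda>k. c k $ r * torus_coeff \<phi> (- k)) has_sum pairing (v $ r) \<phi>) UNIV"
        using pairing_has_sum[OF that, of "v $ r"] by (simp add: v[symmetric] fcoeff_nth)
    qed
    then show "w = v" unfolding vec_eq_iff by (auto intro: distr_eqI_test_funs)
  qed
  then show ?thesis by (simp add: v)
qed

text \<open>
  The functional \<open>\<phi> \<mapsto> - T (\<partial>\<^sub>s\<phi>)\<close> is again a real distribution, of order one higher, and hence it
  is the unique object described by \<open>distr_deriv\<close>.
\<close>

lemma pairing_distr_deriv:
  fixes T :: "'d::finite distr"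
  assumes \<phi>: "\<phi> \<in> test_funs"
  shows "pairing (distr_deriv s T) \<phi> = - pairing T (pderivative s \<phi>)"
proof -
  define S where "S \<phi> = (if \<phi> \<in> test_funs then - pairing T (pderivative s \<phi>) else 0)" for \<phi>
  obtain C m where C: "\<And>\<psi> M. \<psi> \<in> test_funs \<Longrightarrow> derivs_bounded m \<psi> M \<Longrightarrow> norm (pairing T \<psi>) \<le> C * M"
    using is_real_distr_pairing[of T] unfolding is_real_distr_def by blast
  have "is_real_distr S"
    unfolding is_real_distr_def
  proof (intro conjI ballI allI impI)
    fix f g :: "real^'d \<Rightarrow> complex" and a b
    assume t: "f \<in> test_funs" "g \<in> test_funs"
    have "pairing T (\<lambda>x. a * pderivative s f x + b * pderivative s g x)
        = a * pairing T (pderivative s f) + b * pairing T (pderivative s g)"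
      using is_real_distr_pairing[of T] test_funs_pderivative[OF t(1), of s] test_funs_pderivative[OF t(2), of s]
      unfolding is_real_distr_def by blast
    then show "S (\<lambda>x. a * f x + b * g x) = a * S f + b * S g"
      using foldr_pderivative_lincomb[OF t, of "[s]" a b] test_funs_lincomb[OF t] t
      by (simp add: S_def algebra_simps)
  next
    fix f :: "real^'d \<Rightarrow> complex" assume t: "f \<in> test_funs"
    have "pairing T (\<lambda>x. cnj (pderivative s f x)) = cnj (pairing T (pderivative s f))"
      using is_real_distr_pairing[of T] test_funs_pderivative[OF t, of s]
      unfolding is_real_distr_def by blast
    then show "S (\<lambda>x. cnj (f x)) = cnj (S f)"
      using foldr_pderivative_cnj[OF t, of "[s]"] test_funs_cnj[OF t] t by (simp add: S_def)
  next
    show "\<exists>C m. \<forall>\<phi>\<in>test_funs. \<forall>M. derivs_bounded m \<phi> M \<longrightarrow> norm (S \<phi>) \<le> C * M"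
    proof (rule exI[of _ C], rule exI[of _ "Suc m"], intro ballI allI impI)
      fix f :: "real^'d \<Rightarrow> complex" and M assume t: "f \<in> test_funs" and M: "derivs_bounded (Suc m) f M"
      have "derivs_bounded m (pderivative s f) M"
      proof (intro allI impI)
        fix "is" :: "'d list" and x assume "length is \<le> m"
        then show "norm (foldr pderivative is (pderivative s f) x) \<le> M"
          using M[rule_format, of "is @ [s]" x] by simp
      qed
      then have "norm (pairing T (pderivative s f)) \<le> C * M"
        using C[of "pderivative s f" M] test_funs_pderivative[OF t] by blast
      then show "norm (S f) \<le> C * M" using t by (simp add: S_def)
    qed
  qed (auto simp: S_def)
  then have S: "pairing (Abs_distr S) = S" by (simp add: Abs_distr_inverse)
  have "distr_deriv s T = Abs_distr S"
    unfolding distr_deriv_def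
    by (rule the_equality) (auto simp: S S_def intro: distr_eqI_test_funs)
  then show ?thesis using \<phi> by (simp add: S S_def)
qed

lemma dcoeff_distr_deriv: "dcoeff (distr_deriv s T) k = \<i> * of_int (k $ s) * dcoeff T k"
proof -
  have "pairing T (\<lambda>x. (- \<i> * of_int (k $ s)) * efun (- k) x + 0 * efun (- k) x)
    = (- \<i> * of_int (k $ s)) * pairing T (efun (- k)) + 0 * pairing T (efun (- k))"
    using is_real_distr_pairing[of T] efun_in_test_funs[of "- k"] unfolding is_real_distr_def by blast
  then show ?thesis
    by (simp add: dcoeff_def pairing_distr_deriv efun_in_test_funs pderivative_efun)
qed

section \<open>Square summable coefficients and products\<close>

abbreviation torus_measure :: "(real^'d::finite) measure" where
  "torus_measure \<equiv> restrict_space lborel period_cell"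

lemma finite_torus_measure: "finite_measure torus_measure"
  by (rule finite_measureI) (use emeasure_period_cell_finite in \<open>simp add: emeasure_restrict_space space_restrict_space top.not_eq_extremum\<close>)

lemma torus_measurable: "f \<in> borel_measurable borel \<Longrightarrow> f \<in> borel_measurable torus_measure"
  by (intro measurable_restrict_space1) simp

lemma set_integral_eq_torus_measure:
  fixes f :: "real^'d::finite \<Rightarrow> 'b::{banach, second_countable_topology}"
  shows "set_integrable lborel period_cell f \<longleftrightarrow> integrable torus_measure f"
    and "(LINT x:period_cell|lborel. f x) = integral\<^sup>L torus_measure f"
  by (simp_all add: set_integrable_def set_lebesgue_integral_def integrable_restrict_space integral_restrict_space)

lemma integrable_torus_continuous:
  fixes f :: "real^'d::finite \<Rightarrow> 'b::euclidean_space"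
  shows "continuous_on UNIV f \<Longrightarrow> integrable torus_measure f"
  using set_integrable_period_cell set_integral_eq_torus_measure(1) by blast

definition freq_ball :: "nat \<Rightarrow> (int^'d::finite) set" where
  "freq_ball n = {k. norm (kvec k) \<le> real n}"

lemma finite_freq_ball: "finite (freq_ball n :: (int^'d::finite) set)"
proof (rule finite_subset)
  show "freq_ball n \<subseteq> vec_lambda ` (PiE UNIV (\<lambda>_::'d. {- int n..int n}))"
  proof
    fix k :: "int^'d" assume "k \<in> freq_ball n"
    then have "\<bar>real_of_int (k $ j)\<bar> \<le> real n" for j
      using abs_component_le_norm_kvec[of k j] by (simp add: freq_ball_def)
    then have "\<bar>k $ j\<bar> \<le> int n" for j by (metis of_int_abs of_int_le_iff of_int_of_nat_eq)
    then have "vec_nth k \<in> PiE UNIV (\<lambda>_::'d. {- int n..int n})"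
      by (auto simp: abs_le_iff minus_le_iff)
    then show "k \<in> vec_lambda ` (PiE UNIV (\<lambda>_::'d. {- int n..int n}))"
      by (metis image_eqI vec_nth_inverse)
  qed
qed (intro finite_imageI finite_PiE; simp)

lemma uminus_freq_ball: "uminus ` freq_ball n = freq_ball n"
proof -
  have "k \<in> uminus ` freq_ball n" if "k \<in> freq_ball n" for k :: "int^'a"
    using that by (intro image_eqI[of _ _ "- k"]) (auto simp: freq_ball_def)
  then show ?thesis by (auto simp: freq_ball_def)
qed

lemma freq_ball_mono: "m \<le> n \<Longrightarrow> freq_ball m \<subseteq> freq_ball n"
  by (auto simp: freq_ball_def)

lemma filterlim_freq_ball: "filterlim (freq_ball :: nat \<Rightarrow> (int^'d::finite) set) (finite_subsets_at_top UNIV) sequentially"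
  unfolding filterlim_finite_subsets_at_top
proof (intro allI impI)
  fix X :: "(int^'d) set" assume X: "finite X \<and> X \<subseteq> UNIV"
  obtain N where N: "\<forall>k\<in>X. norm (kvec k) \<le> real N"
  proof -
    have "\<forall>k\<in>X. norm (kvec k) \<le> real (nat \<lceil>\<Sum>k\<in>X. norm (kvec k)\<rceil>)"
    proof
      fix k assume "k \<in> X"
      then have "norm (kvec k) \<le> (\<Sum>k\<in>X. norm (kvec k))" using X by (intro member_le_sum) auto
      then show "norm (kvec k) \<le> real (nat \<lceil>\<Sum>k\<in>X. norm (kvec k)\<rceil>)" by linarith
    qed
    then show ?thesis using that by blast
  qed
  show "\<forall>\<^sub>F n in sequentially. finite (freq_ball n :: (int^'d) set) \<and> X \<subseteq> freq_ball n \<and> freq_ball n \<subseteq> UNIV"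
  proof (rule eventually_sequentiallyI[of N])
    fix n assume "N \<le> n"
    then have "norm (kvec k) \<le> real n" if "k \<in> X" for k
      using N that of_nat_mono[of N n, where 'a=real] order_trans by blast
    then show "finite (freq_ball n :: (int^'d) set) \<and> X \<subseteq> freq_ball n \<and> freq_ball n \<subseteq> UNIV"
      using finite_freq_ball by (auto simp: freq_ball_def)
  qed
qed

lemma integral_norm_square_trig_poly:
  fixes a :: "int^'d::finite \<Rightarrow> complex"
  assumes F: "finite F"
  shows "integral\<^sup>L torus_measure (\<lambda>x. (norm (\<Sum>k\<in>F. a k * efun k x))\<^sup>2) = (\<Sum>k\<in>F. (norm (a k))\<^sup>2)"
proof -
  have eq: "complex_of_real ((norm (\<Sum>k\<in>F. a k * efun k x))\<^sup>2)
      = (\<Sum>k\<in>F. \<Sum>h\<in>F. a k * cnj (a h) * (efun k x * efun (- h) x))" for x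
    unfolding complex_norm_square by (simp add: sum_product cnj_efun mult_ac)
  have int: "integrable torus_measure (\<lambda>x. a k * cnj (a h) * (efun k x * efun (- h) x))" for k h
    by (intro integrable_torus_continuous continuous_intros)
  have "complex_of_real (integral\<^sup>L torus_measure (\<lambda>x. (norm (\<Sum>k\<in>F. a k * efun k x))\<^sup>2))
    = integral\<^sup>L torus_measure (\<lambda>x. \<Sum>k\<in>F. \<Sum>h\<in>F. a k * cnj (a h) * (efun k x * efun (- h) x))"
    unfolding eq[symmetric] by (rule integral_complex_of_real[symmetric])
  also have "\<dots> = (\<Sum>k\<in>F. \<Sum>h\<in>F. a k * cnj (a h) * integral\<^sup>L torus_measure (\<lambda>x. efun k x * efun (- h) x))"
    using int by (simp add: Bochner_Integration.integral_sum)
  also have "\<dots> = (\<Sum>k\<in>F. \<Sum>h\<in>F. if h = k then a k * cnj (a k) else 0)"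
    unfolding set_integral_eq_torus_measure(2)[symmetric] torus_integral_efun_mult
    by (intro sum.cong refl) auto
  also have "\<dots> = (\<Sum>k\<in>F. a k * cnj (a k))" using F by simp
  also have "\<dots> = complex_of_real (\<Sum>k\<in>F. (norm (a k))\<^sup>2)"
    by (simp add: complex_norm_square del: of_real_power)
  finally show ?thesis using of_real_eq_iff by blast
qed

lemma integrable_product_of_squares:
  fixes u w :: "'a \<Rightarrow> real"
  assumes [measurable]: "u \<in> borel_measurable M" "w \<in> borel_measurable M"
    and "integrable M (\<lambda>x. (u x)\<^sup>2)" "integrable M (\<lambda>x. (w x)\<^sup>2)"
  shows "integrable M (\<lambda>x. u x * w x)"
proof (rule Bochner_Integration.integrable_bound)
  show "integrable M (\<lambda>x. (u x)\<^sup>2 + (w x)\<^sup>2)" using assms by simp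
  have "\<bar>a * b\<bar> \<le> a\<^sup>2 + b\<^sup>2" for a b :: real
    using sum_squares_bound[of "\<bar>a\<bar>" "\<bar>b\<bar>"] mult_nonneg_nonneg[OF abs_ge_zero abs_ge_zero, of a b]
    unfolding abs_mult power2_abs by linarith
  then show "AE x in M. norm (u x * w x) \<le> norm ((u x)\<^sup>2 + (w x)\<^sup>2)" by auto
qed measurable

text \<open>
  The weighted inequality \<open>|u w| \<le> u\<^sup>2 / q + q w\<^sup>2\<close> replaces Cauchy-Schwarz: a small fixed \<open>q\<close> controls
  the second term, after which the first one tends to zero.
\<close>

lemma L2_null_times_L2_tendsto:
  fixes u :: "nat \<Rightarrow> 'a \<Rightarrow> real" and w :: "'a \<Rightarrow> real"
  assumes m: "\<And>n. u n \<in> borel_measurable M" "w \<in> borel_measurable M"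
    and u: "\<And>n. integrable M (\<lambda>x. (u n x)\<^sup>2)" and w: "integrable M (\<lambda>x. (w x)\<^sup>2)"
    and lim: "(\<lambda>n. integral\<^sup>L M (\<lambda>x. (u n x)\<^sup>2)) \<longlonglongrightarrow> 0"
  shows "(\<lambda>n. integral\<^sup>L M (\<lambda>x. \<bar>u n x * w x\<bar>)) \<longlonglongrightarrow> 0"
proof (rule LIMSEQ_I)
  fix e :: real assume e: "e > 0"
  define I where "I = integral\<^sup>L M (\<lambda>x. (w x)\<^sup>2)"
  have I: "I \<ge> 0" by (simp add: I_def)
  define q where "q = e / (2 * (I + 1))"
  have q: "q > 0" using e I by (simp add: q_def)
  have le: "integral\<^sup>L M (\<lambda>x. \<bar>u n x * w x\<bar>) \<le> integral\<^sup>L M (\<lambda>x. (u n x)\<^sup>2) / q + q * I" for n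
  proof -
    have "\<bar>a * b\<bar> \<le> a\<^sup>2 / q + q * b\<^sup>2" for a b :: real
    proof -
      have "0 \<le> (\<bar>a\<bar> - q * \<bar>b\<bar>)\<^sup>2 + q * \<bar>a\<bar> * \<bar>b\<bar>" using q by auto
      then have "q * (\<bar>a\<bar> * \<bar>b\<bar>) \<le> \<bar>a\<bar>\<^sup>2 + (q * \<bar>b\<bar>)\<^sup>2"
        by (simp add: power2_eq_square algebra_simps)
      then have "\<bar>a\<bar> * \<bar>b\<bar> \<le> (\<bar>a\<bar>\<^sup>2 + (q * \<bar>b\<bar>)\<^sup>2) / q" using q by (simp add: pos_le_divide_eq mult.commute)
      also have "\<dots> = a\<^sup>2 / q + q * b\<^sup>2" using q by (simp add: add_divide_distrib power_mult_distrib power2_eq_square)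
      finally show ?thesis by (simp add: abs_mult)
    qed
    then have "integral\<^sup>L M (\<lambda>x. \<bar>u n x * w x\<bar>) \<le> integral\<^sup>L M (\<lambda>x. (u n x)\<^sup>2 / q + q * (w x)\<^sup>2)"
      using u w integrable_product_of_squares[OF m u w]
      by (intro Bochner_Integration.integral_mono) auto
    also have "\<dots> = integral\<^sup>L M (\<lambda>x. (u n x)\<^sup>2) / q + q * I"
      using u w by (simp add: I_def)
    finally show ?thesis .
  qed
  have "q * I < e / 2 + e / 4"
  proof -
    have "q * I \<le> q * (I + 1)" using q by simp
    also have "\<dots> = e / 2" using I by (simp add: q_def field_simps)
    finally show ?thesis using e by simp
  qed
  moreover have "q * (e / 4) > 0" using q e by simp
  from LIMSEQ_D[OF lim this] obtain N where N: "\<And>n. n \<ge> N \<Longrightarrow> integral\<^sup>L M (\<lambda>x. (u n x)\<^sup>2) < q * (e / 4)"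
    by (fastforce simp: abs_less_iff)
  have "norm (integral\<^sup>L M (\<lambda>x. \<bar>u n x * w x\<bar>) - 0) < e" if "n \<ge> N" for n
  proof -
    have "integral\<^sup>L M (\<lambda>x. (u n x)\<^sup>2) / q < e / 4" using N[OF that] q by (simp add: pos_divide_less_eq mult.commute)
    then have "integral\<^sup>L M (\<lambda>x. \<bar>u n x * w x\<bar>) < e"
      using le[of n] \<open>q * I < e / 2 + e / 4\<close> by linarith
    then show ?thesis by (simp add: integral_nonneg_AE)
  qed
  then show "\<exists>N. \<forall>n\<ge>N. norm (integral\<^sup>L M (\<lambda>x. \<bar>u n x * w x\<bar>) - 0) < e" by blast
qed

definition trig_sum :: "(int^'d::finite \<Rightarrow> complex) \<Rightarrow> nat \<Rightarrow> real^'d \<Rightarrow> real" where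
  "trig_sum a n x = Re (\<Sum>k\<in>freq_ball n. a k * efun k x)"

lemma continuous_trig_sum [continuous_intros]: "continuous_on S (trig_sum a n)"
  unfolding trig_sum_def by (intro continuous_intros)

lemma trig_sum_measurable: "trig_sum a n \<in> borel_measurable torus_measure"
  by (intro torus_measurable borel_measurable_continuous_onI continuous_intros)

lemma of_real_trig_sum:
  assumes "\<And>k. a (- k) = cnj (a k)"
  shows "of_real (trig_sum a n x) = (\<Sum>k\<in>freq_ball n. a k * efun k x)"
proof -
  have "cnj (\<Sum>k\<in>freq_ball n. a k * efun k x) = (\<Sum>k\<in>freq_ball n. a (- k) * efun (- k) x)"
    by (simp add: assms cnj_efun)
  also have "\<dots> = (\<Sum>k\<in>uminus ` freq_ball n. a k * efun k x)"
    by (subst sum.reindex) auto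
  finally have "cnj (\<Sum>k\<in>freq_ball n. a k * efun k x) = (\<Sum>k\<in>freq_ball n. a k * efun k x)"
    by (simp only: uminus_freq_ball)
  then have "(\<Sum>k\<in>freq_ball n. a k * efun k x) \<in> \<real>" by (simp add: Reals_cnj_iff)
  then show ?thesis unfolding trig_sum_def by (rule of_real_Re)
qed

text \<open>
  Completeness of \<open>L\<^sup>2\<close>: a subsequence of the partial sums converges almost everywhere, and Fatou's
  lemma bounds the \<open>L\<^sup>2\<close>-distance of its limit to each partial sum by the tail of the series.
\<close>

theorem riesz_fischer:
  fixes a :: "int^'d::finite \<Rightarrow> complex"
  assumes herm: "\<And>k. a (- k) = cnj (a k)" and bnd: "\<And>G. finite G \<Longrightarrow> (\<Sum>k\<in>G. (norm (a k))\<^sup>2) \<le> A"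
  obtains f :: "real^'d \<Rightarrow> real" where
    "f \<in> borel_measurable torus_measure" "integrable torus_measure (\<lambda>x. (f x)\<^sup>2)"
    "\<And>n. integrable torus_measure (\<lambda>x. (f x - trig_sum a n x)\<^sup>2)"
    "(\<lambda>n. integral\<^sup>L torus_measure (\<lambda>x. (f x - trig_sum a n x)\<^sup>2)) \<longlonglongrightarrow> 0"
proof -
  interpret finite_measure "torus_measure :: (real^'d) measure" by (rule finite_torus_measure)
  let ?M = "torus_measure :: (real^'d) measure"
  define E where "E n = (\<Sum>k\<in>freq_ball n. (norm (a k))\<^sup>2)" for n
  have incE: "incseq E"
    unfolding incseq_def E_def by (intro allI impI sum_mono2 finite_freq_ball freq_ball_mono) auto
  have "E n \<le> A" for n unfolding E_def by (rule bnd[OF finite_freq_ball])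
  then obtain L where L: "E \<longlonglongrightarrow> L" and EL: "\<And>n. E n \<le> L"
    using incseq_convergent[OF incE] by metis
  note [measurable] = trig_sum_measurable[of a]
  have int2: "integrable ?M (\<lambda>x. (trig_sum a m x - trig_sum a n x)\<^sup>2)" for m n
    by (intro integrable_torus_continuous continuous_intros)
  have diff: "integral\<^sup>L ?M (\<lambda>x. (trig_sum a m x - trig_sum a n x)\<^sup>2) \<le> L - E n" if "n \<le> m" for m n
  proof -
    have sub: "freq_ball n \<subseteq> (freq_ball m :: (int^'d) set)" by (rule freq_ball_mono[OF that])
    have "(trig_sum a m x - trig_sum a n x)\<^sup>2 = (norm (\<Sum>k\<in>freq_ball m - freq_ball n. a k * efun k x))\<^sup>2" for x
    proof -
      have "of_real (trig_sum a m x - trig_sum a n x) = (\<Sum>k\<in>freq_ball m - freq_ball n. a k * efun k x)"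
        using of_real_trig_sum[of a, OF herm] sum_diff[OF finite_freq_ball sub, of "\<lambda>k. a k * efun k x"] by simp
      then show ?thesis by (metis norm_of_real power2_abs)
    qed
    then have "integral\<^sup>L ?M (\<lambda>x. (trig_sum a m x - trig_sum a n x)\<^sup>2)
      = (\<Sum>k\<in>freq_ball m - freq_ball n. (norm (a k))\<^sup>2)"
      by (simp add: integral_norm_square_trig_poly finite_freq_ball)
    also have "\<dots> = E m - E n" unfolding E_def by (rule sum_diff[OF finite_freq_ball sub])
    finally show ?thesis using EL[of m] by simp
  qed
  have cauchy: "\<exists>N. \<forall>i\<ge>N. \<forall>j\<ge>N. integral\<^sup>L ?M (\<lambda>x. norm (trig_sum a i x - trig_sum a j x)) < e" if e: "e > 0" for e
  proof -
    define V where "V = measure ?M (space ?M) + 1"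
    have V: "V > 0" by (simp add: V_def add_nonneg_pos)
    define q where "q = e / (2 * V)"
    have q: "q > 0" using e V by (simp add: q_def)
    have "q * (e / 2) > 0" using q e by simp
    then obtain N where N: "L - E N < q * (e / 2)"
      using LIMSEQ_D[OF L, of "q * (e / 2)"] EL by (force simp: abs_less_iff)
    have *: "integral\<^sup>L ?M (\<lambda>x. norm (trig_sum a i x - trig_sum a j x)) < e" if "N \<le> j" "j \<le> i" for i j
    proof -
      \<comment> \<open>Closeness in \<open>L\<^sup>2\<close> on a space of finite measure gives closeness in \<open>L\<^sup>1\<close>.\<close>
      have pw: "norm t \<le> q + t\<^sup>2 / q" for t :: real
      proof (cases "\<bar>t\<bar> \<le> q")
        case False
        then have "\<bar>t\<bar> * q \<le> \<bar>t\<bar> * \<bar>t\<bar>" using q by (intro mult_left_mono) auto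
        then have "\<bar>t\<bar> \<le> t\<^sup>2 / q" using q by (simp add: pos_le_divide_eq power2_eq_square)
        then show ?thesis using q by simp
      next
        case True
        have "0 \<le> t\<^sup>2 / q" using q by simp
        then show ?thesis using True unfolding real_norm_def by linarith
      qed
      have "integral\<^sup>L ?M (\<lambda>x. norm (trig_sum a i x - trig_sum a j x))
        \<le> integral\<^sup>L ?M (\<lambda>x. q + (trig_sum a i x - trig_sum a j x)\<^sup>2 / q)"
        by (intro Bochner_Integration.integral_mono pw integrable_torus_continuous continuous_intros) (use q in auto)
      also have "\<dots> = q * measure ?M (space ?M) + integral\<^sup>L ?M (\<lambda>x. (trig_sum a i x - trig_sum a j x)\<^sup>2) / q"
        using int2 by simp
      also have "\<dots> \<le> q * V + (L - E j) / q"
        using diff[OF that(2)] q by (intro add_mono mult_left_mono divide_right_mono) (auto simp: V_def)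
      also have "\<dots> \<le> e / 2 + (L - E N) / q"
        using incE that(1) q V by (intro add_mono divide_right_mono) (auto simp: q_def incseq_def)
      also have "\<dots> < e / 2 + e / 2"
      proof -
        have "(L - E N) / q < e / 2" unfolding pos_divide_less_eq[OF q] using N by (simp only: mult.commute)
        then show ?thesis by linarith
      qed
      finally show ?thesis by simp
    qed
    have "integral\<^sup>L ?M (\<lambda>x. norm (trig_sum a i x - trig_sum a j x)) < e" if "i \<ge> N" "j \<ge> N" for i j
      using *[of j i] *[of i j] that by (cases "i \<le> j") (auto simp: norm_minus_commute abs_minus_commute)
    then show ?thesis by blast
  qed
  have int1: "integrable ?M (trig_sum a n)" for n
    by (intro integrable_torus_continuous continuous_intros)
  obtain r where r: "strict_mono r" "AE x in ?M. Cauchy (\<lambda>i. trig_sum a (r i) x)"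
    using cauchy_L1_AE_cauchy_subseq[of ?M "trig_sum a", OF int1 cauchy] by blast
  define f where "f x = lim (\<lambda>i. trig_sum a (r i) x)" for x
  have fm [measurable]: "f \<in> borel_measurable ?M" unfolding f_def by measurable
  have conv: "AE x in ?M. (\<lambda>i. trig_sum a (r i) x) \<longlonglongrightarrow> f x"
    using r(2) by eventually_elim (simp add: f_def Cauchy_convergent_iff convergent_LIMSEQ_iff)
  have nn: "(\<integral>\<^sup>+x. ennreal ((f x - trig_sum a n x)\<^sup>2) \<partial>?M) \<le> ennreal (L - E n)" for n
  proof -
    have "(\<integral>\<^sup>+x. ennreal ((f x - trig_sum a n x)\<^sup>2) \<partial>?M)
      = (\<integral>\<^sup>+x. liminf (\<lambda>i. ennreal ((trig_sum a (r i) x - trig_sum a n x)\<^sup>2)) \<partial>?M)"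
    proof (rule nn_integral_cong_AE)
      show "AE x in ?M. ennreal ((f x - trig_sum a n x)\<^sup>2) = liminf (\<lambda>i. ennreal ((trig_sum a (r i) x - trig_sum a n x)\<^sup>2))"
        using conv
      proof eventually_elim
        case (elim x)
        then have "(\<lambda>i. ennreal ((trig_sum a (r i) x - trig_sum a n x)\<^sup>2)) \<longlonglongrightarrow> ennreal ((f x - trig_sum a n x)\<^sup>2)"
          by (intro tendsto_intros)
        then show ?case by (rule lim_imp_Liminf[OF trivial_limit_sequentially, symmetric])
      qed
    qed
    also have "\<dots> \<le> liminf (\<lambda>i. \<integral>\<^sup>+x. ennreal ((trig_sum a (r i) x - trig_sum a n x)\<^sup>2) \<partial>?M)"
      by (rule nn_integral_liminf) measurable
    also have "\<dots> \<le> liminf (\<lambda>i. ennreal (L - E n))"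
    proof (rule Liminf_mono)
      show "\<forall>\<^sub>F i in sequentially. (\<integral>\<^sup>+x. ennreal ((trig_sum a (r i) x - trig_sum a n x)\<^sup>2) \<partial>?M) \<le> ennreal (L - E n)"
      proof (intro eventually_sequentiallyI[of n])
        fix i assume "n \<le> i"
        then have "n \<le> r i" using seq_suble[OF r(1), of i] by simp
        then show "(\<integral>\<^sup>+x. ennreal ((trig_sum a (r i) x - trig_sum a n x)\<^sup>2) \<partial>?M) \<le> ennreal (L - E n)"
          using int2 by (subst nn_integral_eq_integral) (auto intro!: ennreal_leI diff)
      qed
    qed
    also have "\<dots> = ennreal (L - E n)" by (rule lim_imp_Liminf) auto
    finally show ?thesis .
  qed
  have i2: "integrable ?M (\<lambda>x. (f x - trig_sum a n x)\<^sup>2)" for n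
    using order.strict_trans1[OF nn[of n] ennreal_less_top] by (intro integrableI_nonneg) auto
  have le: "integral\<^sup>L ?M (\<lambda>x. (f x - trig_sum a n x)\<^sup>2) \<le> L - E n" for n
    using nn[of n] EL[of n] by (subst (asm) nn_integral_eq_integral[OF i2]) (auto simp: ennreal_le_iff)
  show ?thesis
  proof (rule that[of f])
    have "integrable ?M (\<lambda>x. 2 * (f x - trig_sum a 0 x)\<^sup>2 + 2 * (trig_sum a 0 x)\<^sup>2)"
      by (intro Bochner_Integration.integrable_add integrable_mult_right i2 integrable_torus_continuous continuous_intros)
    then show "integrable ?M (\<lambda>x. (f x)\<^sup>2)"
    proof (rule Bochner_Integration.integrable_bound)
      have "(s::real)\<^sup>2 \<le> 2 * (s - t)\<^sup>2 + 2 * t\<^sup>2" for s t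
        using zero_le_power2[of "s - 2 * t"] by (simp add: power2_eq_square algebra_simps)
      then show "AE x in ?M. norm ((f x)\<^sup>2) \<le> norm (2 * (f x - trig_sum a 0 x)\<^sup>2 + 2 * (trig_sum a 0 x)\<^sup>2)"
        by (intro AE_I2) (simp add: abs_of_nonneg)
    qed measurable
    have "(\<lambda>n. L - E n) \<longlonglongrightarrow> L - L" by (intro tendsto_intros L)
    then have LE: "(\<lambda>n. L - E n) \<longlonglongrightarrow> 0" by simp
    show "(\<lambda>n. integral\<^sup>L ?M (\<lambda>x. (f x - trig_sum a n x)\<^sup>2)) \<longlonglongrightarrow> 0"
    proof (rule tendsto_sandwich[OF always_eventually always_eventually tendsto_const LE])
      show "\<forall>n. 0 \<le> integral\<^sup>L ?M (\<lambda>x. (f x - trig_sum a n x)\<^sup>2)"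
        by (simp add: Bochner_Integration.integral_nonneg)
    qed (use le in blast)
  qed (rule fm i2)+
qed

text \<open>
  The partial sums converge in \<open>L\<^sup>2\<close>, so they may be integrated termwise against a second square
  integrable function.
\<close>

lemma integral_times_trig_sum_tendsto:
  fixes a :: "int^'d::finite \<Rightarrow> complex" and g h :: "real^'d \<Rightarrow> real"
  assumes herm: "\<And>k. a (- k) = cnj (a k)"
    and m: "f \<in> borel_measurable torus_measure" "g \<in> borel_measurable torus_measure"
    and g2: "integrable torus_measure (\<lambda>x. (g x)\<^sup>2)" and f2: "integrable torus_measure (\<lambda>x. (f x)\<^sup>2)"
    and i: "\<And>n. integrable torus_measure (\<lambda>x. (f x - trig_sum a n x)\<^sup>2)"
    and lim: "(\<lambda>n. integral\<^sup>L torus_measure (\<lambda>x. (f x - trig_sum a n x)\<^sup>2)) \<longlonglongrightarrow> 0"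
    and \<phi>: "\<phi> \<in> test_funs"
  shows "(\<lambda>n. \<Sum>k\<in>freq_ball n. a k * torus_integral (\<lambda>x. efun k x * (of_real (g x) * \<phi> x)))
    \<longlonglongrightarrow> torus_integral (\<lambda>x. of_real (f x * g x) * \<phi> x)"
proof -
  let ?M = "torus_measure :: (real^'d) measure"
  note [measurable] = trig_sum_measurable[of a] m
  have \<phi>m [measurable]: "\<phi> \<in> borel_measurable ?M"
    by (intro torus_measurable borel_measurable_continuous_onI test_funs_continuous \<phi>)
  have em [measurable]: "efun k \<in> borel_measurable ?M" for k
    by (intro torus_measurable efun_measurable)
  obtain B where B: "\<And>x. norm (\<phi> x) \<le> B"
    using periodic_fun_bounded[OF test_funs_periodic[OF \<phi>] test_funs_continuous[OF \<phi>]] by blast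
  have B0: "B \<ge> 0" using order_trans[OF norm_ge_zero B] .
  have bound_int: "integrable ?M (\<lambda>x. of_real (w x) * \<phi> x)" if "integrable ?M w" for w :: "real^'d \<Rightarrow> real"
  proof (rule Bochner_Integration.integrable_bound)
    show "integrable ?M (\<lambda>x. w x * B)" using that by simp
    show "AE x in ?M. norm (of_real (w x) * \<phi> x) \<le> norm (w x * B)"
      by (intro AE_I2) (auto simp: norm_mult abs_mult abs_of_nonneg[OF B0] intro!: mult_left_mono B)
    have "w \<in> borel_measurable ?M" using that by simp
    then show "(\<lambda>x. of_real (w x) * \<phi> x) \<in> borel_measurable ?M" by measurable
  qed
  have t2: "integrable ?M (\<lambda>x. (trig_sum a n x)\<^sup>2)" for n
    by (intro integrable_torus_continuous continuous_intros)
  have ig: "integrable ?M g"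
    using integrable_product_of_squares[OF m(2) borel_measurable_const g2, of 1]
      integrable_torus_continuous[of "\<lambda>x::real^'d. 1::real"] by simp
  have fg: "integrable ?M (\<lambda>x. f x * g x)"
    by (rule integrable_product_of_squares[OF m f2 g2])
  have tg: "integrable ?M (\<lambda>x. trig_sum a n x * g x)" for n
    by (rule integrable_product_of_squares[OF trig_sum_measurable m(2) t2 g2])
  have dg: "integrable ?M (\<lambda>x. (f x - trig_sum a n x) * g x)" for n
    by (rule integrable_product_of_squares[OF _ m(2) i g2]) measurable
  have partial: "(\<Sum>k\<in>freq_ball n. a k * torus_integral (\<lambda>x. efun k x * (of_real (g x) * \<phi> x)))
    = integral\<^sup>L ?M (\<lambda>x. of_real (trig_sum a n x * g x) * \<phi> x)" for n
  proof -
    have ei: "integrable ?M (\<lambda>x. a k * (efun k x * (of_real (g x) * \<phi> x)))" for k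
    proof (rule integrable_mult_right, rule Bochner_Integration.integrable_bound)
      show "integrable ?M (\<lambda>x. (2 * pi) powr (- real CARD('d) / 2) * norm (of_real (g x) * \<phi> x))"
        using bound_int[OF ig] by (intro integrable_mult_right integrable_norm)
    qed (auto simp: norm_mult norm_efun)
    have "of_real (trig_sum a n x * g x) * \<phi> x = (\<Sum>k\<in>freq_ball n. a k * (efun k x * (of_real (g x) * \<phi> x)))" for x
      using of_real_trig_sum[of a, OF herm, of n x]
      by (simp only: of_real_mult mult.assoc[of _ "of_real (g x)"]) (simp add: sum_distrib_right mult.assoc)
    then show ?thesis
      using ei unfolding set_integral_eq_torus_measure(2) by (simp add: Bochner_Integration.integral_sum)
  qed
  have "(\<lambda>n. B * integral\<^sup>L ?M (\<lambda>x. \<bar>(f x - trig_sum a n x) * g x\<bar>)) \<longlonglongrightarrow> B * 0"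
    by (intro tendsto_mult_left L2_null_times_L2_tendsto i g2 lim) measurable
  then have lim0: "(\<lambda>n. B * integral\<^sup>L ?M (\<lambda>x. \<bar>(f x - trig_sum a n x) * g x\<bar>)) \<longlonglongrightarrow> 0" by simp
  have "(\<lambda>n. integral\<^sup>L ?M (\<lambda>x. of_real (trig_sum a n x * g x) * \<phi> x) - integral\<^sup>L ?M (\<lambda>x. of_real (f x * g x) * \<phi> x)) \<longlonglongrightarrow> 0"
  proof (rule Lim_null_comparison[OF always_eventually lim0], rule allI)
    fix n
    have "norm (integral\<^sup>L ?M (\<lambda>x. of_real (trig_sum a n x * g x) * \<phi> x) - integral\<^sup>L ?M (\<lambda>x. of_real (f x * g x) * \<phi> x))
      = norm (integral\<^sup>L ?M (\<lambda>x. of_real (trig_sum a n x * g x) * \<phi> x - of_real (f x * g x) * \<phi> x))"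
      by (subst Bochner_Integration.integral_diff) (use bound_int[OF tg] bound_int[OF fg] in auto)
    also have "\<dots> = norm (integral\<^sup>L ?M (\<lambda>x. of_real ((trig_sum a n x - f x) * g x) * \<phi> x))"
      by (simp add: algebra_simps)
    also have "\<dots> \<le> integral\<^sup>L ?M (\<lambda>x. B * \<bar>(f x - trig_sum a n x) * g x\<bar>)"
    proof (rule Bochner_Integration.integral_norm_bound_integral)
      have "integrable ?M (\<lambda>x. - ((f x - trig_sum a n x) * g x))" using dg by simp
      then have "integrable ?M (\<lambda>x. (trig_sum a n x - f x) * g x)" by (simp add: algebra_simps)
      then show "integrable ?M (\<lambda>x. of_real ((trig_sum a n x - f x) * g x) * \<phi> x)" by (rule bound_int)
      show "norm (of_real ((trig_sum a n x - f x) * g x) * \<phi> x) \<le> B * \<bar>(f x - trig_sum a n x) * g x\<bar>" for x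
        unfolding norm_mult[of "of_real _"] norm_of_real
        using mult_left_mono[OF B[of x], of "\<bar>(f x - trig_sum a n x) * g x\<bar>"]
        by (simp add: mult.commute abs_mult abs_minus_commute)
    qed (use dg in simp)
    finally show "norm (integral\<^sup>L ?M (\<lambda>x. of_real (trig_sum a n x * g x) * \<phi> x) - integral\<^sup>L ?M (\<lambda>x. of_real (f x * g x) * \<phi> x))
      \<le> B * integral\<^sup>L ?M (\<lambda>x. \<bar>(f x - trig_sum a n x) * g x\<bar>)"
      by simp
  qed
  then show ?thesis
    unfolding partial unfolding set_integral_eq_torus_measure(2) by (rule LIM_zero_cancel)
qed

text \<open>
  Phrased with finite sums, the form in which bounds for the Sobolev spaces are available.
\<close>

definition square_summable :: "'d::finite distr \<Rightarrow> bool" where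
  "square_summable T \<longleftrightarrow> (\<exists>A. \<forall>G. finite G \<longrightarrow> (\<Sum>k\<in>G. (norm (dcoeff T k))\<^sup>2) \<le> A)"

lemma square_summable_L2:
  fixes T :: "'d::finite distr"
  assumes "square_summable T"
  obtains f where "represents f T" "f \<in> borel_measurable torus_measure" "integrable torus_measure (\<lambda>x. (f x)\<^sup>2)"
    "\<And>n. integrable torus_measure (\<lambda>x. (f x - trig_sum (dcoeff T) n x)\<^sup>2)"
    "(\<lambda>n. integral\<^sup>L torus_measure (\<lambda>x. (f x - trig_sum (dcoeff T) n x)\<^sup>2)) \<longlonglongrightarrow> 0"
proof -
  obtain A where A: "\<And>G. finite G \<Longrightarrow> (\<Sum>k\<in>G. (norm (dcoeff T k))\<^sup>2) \<le> A"
    using assms unfolding square_summable_def by blast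
  obtain f where f: "f \<in> borel_measurable torus_measure" "integrable torus_measure (\<lambda>x. (f x)\<^sup>2)"
    "\<And>n. integrable torus_measure (\<lambda>x. (f x - trig_sum (dcoeff T) n x)\<^sup>2)"
    "(\<lambda>n. integral\<^sup>L torus_measure (\<lambda>x. (f x - trig_sum (dcoeff T) n x)\<^sup>2)) \<longlonglongrightarrow> 0"
    using riesz_fischer[of "dcoeff T" A, OF dcoeff_uminus_index A] by blast
  have one: "integrable torus_measure (\<lambda>x::real^'d. (1::real)\<^sup>2)"
    by (intro integrable_torus_continuous continuous_intros)
  have "integrable torus_measure (\<lambda>x. f x * 1)"
    by (rule integrable_product_of_squares[OF f(1) _ f(2) one]) simp
  then have int: "set_integrable lborel period_cell f"
    by (simp add: set_integral_eq_torus_measure)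
  have "pairing T \<phi> = torus_integral (\<lambda>x. of_real (f x) * \<phi> x)" if \<phi>: "\<phi> \<in> test_funs" for \<phi>
  proof (rule LIMSEQ_unique)
    show "(\<lambda>n. \<Sum>k\<in>freq_ball n. dcoeff T k * torus_coeff \<phi> (- k)) \<longlonglongrightarrow> pairing T \<phi>"
      using filterlim_compose[OF pairing_has_sum[OF \<phi>, of T, unfolded has_sum_def] filterlim_freq_ball] .
    show "(\<lambda>n. \<Sum>k\<in>freq_ball n. dcoeff T k * torus_coeff \<phi> (- k)) \<longlonglongrightarrow> torus_integral (\<lambda>x. of_real (f x) * \<phi> x)"
      using integral_times_trig_sum_tendsto[OF dcoeff_uminus_index f(1) _ one f(2,3,4) \<phi>]
      by (simp add: torus_integral_efun_times)
  qed
  then have "represents f T" using int by (simp add: represents_def)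
  then show ?thesis using that f by blast
qed

lemma distr_of_integrable:
  fixes f :: "real^'d::finite \<Rightarrow> real"
  assumes f: "set_integrable lborel period_cell f"
  shows "\<exists>T. represents f T"
proof -
  let ?M = "torus_measure :: (real^'d) measure"
  define S where "S \<phi> = (if \<phi> \<in> test_funs then torus_integral (\<lambda>x. of_real (f x) * \<phi> x) else 0)" for \<phi>
  have fi: "integrable ?M f" using f by (simp add: set_integral_eq_torus_measure)
  have bound: "integrable ?M (\<lambda>x. of_real (f x) * \<phi> x) \<and>
      norm (torus_integral (\<lambda>x. of_real (f x) * \<phi> x)) \<le> integral\<^sup>L ?M (\<lambda>x. \<bar>f x\<bar>) * B"
    if \<phi>: "\<phi> \<in> test_funs" and B: "\<And>x. norm (\<phi> x) \<le> B" for \<phi> B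
  proof
    have B0: "B \<ge> 0" using order_trans[OF norm_ge_zero B] .
    have pm: "\<phi> \<in> borel_measurable ?M"
      by (intro torus_measurable borel_measurable_continuous_onI test_funs_continuous \<phi>)
    show *: "integrable ?M (\<lambda>x. of_real (f x) * \<phi> x)"
    proof (rule Bochner_Integration.integrable_bound)
      show "integrable ?M (\<lambda>x. f x * B)" using fi by simp
      show "AE x in ?M. norm (of_real (f x) * \<phi> x) \<le> norm (f x * B)"
        by (intro AE_I2) (auto simp: norm_mult abs_mult abs_of_nonneg[OF B0] intro!: mult_left_mono B)
      show "(\<lambda>x. of_real (f x) * \<phi> x) \<in> borel_measurable ?M"
        using borel_measurable_integrable[OF fi] pm by measurable
    qed
    have "norm (torus_integral (\<lambda>x. of_real (f x) * \<phi> x)) \<le> integral\<^sup>L ?M (\<lambda>x. \<bar>f x\<bar> * B)"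
      unfolding set_integral_eq_torus_measure(2)
      by (rule Bochner_Integration.integral_norm_bound_integral[OF *])
        (use fi in \<open>auto simp: norm_mult intro!: mult_left_mono B\<close>)
    then show "norm (torus_integral (\<lambda>x. of_real (f x) * \<phi> x)) \<le> integral\<^sup>L ?M (\<lambda>x. \<bar>f x\<bar>) * B" by simp
  qed
  have intphi: "integrable ?M (\<lambda>x. of_real (f x) * \<phi> x)" if t: "\<phi> \<in> test_funs" for \<phi>
  proof -
    obtain B where B: "\<And>x. norm (\<phi> x) \<le> B"
      using periodic_fun_bounded[OF test_funs_periodic[OF t] test_funs_continuous[OF t]] by blast
    show ?thesis using bound[OF t B] by blast
  qed
  have "is_real_distr S"
    unfolding is_real_distr_def
  proof (intro conjI ballI allI impI)
    fix \<phi> \<psi> :: "real^'d \<Rightarrow> complex" and a b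
    assume t: "\<phi> \<in> test_funs" "\<psi> \<in> test_funs"
    have "torus_integral (\<lambda>x. of_real (f x) * (a * \<phi> x + b * \<psi> x))
      = integral\<^sup>L ?M (\<lambda>x. a * (of_real (f x) * \<phi> x) + b * (of_real (f x) * \<psi> x))"
      unfolding set_integral_eq_torus_measure(2)
      by (intro Bochner_Integration.integral_cong refl) (simp add: algebra_simps)
    also have "\<dots> = a * integral\<^sup>L ?M (\<lambda>x. of_real (f x) * \<phi> x) + b * integral\<^sup>L ?M (\<lambda>x. of_real (f x) * \<psi> x)"
      using intphi[OF t(1)] intphi[OF t(2)] by simp
    finally show "S (\<lambda>x. a * \<phi> x + b * \<psi> x) = a * S \<phi> + b * S \<psi>"
      using test_funs_lincomb[OF t, of a b] t by (simp add: S_def set_integral_eq_torus_measure(2))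
  next
    fix \<phi> :: "real^'d \<Rightarrow> complex" assume t: "\<phi> \<in> test_funs"
    have "cnj (integral\<^sup>L ?M (\<lambda>x. of_real (f x) * \<phi> x)) = integral\<^sup>L ?M (\<lambda>x. cnj (of_real (f x) * \<phi> x))"
      by (subst integral_bounded_linear'[OF bounded_linear_cnj bounded_linear_cnj]) simp_all
    then show "S (\<lambda>x. cnj (\<phi> x)) = cnj (S \<phi>)"
      using test_funs_cnj[OF t] t by (simp add: S_def set_integral_eq_torus_measure(2))
  next
    show "\<exists>C m. \<forall>\<phi>\<in>test_funs. \<forall>M. derivs_bounded m \<phi> M \<longrightarrow> norm (S \<phi>) \<le> C * M"
    proof (rule exI[of _ "integral\<^sup>L ?M (\<lambda>x. \<bar>f x\<bar>)"], rule exI[of _ 0], intro ballI allI impI)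
      fix \<phi> :: "real^'d \<Rightarrow> complex" and M assume t: "\<phi> \<in> test_funs" and M: "derivs_bounded 0 \<phi> M"
      have "norm (\<phi> x) \<le> M" for x using M[rule_format, of "[]" x] by simp
      then show "norm (S \<phi>) \<le> integral\<^sup>L ?M (\<lambda>x. \<bar>f x\<bar>) * M"
        using bound[OF t, of M] t by (simp add: S_def)
    qed
  qed (auto simp: S_def)
  then have "pairing (Abs_distr S) = S" by (simp add: Abs_distr_inverse)
  then have "represents f (Abs_distr S)" using f by (simp add: represents_def S_def)
  then show ?thesis by blast
qed

text \<open>
  Pairing with the exponentials shows that \<open>f - g\<close> has vanishing Fourier coefficients.
\<close>

lemma represents_unique_AE:
  fixes f g :: "real^'d::finite \<Rightarrow> real"
  assumes "represents f T" "represents g T"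
  shows "AE x in lborel. x \<in> period_cell \<longrightarrow> f x = g x"
proof -
  have i: "set_integrable lborel period_cell f" "set_integrable lborel period_cell g"
    using assms by (auto simp: represents_def)
  have p: "torus_integral (\<lambda>x. of_real (f x) * efun k x) = torus_integral (\<lambda>x. of_real (g x) * efun k x)" for k
    using assms efun_in_test_funs[of k] unfolding represents_def by metis
  have ie: "set_integrable lborel period_cell (\<lambda>x. of_real (u x) * efun k x)"
    if u: "set_integrable lborel period_cell u" for u :: "real^'d \<Rightarrow> real" and k
    unfolding set_integrable_def
  proof (rule Bochner_Integration.integrable_bound)
    have ui: "integrable lborel (\<lambda>x. indicat_real period_cell x *\<^sub>R u x)"
      using u by (simp add: set_integrable_def)
    then show "integrable lborel (\<lambda>x. (2 * pi) powr (- real CARD('d) / 2) * (indicat_real period_cell x *\<^sub>R u x))"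
      by (rule integrable_mult_right)
    have "(\<lambda>x. of_real (indicat_real period_cell x *\<^sub>R u x) * efun k x) \<in> borel_measurable lborel"
      using borel_measurable_integrable[OF ui] by measurable
    then show "(\<lambda>x. indicat_real period_cell x *\<^sub>R (of_real (u x) * efun k x)) \<in> borel_measurable lborel"
      by (simp add: scaleR_conv_of_real mult.assoc)
  qed (intro AE_I2, simp add: norm_mult norm_efun abs_mult)
  have "AE x in lborel. x \<in> period_cell \<longrightarrow> complex_of_real (f x) - complex_of_real (g x) = 0"
  proof (rule AE_eq_0_if_coeffs_eq_0)
    have "set_integrable lborel period_cell (\<lambda>x. complex_of_real (u x))"
      if "set_integrable lborel period_cell u" for u :: "real^'d \<Rightarrow> real"
    proof -
      have "integrable torus_measure u" using that by (simp add: set_integral_eq_torus_measure)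
      then show ?thesis unfolding set_integral_eq_torus_measure by (rule integrable_of_real)
    qed
    then show "set_integrable lborel period_cell (\<lambda>x. complex_of_real (f x) - complex_of_real (g x))"
      using i by (intro set_integral_diff) auto
    show "torus_coeff (\<lambda>x. complex_of_real (f x) - complex_of_real (g x)) k = 0" for k
      using p[of "- k"] ie[OF i(1), of "- k"] ie[OF i(2), of "- k"]
      by (simp add: torus_coeff_def left_diff_distrib set_integral_diff)
  qed
  then show ?thesis by simp
qed

text \<open>
  The representing functions are square integrable and unique almost everywhere, so their product is
  integrable and well defined.  Expanding only the second factor in its Fourier series gives the
  convolution formula as a limit along balls of frequencies.
\<close>

theorem product_of_square_summable:
  fixes S T :: "'d::finite distr"
  assumes S: "square_summable S" and T: "square_summable T"
  shows "\<exists>!R. is_product S T R"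
    and "(\<lambda>n. of_real ((2 * pi) powr (- real CARD('d) / 2)) * (\<Sum>p\<in>freq_ball n. dcoeff S (k - p) * dcoeff T p))
      \<longlonglongrightarrow> dcoeff (distr_mult S T) k"
proof -
  obtain f where f: "represents f S" "f \<in> borel_measurable torus_measure" "integrable torus_measure (\<lambda>x. (f x)\<^sup>2)"
    using square_summable_L2[OF S] by blast
  obtain g where g: "represents g T" "g \<in> borel_measurable torus_measure" "integrable torus_measure (\<lambda>x. (g x)\<^sup>2)"
    "\<And>n. integrable torus_measure (\<lambda>x. (g x - trig_sum (dcoeff T) n x)\<^sup>2)"
    "(\<lambda>n. integral\<^sup>L torus_measure (\<lambda>x. (g x - trig_sum (dcoeff T) n x)\<^sup>2)) \<longlonglongrightarrow> 0"
    using square_summable_L2[OF T] by blast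
  have "set_integrable lborel period_cell (\<lambda>x. f x * g x)"
    unfolding set_integral_eq_torus_measure by (rule integrable_product_of_squares[OF f(2) g(2) f(3) g(3)])
  then obtain R where R: "represents (\<lambda>x. f x * g x) R" using distr_of_integrable by blast
  have prod: "is_product S T R" using f(1) g(1) R unfolding is_product_def by blast
  have uniq: "R' = R" if P: "is_product S T R'" for R'
  proof -
    obtain f' g' where fg': "represents f' S" "represents g' T" "represents (\<lambda>x. f' x * g' x) R'"
      using P unfolding is_product_def by blast
    have "AE x in lborel. x \<in> period_cell \<longrightarrow> f' x * g' x = f x * g x"
      using represents_unique_AE[OF fg'(1) f(1)] represents_unique_AE[OF fg'(2) g(1)]
      by eventually_elim auto
    then have AE: "AE x in torus_measure. f' x * g' x = f x * g x"
      by (simp add: AE_restrict_space_iff)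
    have im: "integrable torus_measure (\<lambda>x. f x * g x)" "integrable torus_measure (\<lambda>x. f' x * g' x)"
      using R fg'(3) by (auto simp: represents_def set_integral_eq_torus_measure)
    show ?thesis
    proof (rule distr_eqI_test_funs)
      fix \<phi> :: "real^'d \<Rightarrow> complex" assume \<phi>: "\<phi> \<in> test_funs"
      have pm: "\<phi> \<in> borel_measurable torus_measure"
        by (intro torus_measurable borel_measurable_continuous_onI test_funs_continuous \<phi>)
      have "integral\<^sup>L torus_measure (\<lambda>x. of_real (f' x * g' x) * \<phi> x) = integral\<^sup>L torus_measure (\<lambda>x. of_real (f x * g x) * \<phi> x)"
      proof (rule integral_cong_AE)
        show "(\<lambda>x. of_real (f' x * g' x) * \<phi> x) \<in> borel_measurable torus_measure"
          using borel_measurable_integrable[OF im(2)] pm by measurable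
        show "(\<lambda>x. of_real (f x * g x) * \<phi> x) \<in> borel_measurable torus_measure"
          using borel_measurable_integrable[OF im(1)] pm by measurable
        show "AE x in torus_measure. of_real (f' x * g' x) * \<phi> x = of_real (f x * g x) * \<phi> x"
          using AE by eventually_elim simp
      qed
      then show "pairing R' \<phi> = pairing R \<phi>"
        using R fg'(3) \<phi> by (simp add: represents_def set_integral_eq_torus_measure(2))
    qed
  qed
  show "\<exists>!R. is_product S T R" using prod uniq by blast
  have RR: "distr_mult S T = R" unfolding distr_mult_def using prod uniq by blast
  have lim: "(\<lambda>n. \<Sum>p\<in>freq_ball n. dcoeff T p * torus_integral (\<lambda>x. efun p x * (of_real (f x) * efun (- k) x)))
    \<longlonglongrightarrow> torus_integral (\<lambda>x. of_real (g x * f x) * efun (- k) x)"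
    by (rule integral_times_trig_sum_tendsto[OF dcoeff_uminus_index g(2) f(2,3) g(3,4,5) efun_in_test_funs])
  have "torus_integral (\<lambda>x. efun p x * (of_real (f x) * efun (- k) x))
    = of_real ((2 * pi) powr (- real CARD('d) / 2)) * dcoeff S (k - p)" for p
  proof -
    have "efun p x * (of_real (f x) * efun (- k) x)
      = of_real ((2 * pi) powr (- real CARD('d) / 2)) * (of_real (f x) * efun (- (k - p)) x)" for x
      using efun_mult[of p x "- k"] by (simp add: mult_ac)
    then have "torus_integral (\<lambda>x. efun p x * (of_real (f x) * efun (- k) x))
      = of_real ((2 * pi) powr (- real CARD('d) / 2)) * torus_integral (\<lambda>x. of_real (f x) * efun (- (k - p)) x)"
      by (simp only: set_integral_mult_right)
    then show ?thesis using f(1) efun_in_test_funs[of "- (k - p)"] by (simp add: represents_def dcoeff_def)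
  qed
  moreover have "torus_integral (\<lambda>x. of_real (g x * f x) * efun (- k) x) = dcoeff R k"
    using R efun_in_test_funs[of "- k"] by (simp add: represents_def dcoeff_def mult.commute)
  ultimately show "(\<lambda>n. of_real ((2 * pi) powr (- real CARD('d) / 2)) * (\<Sum>p\<in>freq_ball n. dcoeff S (k - p) * dcoeff T p))
      \<longlonglongrightarrow> dcoeff (distr_mult S T) k"
    using lim by (simp add: RR sum_distrib_left sum_distrib_right mult_ac)
qed

section \<open>Sobolev spaces of divergence free fields\<close>

definition weighted :: "real \<Rightarrow> (int^'d::finite \<Rightarrow> complex^'d) \<Rightarrow> int^'d \<Rightarrow> real" where
  "weighted n c k = norm (kvec k) powr n * norm (c k)"

lemma weighted_nonneg: "weighted n c k \<ge> 0"
  by (simp add: weighted_def)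

lemma weighted_0: "weighted n c 0 = 0"
  by (simp add: weighted_def)

lemma weighted_square: "norm (kvec k) powr (2 * n) * (norm (c k))\<^sup>2 = (weighted n c k)\<^sup>2"
  by (simp add: weighted_def power_mult_distrib power2_eq_square powr_add[symmetric])

lemma cdot_add: "cdot a (b + c) = cdot a b + cdot a c"
  by (simp add: cdot_def distrib_left sum.distrib)

lemma cdot_scaleR: "cdot a (r *\<^sub>R b) = of_real r * cdot a b"
  by (simp add: cdot_def sum_distrib_left) (simp add: scaleR_conv_of_real mult_ac)

lemma cdot_0_right: "cdot a 0 = 0"
  by (simp add: cdot_def)

lemma cdot_diff: "cdot a (b - c) = cdot a b - cdot a c"
  by (simp add: cdot_def right_diff_distrib sum_subtractf)

lemma tendsto_cdot:
  assumes "(f \<longlongrightarrow> b) F" shows "((\<lambda>i. cdot a (f i)) \<longlongrightarrow> cdot a b) F"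
  unfolding cdot_def by (intro tendsto_intros assms)

text \<open>
  Working with finite \<open>\<ell>\<^sup>2\<close> sums of weighted coefficients, bounded uniformly, transfers the
  inequalities known for \<open>L2_set\<close> to the Sobolev norm and makes limits harmless.
\<close>

lemma sobolev_norm_L2:
  fixes v :: "'d::finite vfield"
  assumes "\<And>F. finite F \<Longrightarrow> L2_set (weighted n (fcoeff v)) F \<le> C"
  shows "(\<lambda>k. (weighted n (fcoeff v) k)\<^sup>2) summable_on UNIV" and "sobolev_norm n v \<le> C"
proof -
  let ?g = "\<lambda>k. (weighted n (fcoeff v) k)\<^sup>2"
  have C0: "C \<ge> 0" using assms[of "{}"] by simp
  have le: "sum ?g F \<le> C\<^sup>2" if F: "finite F" for F
  proof -
    have "sqrt (sum ?g F) \<le> C" using assms[OF F] by (simp add: L2_set_def)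
    then show ?thesis using real_le_rsqrt sqrt_le_D by blast
  qed
  show s: "?g summable_on UNIV"
    by (rule nonneg_bdd_above_summable_on) (auto intro!: bdd_aboveI2 le)
  have s': "?g summable_on (UNIV - {0})" by (rule summable_on_subset_banach[OF s]) auto
  have "infsum ?g (UNIV - {0}) \<le> C\<^sup>2" by (rule infsum_le_finite_sums[OF s' le])
  then show "sobolev_norm n v \<le> C"
    unfolding sobolev_norm_def weighted_square using C0 real_le_lsqrt by blast
qed

lemma sobolev0_iff:
  "v \<in> sobolev0 n \<longleftrightarrow> fcoeff v 0 = 0 \<and> (\<exists>C. \<forall>F. finite F \<longrightarrow> L2_set (weighted n (fcoeff v)) F \<le> C)"
proof (intro iffI conjI; (elim conjE)?)
  let ?g = "\<lambda>k. (weighted n (fcoeff v) k)\<^sup>2"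
  assume v: "v \<in> sobolev0 n"
  then show "fcoeff v 0 = 0" by (simp add: sobolev0_def)
  have s: "?g summable_on (UNIV - {0})" using v by (simp add: sobolev0_def weighted_square)
  have "L2_set (weighted n (fcoeff v)) F \<le> sqrt (infsum ?g (UNIV - {0}))" if F: "finite F" for F
  proof -
    have "sum ?g F = sum ?g (F - {0})"
      using F by (intro sum.mono_neutral_right) (auto simp: weighted_0)
    also have "\<dots> \<le> infsum ?g (UNIV - {0})" using F by (intro finite_sum_le_infsum[OF s]) auto
    finally show ?thesis by (simp add: L2_set_def)
  qed
  then show "\<exists>C. \<forall>F. finite F \<longrightarrow> L2_set (weighted n (fcoeff v)) F \<le> C" by blast
next
  assume "fcoeff v 0 = 0" "\<exists>C. \<forall>F. finite F \<longrightarrow> L2_set (weighted n (fcoeff v)) F \<le> C"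
  moreover from this obtain C where "\<And>F. finite F \<Longrightarrow> L2_set (weighted n (fcoeff v)) F \<le> C" by blast
  from sobolev_norm_L2(1)[OF this] have "(\<lambda>k. (weighted n (fcoeff v) k)\<^sup>2) summable_on (UNIV - {0})"
    by (rule summable_on_subset_banach) auto
  ultimately show "v \<in> sobolev0 n" by (simp add: sobolev0_def weighted_square)
qed

lemma L2_set_le_sobolev_norm:
  assumes v: "v \<in> sobolev0 n" and F: "finite F"
  shows "L2_set (weighted n (fcoeff v)) F \<le> sobolev_norm n v"
proof -
  let ?g = "\<lambda>k. (weighted n (fcoeff v) k)\<^sup>2"
  have s: "?g summable_on (UNIV - {0})" using v by (simp add: sobolev0_def weighted_square)
  have "sum ?g F = sum ?g (F - {0})"
    using F by (intro sum.mono_neutral_right) (auto simp: weighted_0)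
  also have "\<dots> \<le> infsum ?g (UNIV - {0})" using F by (intro finite_sum_le_infsum[OF s]) auto
  finally show ?thesis by (simp add: L2_set_def sobolev_norm_def weighted_square)
qed

lemma weighted_le_sobolev_norm:
  "v \<in> sobolev0 n \<Longrightarrow> weighted n (fcoeff v) k \<le> sobolev_norm n v"
  using L2_set_le_sobolev_norm[of v n "{k}"] by (simp add: weighted_nonneg)

lemma sobolev_norm_nonneg: "0 \<le> sobolev_norm n v"
  unfolding sobolev_norm_def by (intro real_sqrt_ge_zero infsum_nonneg) auto

lemma sobolev_norm_minus_commute: "sobolev_norm n (v - w) = sobolev_norm n (w - v)"
  by (simp add: sobolev_norm_def fcoeff_diff norm_minus_commute)

lemma sobolev_norm_0 [simp]: "sobolev_norm n 0 = 0"
  by (simp add: sobolev_norm_def fcoeff_0)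

lemma sobolev_norm_scaleR: "sobolev_norm n (c *\<^sub>R v) = \<bar>c\<bar> * sobolev_norm n v"
proof -
  have "(\<Sum>\<^sub>\<infinity>k\<in>UNIV - {0}. norm (kvec k) powr (2 * n) * (norm (fcoeff (c *\<^sub>R v) k))\<^sup>2)
    = (\<Sum>\<^sub>\<infinity>k\<in>UNIV - {0}. c\<^sup>2 * (norm (kvec k) powr (2 * n) * (norm (fcoeff v k))\<^sup>2))"
    by (rule infsum_cong) (simp add: fcoeff_scaleR power_mult_distrib mult_ac)
  then show ?thesis
    by (simp add: sobolev_norm_def infsum_cmult_right' real_sqrt_mult)
qed

lemma sobolev_norm_uminus: "sobolev_norm n (- v) = sobolev_norm n v"
  using sobolev_norm_scaleR[of n "-1" v] by simp

lemma sobolev_add: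
  assumes v: "v \<in> sobolev0 n" and w: "w \<in> sobolev0 n"
  shows "v + w \<in> sobolev0 n" and "sobolev_norm n (v + w) \<le> sobolev_norm n v + sobolev_norm n w"
proof -
  have le: "L2_set (weighted n (fcoeff (v + w))) F \<le> sobolev_norm n v + sobolev_norm n w" if F: "finite F" for F
  proof -
    have "L2_set (weighted n (fcoeff (v + w))) F \<le> L2_set (\<lambda>k. weighted n (fcoeff v) k + weighted n (fcoeff w) k) F"
    proof (rule L2_set_mono)
      show "weighted n (fcoeff (v + w)) k \<le> weighted n (fcoeff v) k + weighted n (fcoeff w) k" for k
        unfolding weighted_def fcoeff_add distrib_left[symmetric]
        by (intro mult_left_mono norm_triangle_ineq) auto
    qed (rule weighted_nonneg)
    also have "\<dots> \<le> L2_set (weighted n (fcoeff v)) F + L2_set (weighted n (fcoeff w)) F"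
      by (rule L2_set_triangle_ineq)
    also have "\<dots> \<le> sobolev_norm n v + sobolev_norm n w"
      by (intro add_mono L2_set_le_sobolev_norm v w F)
    finally show ?thesis .
  qed
  then show "v + w \<in> sobolev0 n" using v w by (auto simp: sobolev0_iff fcoeff_add)
  show "sobolev_norm n (v + w) \<le> sobolev_norm n v + sobolev_norm n w" using le by (rule sobolev_norm_L2)
qed

lemma sobolev_scaleR:
  assumes v: "v \<in> sobolev0 n" shows "c *\<^sub>R v \<in> sobolev0 n"
proof -
  have "L2_set (weighted n (fcoeff (c *\<^sub>R v))) F \<le> \<bar>c\<bar> * sobolev_norm n v" if F: "finite F" for F
  proof -
    have "weighted n (fcoeff (c *\<^sub>R v)) = (\<lambda>k. \<bar>c\<bar> * weighted n (fcoeff v) k)"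
      by (auto simp: weighted_def fcoeff_scaleR)
    then have "L2_set (weighted n (fcoeff (c *\<^sub>R v))) F = \<bar>c\<bar> * L2_set (weighted n (fcoeff v)) F"
      by (simp add: L2_set_right_distrib)
    then show ?thesis using L2_set_le_sobolev_norm[OF v F] by (simp add: mult_left_mono)
  qed
  then show ?thesis using v by (auto simp: sobolev0_iff fcoeff_scaleR)
qed

lemma sobolev_div0_iff:
  "v \<in> sobolev_div0 n \<longleftrightarrow> v \<in> sobolev0 n \<and> (\<forall>k. cdot (kvecC k) (fcoeff v k) = 0)"
  by (simp add: sobolev_div0_def)

lemma sobolev_div0D: "v \<in> sobolev_div0 n \<Longrightarrow> v \<in> sobolev0 n"
  by (simp add: sobolev_div0_def)

lemma subspace_sobolev_div0: "subspace (sobolev_div0 n :: ('d::finite vfield) set)"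
  unfolding subspace_def
proof (intro conjI ballI allI)
  have "L2_set (weighted n (fcoeff (0 :: 'd vfield))) F \<le> 0" for F
    by (simp add: weighted_def[abs_def] fcoeff_0 L2_set_def)
  then show "0 \<in> (sobolev_div0 n :: 'd vfield set)"
    unfolding sobolev_div0_iff sobolev0_iff by (simp add: fcoeff_0 cdot_0_right) blast
qed (auto simp: sobolev_div0_iff sobolev_add sobolev_scaleR fcoeff_add fcoeff_scaleR cdot_add cdot_scaleR)

lemma sobolev_div0_diff: "v \<in> sobolev_div0 n \<Longrightarrow> w \<in> sobolev_div0 n \<Longrightarrow> v - w \<in> sobolev_div0 n"
  by (rule subspace_diff[OF subspace_sobolev_div0])

lemma sobolev_norm_eq_0:
  assumes v: "v \<in> sobolev0 n" and 0: "sobolev_norm n v = 0"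
  shows "v = 0"
proof (rule vfield_eqI)
  fix k
  have "weighted n (fcoeff v) k = 0"
    using weighted_le_sobolev_norm[OF v, of k] weighted_nonneg[of n "fcoeff v" k] 0 by linarith
  then show "fcoeff v k = fcoeff 0 k"
    using v by (cases "k = 0") (auto simp: weighted_def fcoeff_0 sobolev0_iff)
qed

lemma normed_space_sobolev: "normed_space_on (sobolev_div0 n) (sobolev_norm n)"
  unfolding normed_space_on_def
proof (intro conjI ballI allI)
  show "sobolev_norm n v = 0 \<longleftrightarrow> v = 0" if "v \<in> sobolev_div0 n" for v :: "'a vfield"
    using sobolev_norm_eq_0[OF sobolev_div0D[OF that]] by auto
qed (auto simp: subspace_sobolev_div0 sobolev_norm_nonneg sobolev_norm_scaleR sobolev_add sobolev_div0_iff)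

lemma Metric_space_sobolev: "Metric_space (sobolev_div0 n) (\<lambda>v w. sobolev_norm n (v - w))"
proof
  fix u v w :: "'a vfield"
  show "0 \<le> sobolev_norm n (v - w)" by (rule sobolev_norm_nonneg)
  show "sobolev_norm n (v - w) = sobolev_norm n (w - v)" by (rule sobolev_norm_minus_commute)
  show "sobolev_norm n (v - w) = 0 \<longleftrightarrow> v = w" if "v \<in> sobolev_div0 n" "w \<in> sobolev_div0 n"
    using sobolev_norm_eq_0[OF sobolev_div0D[OF sobolev_div0_diff[OF that]]] by auto
  show "sobolev_norm n (u - w) \<le> sobolev_norm n (u - v) + sobolev_norm n (v - w)"
    if "u \<in> sobolev_div0 n" "v \<in> sobolev_div0 n" "w \<in> sobolev_div0 n"
    using sobolev_add(2)[OF sobolev_div0D[OF sobolev_div0_diff[OF that(1,2)]] sobolev_div0D[OF sobolev_div0_diff[OF that(2,3)]]]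
    by simp
qed

text \<open>
  This makes weighted families eligible as coefficients of distributions.
\<close>

lemma weighted_le_imp_poly_growth:
  fixes c :: "int^'d::finite \<Rightarrow> complex^'d"
  assumes "\<And>k. k \<noteq> 0 \<Longrightarrow> weighted n c k \<le> C"
  shows "\<exists>C m. \<forall>k. norm (c k) \<le> C * (1 + norm (kvec k)) ^ m"
proof -
  define m where "m = nat \<lceil>\<bar>n\<bar>\<rceil>"
  have "norm (c k) \<le> (\<bar>C\<bar> + norm (c 0)) * (1 + norm (kvec k)) ^ m" for k
  proof (cases "k = 0")
    case False
    define R where "R = norm (kvec k)"
    have R: "R \<ge> 1" unfolding R_def by (rule norm_kvec_ge_1[OF False])
    have "norm (c k) = R powr (- n) * weighted n c k"
      using R by (simp add: weighted_def R_def[symmetric] mult.assoc[symmetric] powr_add[symmetric])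
    also have "\<dots> \<le> R powr (- n) * \<bar>C\<bar>"
      using assms[OF False] by (intro mult_left_mono) auto
    also have "\<dots> \<le> (1 + R) ^ m * (\<bar>C\<bar> + norm (c 0))"
    proof (rule mult_mono)
      have "R powr (- n) \<le> R powr real m" using R by (intro powr_mono) (auto simp: m_def, linarith)
      also have "\<dots> = R ^ m" using R by (simp add: powr_realpow)
      also have "\<dots> \<le> (1 + R) ^ m" using R by (intro power_mono) auto
      finally show "R powr (- n) \<le> (1 + R) ^ m" .
    qed (use R in auto)
    finally show ?thesis by (simp add: R_def mult.commute)
  qed simp
  then show ?thesis by blast
qed

text \<open>The passage from sequences back to fields; limits of Cauchy sequences and images under Fourier
  multipliers are both obtained this way.\<close>

lemma sobolev_of_coeffs:
  fixes c :: "int^'d::finite \<Rightarrow> complex^'d"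
  assumes herm: "\<And>k r. c (- k) $ r = cnj (c k $ r)" and "c 0 = 0" "\<And>k. cdot (kvecC k) (c k) = 0"
    and L2: "\<And>F. finite F \<Longrightarrow> L2_set (weighted n c) F \<le> C"
  shows "fcoeff (fseries c) k = c k" and "fseries c \<in> sobolev_div0 n" and "sobolev_norm n (fseries c) \<le> C"
proof -
  have "weighted n c k \<le> C" for k using L2[of "{k}"] by (simp add: weighted_nonneg)
  then have "admissible c"
    unfolding admissible_def using weighted_le_imp_poly_growth[of n c C] herm by blast
  then have c: "fcoeff (fseries c) = c" by (intro ext fcoeff_fseries)
  then show "fcoeff (fseries c) k = c k" by simp
  have "\<And>F. finite F \<Longrightarrow> L2_set (weighted n (fcoeff (fseries c))) F \<le> C" using L2 c by simp
  then show "sobolev_norm n (fseries c) \<le> C" by (rule sobolev_norm_L2(2))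
  show "fseries c \<in> sobolev_div0 n"
    using assms by (auto simp: sobolev_div0_iff sobolev0_iff c)
qed

lemma fcoeff_uminus_index: "fcoeff v (- k) $ r = cnj (fcoeff v k $ r)"
  by (simp add: fcoeff_nth dcoeff_uminus_index)

text \<open>
  The coefficients of a Cauchy sequence converge one by one, and the uniform bounds on finite
  \<open>\<ell>\<^sup>2\<close> sums survive the limit.
\<close>

theorem banach_space_sobolev: "banach_space_on (sobolev_div0 n :: ('d::finite vfield) set) (sobolev_norm n)"
  unfolding banach_space_on_def
proof (intro conjI normed_space_sobolev)
  interpret Metric_space "sobolev_div0 n" "\<lambda>v w :: 'd vfield. sobolev_norm n (v - w)"
    by (rule Metric_space_sobolev)
  show "mcomplete"
    unfolding mcomplete_def
  proof (intro allI impI)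
    fix \<sigma> :: "nat \<Rightarrow> 'd vfield" assume "MCauchy \<sigma>"
    then have \<sigma>: "\<And>i. \<sigma> i \<in> sobolev_div0 n"
      and cauchy: "\<And>e. e > 0 \<Longrightarrow> \<exists>N. \<forall>i\<ge>N. \<forall>j\<ge>N. sobolev_norm n (\<sigma> i - \<sigma> j) < e"
      unfolding MCauchy_def by (auto simp: image_subset_iff)
    have diff: "\<sigma> i - \<sigma> j \<in> sobolev0 n" for i j by (intro sobolev_div0D sobolev_div0_diff \<sigma>)
    have "Cauchy (\<lambda>i. fcoeff (\<sigma> i) k)" for k
    proof (cases "k = 0")
      case True
      then have "fcoeff (\<sigma> i) k = 0" for i using \<sigma>[of i] by (simp add: sobolev_div0_iff sobolev0_iff)
      then show ?thesis by (simp add: Cauchy_def)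
    next
      case False
      let ?w = "norm (kvec k) powr n"
      have w: "?w > 0" using False by simp
      show ?thesis
        unfolding Cauchy_def
      proof (intro allI impI)
        fix e :: real assume "e > 0"
        then have "e * ?w > 0" using w by simp
        from cauchy[OF this] obtain N where N: "\<And>i j. i \<ge> N \<Longrightarrow> j \<ge> N \<Longrightarrow> sobolev_norm n (\<sigma> i - \<sigma> j) < e * ?w" by blast
        have "dist (fcoeff (\<sigma> i) k) (fcoeff (\<sigma> j) k) < e" if "i \<ge> N" "j \<ge> N" for i j
        proof -
          have "?w * norm (fcoeff (\<sigma> i) k - fcoeff (\<sigma> j) k) < ?w * e"
            using weighted_le_sobolev_norm[OF diff, of i j k] N[OF that]
            by (simp add: weighted_def fcoeff_diff mult.commute)
          then show ?thesis using w by (simp add: dist_norm)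
        qed
        then show "\<exists>M. \<forall>i\<ge>M. \<forall>j\<ge>M. dist (fcoeff (\<sigma> i) k) (fcoeff (\<sigma> j) k) < e" by blast
      qed
    qed
    then have "\<exists>l. (\<lambda>i. fcoeff (\<sigma> i) k) \<longlonglongrightarrow> l" for k
      by (simp add: Cauchy_convergent_iff convergent_def)
    then obtain c where c: "\<And>k. (\<lambda>i. fcoeff (\<sigma> i) k) \<longlonglongrightarrow> c k" by metis
    have herm: "c (- k) $ r = cnj (c k $ r)" for k r
    proof (rule LIMSEQ_unique)
      show "(\<lambda>i. fcoeff (\<sigma> i) (- k) $ r) \<longlonglongrightarrow> c (- k) $ r" by (intro tendsto_vec_nth c)
      show "(\<lambda>i. fcoeff (\<sigma> i) (- k) $ r) \<longlonglongrightarrow> cnj (c k $ r)"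
        unfolding fcoeff_uminus_index by (intro tendsto_cnj tendsto_vec_nth c)
    qed
    have c0: "c 0 = 0"
      using c[of 0] \<sigma> by (simp add: sobolev_div0_iff sobolev0_iff LIMSEQ_const_iff)
    have div: "cdot (kvecC k) (c k) = 0" for k
      using tendsto_cdot[OF c, of "kvecC k" k] \<sigma> by (simp add: sobolev_div0_iff LIMSEQ_const_iff)
    have tail: "L2_set (weighted n (\<lambda>k. fcoeff (\<sigma> i) k - c k)) F \<le> e"
      if N: "\<And>i j. i \<ge> N \<Longrightarrow> j \<ge> N \<Longrightarrow> sobolev_norm n (\<sigma> i - \<sigma> j) < e" and i: "i \<ge> N" and F: "finite F" for N i e F
    proof (rule tendsto_upperbound)
      show "(\<lambda>j. L2_set (weighted n (\<lambda>k. fcoeff (\<sigma> i) k - fcoeff (\<sigma> j) k)) F)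
        \<longlonglongrightarrow> L2_set (weighted n (\<lambda>k. fcoeff (\<sigma> i) k - c k)) F"
        unfolding L2_set_def weighted_def by (intro tendsto_intros c)
      show "\<forall>\<^sub>F j in sequentially. L2_set (weighted n (\<lambda>k. fcoeff (\<sigma> i) k - fcoeff (\<sigma> j) k)) F \<le> e"
      proof (rule eventually_sequentiallyI[of N])
        fix j assume "N \<le> j"
        then show "L2_set (weighted n (\<lambda>k. fcoeff (\<sigma> i) k - fcoeff (\<sigma> j) k)) F \<le> e"
          using L2_set_le_sobolev_norm[OF diff F, of i j] N[OF i, of j] by (simp add: fcoeff_diff[abs_def])
      qed
    qed simp
    obtain N1 where N1: "\<And>i j. i \<ge> N1 \<Longrightarrow> j \<ge> N1 \<Longrightarrow> sobolev_norm n (\<sigma> i - \<sigma> j) < 1"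
      using cauchy[of 1] by auto
    have bnd: "L2_set (weighted n c) F \<le> sobolev_norm n (\<sigma> N1) + 1" if F: "finite F" for F
    proof -
      have "L2_set (weighted n c) F \<le> L2_set (\<lambda>k. weighted n (fcoeff (\<sigma> N1)) k + weighted n (\<lambda>k. fcoeff (\<sigma> N1) k - c k) k) F"
      proof (rule L2_set_mono)
        show "weighted n c k \<le> weighted n (fcoeff (\<sigma> N1)) k + weighted n (\<lambda>k. fcoeff (\<sigma> N1) k - c k) k" for k
          unfolding weighted_def distrib_left[symmetric]
          using norm_triangle_ineq4[of "fcoeff (\<sigma> N1) k" "fcoeff (\<sigma> N1) k - c k"] by (intro mult_left_mono) auto
      qed (rule weighted_nonneg)
      also have "\<dots> \<le> L2_set (weighted n (fcoeff (\<sigma> N1))) F + L2_set (weighted n (\<lambda>k. fcoeff (\<sigma> N1) k - c k)) F"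
        by (rule L2_set_triangle_ineq)
      also have "\<dots> \<le> sobolev_norm n (\<sigma> N1) + 1"
        by (intro add_mono L2_set_le_sobolev_norm sobolev_div0D \<sigma> F tail[of N1]) (use N1 in auto)
      finally show ?thesis .
    qed
    note v = sobolev_of_coeffs[of c n, OF herm c0 div bnd]
    show "\<exists>v. limitin mtopology \<sigma> v sequentially"
    proof (rule exI[of _ "fseries c"], unfold limit_metric_sequentially, intro conjI allI impI)
      show "fseries c \<in> sobolev_div0 n" by (rule v(2))
      fix e :: real assume e: "e > 0"
      then obtain N where N: "\<And>i j. i \<ge> N \<Longrightarrow> j \<ge> N \<Longrightarrow> sobolev_norm n (\<sigma> i - \<sigma> j) < e / 2"
        using cauchy[of "e / 2"] by auto
      have "sobolev_norm n (\<sigma> i - fseries c) < e" if i: "i \<ge> N" for i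
      proof -
        have "fcoeff (\<sigma> i - fseries c) = (\<lambda>k. fcoeff (\<sigma> i) k - c k)"
          by (auto simp: fcoeff_diff v(1))
        then have "\<And>F. finite F \<Longrightarrow> L2_set (weighted n (fcoeff (\<sigma> i - fseries c))) F \<le> e / 2"
          using tail[of N "e / 2" i] N i by simp
        then have "sobolev_norm n (\<sigma> i - fseries c) \<le> e / 2" by (rule sobolev_norm_L2(2))
        then show ?thesis using e by simp
      qed
      then show "\<exists>N. \<forall>i\<ge>N. \<sigma> i \<in> sobolev_div0 n \<and> sobolev_norm n (\<sigma> i - fseries c) < e"
        using \<sigma> by blast
    qed
  qed
qed

section \<open>Fourier multipliers\<close>

definition fmult :: "(int^'d::finite \<Rightarrow> real) \<Rightarrow> 'd vfield \<Rightarrow> 'd vfield" where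
  "fmult m v = fseries (\<lambda>k. m k *\<^sub>R fcoeff v k)"

text \<open>
  Under this condition \<open>fmult m\<close> maps the space of order \<open>n1\<close> to that of order \<open>n2\<close> with norm at most
  \<open>C\<close>; evenness of the symbol keeps the fields real.
\<close>

definition multiplier_bound :: "real \<Rightarrow> real \<Rightarrow> real \<Rightarrow> (int^'d::finite \<Rightarrow> real) \<Rightarrow> bool" where
  "multiplier_bound n1 n2 C m \<longleftrightarrow> 0 \<le> C \<and> (\<forall>k. m (- k) = m k) \<and>
     (\<forall>k. k \<noteq> 0 \<longrightarrow> \<bar>m k\<bar> * norm (kvec k) powr n2 \<le> C * norm (kvec k) powr n1)"

lemma weighted_multiplier_le:
  assumes m: "multiplier_bound n1 n2 C m"
  shows "weighted n2 (\<lambda>k. m k *\<^sub>R c k) k \<le> C * weighted n1 c k"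
proof (cases "k = 0")
  case False
  have "\<bar>m k\<bar> * norm (kvec k) powr n2 * norm (c k) \<le> C * norm (kvec k) powr n1 * norm (c k)"
    using m False by (intro mult_right_mono) (auto simp: multiplier_bound_def)
  then show ?thesis by (simp add: weighted_def mult_ac)
qed (simp add: weighted_0)

lemma fmult:
  fixes v :: "'d::finite vfield"
  assumes m: "multiplier_bound n1 n2 C m" and v: "v \<in> sobolev_div0 n1"
  shows "fcoeff (fmult m v) k = m k *\<^sub>R fcoeff v k" and "fmult m v \<in> sobolev_div0 n2"
    and "sobolev_norm n2 (fmult m v) \<le> C * sobolev_norm n1 v"
proof -
  have C: "C \<ge> 0" using m by (simp add: multiplier_bound_def)
  have L2: "L2_set (weighted n2 (\<lambda>k. m k *\<^sub>R fcoeff v k)) F \<le> C * sobolev_norm n1 v" if F: "finite F" for F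
  proof -
    have "L2_set (weighted n2 (\<lambda>k. m k *\<^sub>R fcoeff v k)) F \<le> L2_set (\<lambda>k. C * weighted n1 (fcoeff v) k) F"
      by (intro L2_set_mono weighted_multiplier_le m weighted_nonneg)
    also have "\<dots> = C * L2_set (weighted n1 (fcoeff v)) F"
      using C by (simp add: L2_set_right_distrib)
    also have "\<dots> \<le> C * sobolev_norm n1 v"
      by (intro mult_left_mono L2_set_le_sobolev_norm sobolev_div0D v F C)
    finally show ?thesis .
  qed
  have herm: "(m (- k) *\<^sub>R fcoeff v (- k)) $ r = cnj ((m k *\<^sub>R fcoeff v k) $ r)" for k r
    using m by (simp add: fcoeff_uminus_index multiplier_bound_def)
  have z: "m 0 *\<^sub>R fcoeff v 0 = 0" and d: "cdot (kvecC k) (m k *\<^sub>R fcoeff v k) = 0" for k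
    using v by (auto simp: sobolev_div0_iff sobolev0_iff cdot_scaleR)
  note r = sobolev_of_coeffs[of "\<lambda>k. m k *\<^sub>R fcoeff v k", OF herm z d L2]
  show "fcoeff (fmult m v) k = m k *\<^sub>R fcoeff v k" unfolding fmult_def by (rule r(1))
  show "fmult m v \<in> sobolev_div0 n2" unfolding fmult_def by (rule r(2))
  show "sobolev_norm n2 (fmult m v) \<le> C * sobolev_norm n1 v" unfolding fmult_def by (rule r(3))
qed

text \<open>Dominated convergence for multipliers: all but finitely many coefficients are uniformly negligible.\<close>

lemma fmult_tendsto_0:
  fixes v :: "'d::finite vfield"
  assumes v: "v \<in> sobolev_div0 n1" and m: "\<forall>\<^sub>F i in Fl. multiplier_bound n1 n2 C (m i)"
    and lim: "\<And>k. ((\<lambda>i. m i k) \<longlongrightarrow> 0) Fl"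
  shows "((\<lambda>i. sobolev_norm n2 (fmult (m i) v)) \<longlongrightarrow> 0) Fl"
proof (cases "C \<ge> 0")
  case True
  let ?g = "\<lambda>k. (weighted n1 (fcoeff v) k)\<^sup>2"
  show ?thesis
  proof (rule tendstoI)
    fix e :: real assume e: "e > 0"
    define q where "q = (e / 2)\<^sup>2 / 2"
    have q: "q > 0" using e by (simp add: q_def)
    have s: "?g summable_on UNIV"
      by (rule sobolev_norm_L2(1)[OF L2_set_le_sobolev_norm[OF sobolev_div0D[OF v]]])
    have "q / (C\<^sup>2 + 1) > 0" using q by (simp add: add_nonneg_pos)
    then obtain F where F: "finite F" and Fs: "infsum ?g UNIV - sum ?g F < q / (C\<^sup>2 + 1)"
    proof -
      assume "q / (C\<^sup>2 + 1) > 0"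
      then have "infsum ?g UNIV - q / (C\<^sup>2 + 1) < infsum ?g UNIV" by simp
      then have ev: "\<forall>\<^sub>F F in finite_subsets_at_top UNIV. sum ?g F > infsum ?g UNIV - q / (C\<^sup>2 + 1)"
        using has_sum_infsum[OF s] unfolding has_sum_def by (rule order_tendstoD(1)[rotated])
      have "\<forall>\<^sub>F F in finite_subsets_at_top UNIV. finite F \<and> sum ?g F > infsum ?g UNIV - q / (C\<^sup>2 + 1)"
      proof (rule eventually_conj[OF _ ev])
        show "\<forall>\<^sub>F F in finite_subsets_at_top UNIV. finite (F :: (int^'d) set)"
          by (rule eventually_finite_subsets_at_top_weakI)
      qed
      then obtain F where "finite F" "sum ?g F > infsum ?g UNIV - q / (C\<^sup>2 + 1)"
        using eventually_happens' finite_subsets_at_top_neq_bot by blast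
      then show ?thesis using that[of F] by simp
    qed
    have tail: "sum ?g G \<le> q / (C\<^sup>2 + 1)" if "finite G" "G \<inter> F = {}" for G
    proof -
      have "sum ?g G + sum ?g F = sum ?g (G \<union> F)" using that F by (simp add: sum.union_disjoint)
      also have "\<dots> \<le> infsum ?g UNIV" using that F by (intro finite_sum_le_infsum[OF s]) auto
      finally show ?thesis using Fs by simp
    qed
    let ?h = "\<lambda>i k. (weighted n2 (\<lambda>k. m i k *\<^sub>R fcoeff v k) k)\<^sup>2"
    have "((\<lambda>i. \<Sum>k\<in>F. ?h i k) \<longlongrightarrow> (\<Sum>k\<in>F. 0)) Fl"
    proof (rule tendsto_sum)
      fix k
      have "((\<lambda>i. (norm (kvec k) powr n2 * (\<bar>m i k\<bar> * norm (fcoeff v k)))\<^sup>2) \<longlongrightarrow> (norm (kvec k) powr n2 * (\<bar>0\<bar> * norm (fcoeff v k)))\<^sup>2) Fl"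
        by (intro tendsto_intros lim)
      then show "((\<lambda>i. ?h i k) \<longlongrightarrow> 0) Fl" by (simp add: weighted_def)
    qed
    then have "\<forall>\<^sub>F i in Fl. (\<Sum>k\<in>F. ?h i k) < q" using order_tendstoD(2)[of _ 0 Fl q] q by simp
    with m show "\<forall>\<^sub>F i in Fl. dist (sobolev_norm n2 (fmult (m i) v)) 0 < e"
    proof eventually_elim
      case (elim i)
      have le: "?h i k \<le> C\<^sup>2 * ?g k" for k
        using power_mono[OF weighted_multiplier_le[OF elim(1), of "fcoeff v" k] weighted_nonneg, of 2]
        by (simp add: power_mult_distrib)
      have "L2_set (weighted n2 (fcoeff (fmult (m i) v))) G \<le> e / 2" if G: "finite G" for G
      proof -
        have "(\<Sum>k\<in>G. ?h i k) = (\<Sum>k\<in>G \<inter> F. ?h i k) + (\<Sum>k\<in>G - F. ?h i k)"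
          using sum.Int_Diff[OF G] by blast
        also have "\<dots> \<le> (\<Sum>k\<in>F. ?h i k) + (\<Sum>k\<in>G - F. C\<^sup>2 * ?g k)"
          using F by (intro add_mono sum_mono2 sum_mono le) auto
        also have "\<dots> \<le> q + C\<^sup>2 * (q / (C\<^sup>2 + 1))"
          unfolding sum_distrib_left[symmetric] using G elim(2)
          by (intro add_mono mult_left_mono tail) auto
        also have "\<dots> \<le> q + q"
        proof -
          have pos: "C\<^sup>2 + 1 > 0" by (simp add: add_nonneg_pos)
          have "C\<^sup>2 * (q / (C\<^sup>2 + 1)) \<le> (C\<^sup>2 + 1) * (q / (C\<^sup>2 + 1))"
            using pos q by (intro mult_right_mono divide_nonneg_pos) auto
          also have "\<dots> = q" using pos by simp
          finally show ?thesis by simp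
        qed
        also have "\<dots> = (e / 2)\<^sup>2" by (simp add: q_def)
        finally have "sqrt (\<Sum>k\<in>G. ?h i k) \<le> e / 2"
          using e by (intro real_le_lsqrt) auto
        moreover have "fcoeff (fmult (m i) v) = (\<lambda>k. m i k *\<^sub>R fcoeff v k)"
          using fmult(1)[OF elim(1) v] by blast
        ultimately show ?thesis by (simp add: L2_set_def)
      qed
      then have "sobolev_norm n2 (fmult (m i) v) \<le> e / 2" by (rule sobolev_norm_L2(2))
      then show ?case using e sobolev_norm_nonneg[of n2 "fmult (m i) v"] by simp
    qed
  qed
next
  case False
  from m have "\<forall>\<^sub>F i in Fl. False"
    by (rule eventually_mono) (use False in \<open>auto simp: multiplier_bound_def\<close>)
  then have "Fl = bot" by (simp add: trivial_limit_def)
  then show ?thesis by simp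
qed

section \<open>Topology of normed spaces of vector fields\<close>

lemma topspace_sobolev: "topspace (norm_topology (sobolev_div0 n) (sobolev_norm n)) = sobolev_div0 n"
  unfolding norm_topology_def by (rule Metric_space.topspace_mtopology[OF Metric_space_sobolev])

text \<open>
  The second factor will be a time interval for the semigroup and a Sobolev space for the quadratic
  term; \<open>d\<close> only has to describe neighbourhoods in it.
\<close>

lemma continuous_map_to_sobolev_prod:
  fixes f :: "'d::finite vfield \<Rightarrow> 'b \<Rightarrow> 'd vfield" and Y :: "'b topology" and d :: "'b \<Rightarrow> 'b \<Rightarrow> real"
  assumes Y: "\<And>s \<delta>. s \<in> topspace Y \<Longrightarrow> \<delta> > 0 \<Longrightarrow> openin Y {s' \<in> topspace Y. d s' s < \<delta>}"
    and d: "\<And>s. s \<in> topspace Y \<Longrightarrow> d s s = 0"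
    and f: "\<And>v s. v \<in> sobolev_div0 n1 \<Longrightarrow> s \<in> topspace Y \<Longrightarrow> f v s \<in> sobolev_div0 n2"
    and cont: "\<And>v s e. v \<in> sobolev_div0 n1 \<Longrightarrow> s \<in> topspace Y \<Longrightarrow> e > 0 \<Longrightarrow> \<exists>\<delta>>0. \<forall>v'\<in>sobolev_div0 n1. \<forall>s'\<in>topspace Y.
      sobolev_norm n1 (v' - v) < \<delta> \<longrightarrow> d s' s < \<delta> \<longrightarrow> sobolev_norm n2 (f v' s' - f v s) < e"
  shows "continuous_map (prod_topology (norm_topology (sobolev_div0 n1) (sobolev_norm n1)) Y)
    (norm_topology (sobolev_div0 n2) (sobolev_norm n2)) (\<lambda>(v, s). f v s)"
proof -
  interpret A: Metric_space "sobolev_div0 n1" "\<lambda>v w :: 'd vfield. sobolev_norm n1 (v - w)"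
    by (rule Metric_space_sobolev)
  interpret B: Metric_space "sobolev_div0 n2" "\<lambda>v w :: 'd vfield. sobolev_norm n2 (v - w)"
    by (rule Metric_space_sobolev)
  show ?thesis
    unfolding norm_topology_def B.continuous_map_to_metric
  proof (intro ballI allI impI)
    fix x and e :: real
    assume "x \<in> topspace (prod_topology A.mtopology Y)" and e: "e > 0"
    then obtain v s where x: "x = (v, s)" and v: "v \<in> sobolev_div0 n1" and s: "s \<in> topspace Y" by auto
    obtain \<delta> where \<delta>: "\<delta> > 0" and near: "\<And>v' s'. v' \<in> sobolev_div0 n1 \<Longrightarrow> s' \<in> topspace Y \<Longrightarrow>
        sobolev_norm n1 (v' - v) < \<delta> \<Longrightarrow> d s' s < \<delta> \<Longrightarrow> sobolev_norm n2 (f v' s' - f v s) < e"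
      using cont[OF v s e] by blast
    let ?U = "A.mball v \<delta> \<times> {s' \<in> topspace Y. d s' s < \<delta>}"
    have "openin (prod_topology A.mtopology Y) ?U"
      unfolding openin_prod_Times_iff using Y[OF s \<delta>] by simp
    moreover have "x \<in> ?U" using x v s \<delta> d[OF s] by simp
    moreover have "(case y of (v, s) \<Rightarrow> f v s) \<in> B.mball (case x of (v, s) \<Rightarrow> f v s) e" if "y \<in> ?U" for y
      using that near f v s by (auto simp: x sobolev_norm_minus_commute[of n2 "f v s"] sobolev_norm_minus_commute[of n1 v])
    ultimately show "\<exists>U. openin (prod_topology A.mtopology Y) U \<and> x \<in> U \<and>
        (\<forall>y\<in>U. (case y of (v, s) \<Rightarrow> f v s) \<in> B.mball (case x of (v, s) \<Rightarrow> f v s) e)"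
      by blast
  qed
qed

lemma limitin_sobolev:
  "limitin (norm_topology (sobolev_div0 n) (sobolev_norm n)) f l Fl \<longleftrightarrow>
     l \<in> sobolev_div0 n \<and> (\<forall>e>0. \<forall>\<^sub>F x in Fl. f x \<in> sobolev_div0 n \<and> sobolev_norm n (f x - l) < e)"
  unfolding norm_topology_def by (rule Metric_space.limitin_metric[OF Metric_space_sobolev])

lemma closure_of_sobolev:
  "norm_topology (sobolev_div0 n) (sobolev_norm n) closure_of S
     = {v \<in> sobolev_div0 n. \<forall>e>0. \<exists>w\<in>S. w \<in> sobolev_div0 n \<and> sobolev_norm n (v - w) < e}"
proof -
  interpret Metric_space "sobolev_div0 n" "\<lambda>v w :: 'a vfield. sobolev_norm n (v - w)"
    by (rule Metric_space_sobolev)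
  show ?thesis unfolding norm_topology_def metric_closure_of by auto
qed

lemma continuous_map_inclusion_sobolev:
  assumes "\<And>v :: 'd::finite vfield. v \<in> sobolev_div0 n1 \<Longrightarrow> v \<in> sobolev_div0 n2 \<and> sobolev_norm n2 v \<le> sobolev_norm n1 v"
  shows "continuous_map (norm_topology (sobolev_div0 n1) (sobolev_norm n1))
    (norm_topology (sobolev_div0 n2 :: 'd vfield set) (sobolev_norm n2)) (\<lambda>v. v)"
proof -
  interpret A: Metric_space "sobolev_div0 n1" "\<lambda>v w :: 'd vfield. sobolev_norm n1 (v - w)"
    by (rule Metric_space_sobolev)
  interpret B: Metric_space "sobolev_div0 n2" "\<lambda>v w :: 'd vfield. sobolev_norm n2 (v - w)"
    by (rule Metric_space_sobolev)
  show ?thesis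
    unfolding norm_topology_def B.continuous_map_to_metric
  proof (intro ballI allI impI)
    fix x and e :: real
    assume "x \<in> topspace A.mtopology" and e: "e > 0"
    then have x: "x \<in> sobolev_div0 n1" by simp
    have "y \<in> B.mball x e" if y: "y \<in> A.mball x e" for y
    proof -
      have y1: "y \<in> sobolev_div0 n1" and lt: "sobolev_norm n1 (x - y) < e" using y by auto
      have "sobolev_norm n2 (x - y) \<le> sobolev_norm n1 (x - y)"
        using assms[OF sobolev_div0_diff[OF x y1]] by blast
      then show ?thesis using lt assms[OF x] assms[OF y1] by simp
    qed
    then show "\<exists>U. openin A.mtopology U \<and> x \<in> U \<and> (\<forall>y\<in>U. y \<in> B.mball x e)"
      using x e by (intro exI[of _ "A.mball x e"]) auto
  qed
qed

section \<open>The heat semigroup\<close>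

definition heat_symbol :: "real \<Rightarrow> int^'d::finite \<Rightarrow> real" where
  "heat_symbol t k = exp (- t * (norm (kvec k))\<^sup>2)"

definition heat :: "real \<Rightarrow> 'd::finite vfield \<Rightarrow> 'd vfield" where
  "heat t v = fmult (heat_symbol t) v"

lemma norm_kvec_sq_ge_1: "k \<noteq> 0 \<Longrightarrow> 1 \<le> (norm (kvec k))\<^sup>2"
  by (rule one_le_power[OF norm_kvec_ge_1])

text \<open>
  The exponential decay comes from \<open>|k| \<ge> 1\<close> for the nonzero frequencies.
\<close>

lemma heat_symbol_bound: "0 \<le> t \<Longrightarrow> multiplier_bound n n (exp (- t)) (heat_symbol t)"
  using norm_kvec_sq_ge_1
  by (auto simp: multiplier_bound_def heat_symbol_def mult_le_cancel_left1 intro!: mult_right_mono)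

lemma heat_symbol_bound_1: "0 \<le> t \<Longrightarrow> multiplier_bound n n 1 (heat_symbol t)"
  by (auto simp: multiplier_bound_def heat_symbol_def intro!: mult_left_le_one_le)

lemma laplacian_eq_fmult: "laplacian v = fmult (\<lambda>k. - ((norm (kvec k))\<^sup>2)) v"
  by (simp add: laplacian_def fmult_def)

lemma laplacian_bound: "multiplier_bound (n + 2) n 1 (\<lambda>k::int^'d::finite. - ((norm (kvec k))\<^sup>2))"
proof -
  have "(norm (kvec k))\<^sup>2 * norm (kvec k) powr n = norm (kvec k) powr (n + 2)" if "k \<noteq> 0" for k :: "int^'d"
    using that by (simp add: powr_add)
  then show ?thesis by (simp add: multiplier_bound_def)
qed

lemmas laplacian_sobolev = fmult[OF laplacian_bound, folded laplacian_eq_fmult]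

lemmas heat_sobolev = fmult[OF heat_symbol_bound_1, folded heat_def]

text \<open>
  The inclusions between the spaces are the multiplier \<open>1\<close>, again because \<open>|k| \<ge> 1\<close>.
\<close>

lemma inclusion_bound: "n2 \<le> n1 \<Longrightarrow> multiplier_bound n1 n2 1 (\<lambda>k. 1)"
  using norm_kvec_ge_1 by (auto simp: multiplier_bound_def intro!: powr_mono)

lemma fmult_one: "v \<in> sobolev_div0 n \<Longrightarrow> fmult (\<lambda>k. 1) v = v"
  by (rule vfield_eqI) (simp add: fmult(1)[OF inclusion_bound[OF order_refl]])

lemma sobolev_inclusion:
  assumes "n2 \<le> n1" "v \<in> sobolev_div0 n1"
  shows "v \<in> sobolev_div0 n2" and "sobolev_norm n2 v \<le> sobolev_norm n1 v"
  using fmult(2,3)[OF inclusion_bound[OF assms(1)] assms(2)] fmult_one[OF assms(2)] by simp_all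

lemma heat_0: "v \<in> sobolev_div0 n \<Longrightarrow> heat 0 v = v"
  by (rule vfield_eqI) (simp add: heat_sobolev(1) heat_symbol_def)

lemma heat_add_time:
  assumes "0 \<le> s" "0 \<le> t" "v \<in> sobolev_div0 n"
  shows "heat (s + t) v = heat s (heat t v)"
proof (rule vfield_eqI)
  fix k
  have "fcoeff (heat s (heat t v)) k = heat_symbol s k *\<^sub>R heat_symbol t k *\<^sub>R fcoeff v k"
    using assms by (simp add: heat_sobolev(1)[OF _ heat_sobolev(2)] heat_sobolev(1))
  moreover have "heat_symbol (s + t) k = heat_symbol s k * heat_symbol t k"
    by (simp add: heat_symbol_def exp_add[symmetric] algebra_simps)
  ultimately show "fcoeff (heat (s + t) v) k = fcoeff (heat s (heat t v)) k"
    using assms by (simp add: heat_sobolev(1))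
qed

lemma fmult_linear_map:
  fixes m :: "int^'d::finite \<Rightarrow> real"
  assumes m: "multiplier_bound n1 n2 C m"
  shows "linear_map_on (sobolev_div0 n1) (sobolev_div0 n2) (fmult m)"
  unfolding linear_map_on_def
proof (intro conjI ballI allI)
  show "fmult m ` sobolev_div0 n1 \<subseteq> sobolev_div0 n2" using fmult(2)[OF m] by blast
  fix v :: "'d vfield" assume v: "v \<in> sobolev_div0 n1"
  show "fmult m (c *\<^sub>R v) = c *\<^sub>R fmult m v" for c
    using subspace_scale[OF subspace_sobolev_div0 v]
    by (intro vfield_eqI) (simp add: fmult(1)[OF m] v fcoeff_scaleR)
  fix w :: "'d vfield" assume w: "w \<in> sobolev_div0 n1"
  show "fmult m (v + w) = fmult m v + fmult m w"
    using subspace_add[OF subspace_sobolev_div0 v w]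
    by (intro vfield_eqI) (simp add: fmult(1)[OF m] v w fcoeff_add scaleR_add_right)
qed

lemma linear_map_on_diff:
  assumes L: "linear_map_on (sobolev_div0 n) Y L" and v: "v \<in> sobolev_div0 n" and w: "w \<in> sobolev_div0 n"
  shows "L (v - w) = L v - L w"
proof -
  have "(- 1) *\<^sub>R w \<in> sobolev_div0 n" by (rule subspace_scale[OF subspace_sobolev_div0 w])
  then have "L (v + (- 1) *\<^sub>R w) = L v + (- 1) *\<^sub>R L w"
    using L v w unfolding linear_map_on_def by metis
  then show ?thesis by simp
qed

text \<open>Joint continuity needs only that the symbols are locally uniformly bounded multipliers.\<close>

lemma heat_continuous_map:
  assumes bnd: "\<And>t. t \<in> S \<Longrightarrow> \<exists>C \<delta>. \<delta> > 0 \<and> (\<forall>s\<in>S. \<bar>s - t\<bar> < \<delta> \<longrightarrow> multiplier_bound n1 n2 C (heat_symbol s :: int^'d::finite \<Rightarrow> real))"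
  shows "continuous_map (prod_topology (norm_topology (sobolev_div0 n1) (sobolev_norm n1)) (top_of_set S))
    (norm_topology (sobolev_div0 n2) (sobolev_norm n2)) (\<lambda>(v :: 'd vfield, t). heat t v)"
proof (rule continuous_map_to_sobolev_prod[where d = "\<lambda>s t. \<bar>s - t\<bar>"])
  have bnd1: "\<exists>C. multiplier_bound n1 n2 C (heat_symbol t :: int^'d \<Rightarrow> real)" if "t \<in> S" for t
    using bnd[OF that] that by auto
  show "openin (top_of_set S) {s' \<in> topspace (top_of_set S). \<bar>s' - s\<bar> < \<delta>}" for s \<delta>
  proof -
    have "{s' \<in> topspace (top_of_set S). \<bar>s' - s\<bar> < \<delta>} = S \<inter> ball s \<delta>"
      by (auto simp: dist_real_def abs_minus_commute)
    then show ?thesis by (simp add: openin_open_Int)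
  qed
  show "heat s v \<in> sobolev_div0 n2" if "v \<in> sobolev_div0 n1" "s \<in> topspace (top_of_set S)" for v :: "'d vfield" and s
    using bnd1[of s] that fmult(2) unfolding heat_def by auto
  fix v :: "'d vfield" and t e :: real
  assume v: "v \<in> sobolev_div0 n1" and "t \<in> topspace (top_of_set S)" and e: "e > 0"
  then have t: "t \<in> S" by simp
  obtain C \<delta>0 where \<delta>0: "\<delta>0 > 0" and C: "\<And>s. s \<in> S \<Longrightarrow> \<bar>s - t\<bar> < \<delta>0 \<Longrightarrow> multiplier_bound n1 n2 C (heat_symbol s :: int^'d \<Rightarrow> real)"
    using bnd[OF t] by blast
  have C0: "C \<ge> 0" using C[OF t] \<delta>0 by (simp add: multiplier_bound_def)
  let ?m = "\<lambda>s k. heat_symbol s k - heat_symbol t (k :: int^'d)"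
  have mb: "multiplier_bound n1 n2 (2 * C) (?m s)" if "s \<in> S" "\<bar>s - t\<bar> < \<delta>0" for s
  proof -
    have 1: "multiplier_bound n1 n2 C (heat_symbol s :: int^'d \<Rightarrow> real)" "multiplier_bound n1 n2 C (heat_symbol t :: int^'d \<Rightarrow> real)"
      using C[OF that] C[OF t] \<delta>0 by auto
    have "\<bar>?m s k\<bar> * norm (kvec k) powr n2 \<le> 2 * C * norm (kvec k) powr n1" if "k \<noteq> 0" for k
    proof -
      have "\<bar>?m s k\<bar> * norm (kvec k) powr n2 \<le> (\<bar>heat_symbol s k\<bar> + \<bar>heat_symbol t k\<bar>) * norm (kvec k) powr n2"
        by (intro mult_right_mono) auto
      also have "\<dots> \<le> C * norm (kvec k) powr n1 + C * norm (kvec k) powr n1"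
        unfolding distrib_right using 1 that by (intro add_mono) (auto simp: multiplier_bound_def)
      finally show ?thesis by simp
    qed
    then show ?thesis using 1 C0 by (auto simp: multiplier_bound_def)
  qed
  \<comment> \<open>This filter, unlike \<open>at t within S\<close>, includes the point \<open>t\<close> itself.\<close>
  let ?Fl = "inf (nhds t) (principal S)"
  have "((\<lambda>s. sobolev_norm n2 (fmult (?m s) v)) \<longlongrightarrow> 0) ?Fl"
  proof (rule fmult_tendsto_0[OF v])
    show "\<forall>\<^sub>F s in ?Fl. multiplier_bound n1 n2 (2 * C) (?m s)"
      unfolding eventually_inf_principal eventually_nhds_metric
      using \<delta>0 mb by (auto simp: dist_real_def intro!: exI[of _ \<delta>0])
    show "((\<lambda>s. ?m s k) \<longlongrightarrow> 0) ?Fl" for k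
    proof -
      have "((\<lambda>s. exp (- s * (norm (kvec k))\<^sup>2) - exp (- t * (norm (kvec k))\<^sup>2)) \<longlongrightarrow> exp (- t * (norm (kvec k))\<^sup>2) - exp (- t * (norm (kvec k))\<^sup>2)) (nhds t)"
        by (intro tendsto_intros filterlim_ident)
      then have "((\<lambda>s. ?m s k) \<longlongrightarrow> 0) (nhds t)" by (simp add: heat_symbol_def)
      then show ?thesis by (rule filterlim_mono) auto
    qed
  qed
  then have "\<forall>\<^sub>F s in ?Fl. sobolev_norm n2 (fmult (?m s) v) < e / 2"
    by (rule order_tendstoD) (use e in simp)
  then obtain \<delta>1 where \<delta>1: "\<delta>1 > 0" and near: "\<And>s. s \<in> S \<Longrightarrow> \<bar>s - t\<bar> < \<delta>1 \<Longrightarrow> sobolev_norm n2 (fmult (?m s) v) < e / 2"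
    unfolding eventually_inf_principal eventually_nhds_metric by (auto simp: dist_real_def)
  define \<delta> where "\<delta> = Min {\<delta>0, \<delta>1, e / 2 / (C + 1)}"
  have \<delta>: "\<delta> > 0" "\<delta> \<le> \<delta>0" "\<delta> \<le> \<delta>1" "\<delta> \<le> e / 2 / (C + 1)"
    using \<delta>0 \<delta>1 e C0 by (auto simp: \<delta>_def)
  have "sobolev_norm n2 (heat s w - heat t v) < e"
    if w: "w \<in> sobolev_div0 n1" and s: "s \<in> S" and close: "sobolev_norm n1 (w - v) < \<delta>" "\<bar>s - t\<bar> < \<delta>" for w s
  proof -
    have wv: "w - v \<in> sobolev_div0 n1" by (rule sobolev_div0_diff[OF w v])
    have s0: "\<bar>s - t\<bar> < \<delta>0" "\<bar>s - t\<bar> < \<delta>1" using close \<delta> by auto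
    note hs = fmult[OF C[OF s s0(1)], folded heat_def]
    have t0: "\<bar>t - t\<bar> < \<delta>0" using \<delta>0 by simp
    note ht = fmult[OF C[OF t t0], folded heat_def]
    note hd = fmult[OF mb[OF s s0(1)] v]
    have "heat s w - heat t v = heat s (w - v) + fmult (?m s) v"
      by (rule vfield_eqI) (simp add: fcoeff_diff fcoeff_add hs(1)[OF w] hs(1)[OF wv] ht(1)[OF v] hd(1) algebra_simps)
    then have "sobolev_norm n2 (heat s w - heat t v) \<le> sobolev_norm n2 (heat s (w - v)) + sobolev_norm n2 (fmult (?m s) v)"
      using sobolev_add(2)[OF sobolev_div0D[OF hs(2)[OF wv]] sobolev_div0D[OF hd(2)]] by simp
    also have "sobolev_norm n2 (heat s (w - v)) \<le> C * sobolev_norm n1 (w - v)" by (rule hs(3)[OF wv])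
    also have "\<dots> \<le> C * (e / 2 / (C + 1))" using close \<delta> C0 by (intro mult_left_mono) auto
    also have "\<dots> \<le> (C + 1) * (e / 2 / (C + 1))" using C0 e by (intro mult_right_mono) auto
    also have "\<dots> = e / 2" by (subst times_divide_eq_right, rule nonzero_mult_div_cancel_left) (use C0 in simp)
    finally show ?thesis using near[OF s s0(2)] by simp
  qed
  then show "\<exists>\<delta>>0. \<forall>w\<in>sobolev_div0 n1. \<forall>s\<in>topspace (top_of_set S).
      sobolev_norm n1 (w - v) < \<delta> \<longrightarrow> \<bar>s - t\<bar> < \<delta> \<longrightarrow> sobolev_norm n2 (heat s w - heat t v) < e"
    using \<delta>(1) by auto
qed simp

lemma heat_continuous_map_time:
  assumes "v \<in> sobolev_div0 n"
  shows "continuous_map (top_of_set {0..}) (norm_topology (sobolev_div0 n) (sobolev_norm n)) (\<lambda>t. heat t (v :: 'd::finite vfield))"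
proof -
  have c: "continuous_map (prod_topology (norm_topology (sobolev_div0 n) (sobolev_norm n)) (top_of_set {0..}))
    (norm_topology (sobolev_div0 n) (sobolev_norm n)) (\<lambda>(v :: 'd vfield, t). heat t v)"
    by (rule heat_continuous_map) (auto intro!: exI[of _ 1] heat_symbol_bound_1)
  have p: "continuous_map (top_of_set {0..}) (prod_topology (norm_topology (sobolev_div0 n) (sobolev_norm n)) (top_of_set {0..})) (\<lambda>t::real. (v, t))"
    by (intro continuous_map_pairedI) (auto simp: topspace_sobolev assms)
  show ?thesis using continuous_map_compose[OF p c] by (simp add: o_def)
qed

lemma sc_semigroup_heat: "sc_semigroup (sobolev_div0 n) (sobolev_norm n) heat"
  unfolding sc_semigroup_def
proof (intro conjI allI impI ballI)
  fix t :: real assume t: "0 \<le> t"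
  show "linear_map_on (sobolev_div0 n) (sobolev_div0 n) (heat t)"
    unfolding heat_def by (rule fmult_linear_map[OF heat_symbol_bound_1[OF t]])
  show "\<exists>C. \<forall>x\<in>sobolev_div0 n. sobolev_norm n (heat t x) \<le> C * sobolev_norm n x"
    using heat_sobolev(3)[OF t] by blast
qed (auto intro: heat_0 heat_add_time heat_continuous_map_time)

text \<open>The maximum over \<open>y > 0\<close> is attained at \<open>y = a / t\<close>.\<close>

lemma powr_times_exp_le:
  assumes "a > 0" "t > 0" "y > (0::real)"
  shows "y powr a * exp (- t * y) \<le> (a / (exp 1 * t)) powr a"
proof -
  have "ln (t * y / a) \<le> t * y / a - 1" using assms by (intro ln_le_minus_one) simp
  then have "a * ln (t * y / a) \<le> a * (t * y / a - 1)" using assms by (intro mult_left_mono) auto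
  also have "\<dots> = t * y - a" using assms by (simp add: right_diff_distrib)
  finally have "a * ln y - t * y \<le> a * ln (a / (exp 1 * t))"
    using assms by (simp add: ln_div ln_mult algebra_simps)
  then have "exp (a * ln y - t * y) \<le> exp (a * ln (a / (exp 1 * t)))" by simp
  then show ?thesis using assms by (simp add: powr_def exp_diff exp_minus field_simps)
qed

lemma norm_kvec_powr_diff:
  assumes "k \<noteq> 0" "((norm (kvec k))\<^sup>2) powr ((n2 - n1) / 2) * x \<le> C"
  shows "x * norm (kvec k) powr n2 \<le> C * norm (kvec k) powr n1"
proof -
  define R where "R = norm (kvec k)"
  have R: "R > 0" using assms by (simp add: R_def)
  have "(R\<^sup>2) powr ((n2 - n1) / 2) = R powr (n2 - n1)"
  proof -
    have "R\<^sup>2 = R powr 2" using R by simp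
    then have "(R\<^sup>2) powr ((n2 - n1) / 2) = R powr (2 * ((n2 - n1) / 2))" by (simp only: powr_powr)
    also have "2 * ((n2 - n1) / 2) = n2 - n1" by (simp add: field_simps)
    finally show ?thesis .
  qed
  then have "R powr n2 = (R\<^sup>2) powr ((n2 - n1) / 2) * R powr n1"
    using R by (simp add: powr_add[symmetric])
  moreover have "(((R\<^sup>2) powr ((n2 - n1) / 2)) * x) * R powr n1 \<le> C * R powr n1"
    using assms(2) by (intro mult_right_mono) (auto simp: R_def)
  ultimately show ?thesis by (simp add: R_def mult_ac)
qed

lemma heat_symbol_smoothing:
  assumes "t > 0" "n1 < n2"
  shows "\<exists>C. \<forall>s\<ge>t. multiplier_bound n1 n2 C (heat_symbol s)"
proof -
  let ?a = "(n2 - n1) / 2"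
  define C where "C = (?a / (exp 1 * t)) powr ?a"
  have "multiplier_bound n1 n2 C (heat_symbol s :: int^'a \<Rightarrow> real)" if s: "s \<ge> t" for s
    unfolding multiplier_bound_def
  proof (intro conjI allI impI)
    fix k :: "int^'a" assume k: "k \<noteq> 0"
    define y where "y = (norm (kvec k))\<^sup>2"
    have y: "y > 0" using k by (simp add: y_def)
    have "y powr ?a * exp (- s * y) \<le> y powr ?a * exp (- t * y)"
      using s y by (intro mult_left_mono) auto
    also have "\<dots> \<le> C" unfolding C_def using assms y by (intro powr_times_exp_le) auto
    finally have "y powr ?a * exp (- s * y) \<le> C" .
    then show "\<bar>heat_symbol s k\<bar> * norm (kvec k) powr n2 \<le> C * norm (kvec k) powr n1"
      by (intro norm_kvec_powr_diff[OF k]) (simp add: heat_symbol_def y_def)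
  qed (auto simp: C_def heat_symbol_def)
  then show ?thesis by blast
qed

lemma limitin_fcoeff:
  fixes f :: "'i \<Rightarrow> 'd::finite vfield"
  assumes "limitin (norm_topology (sobolev_div0 n) (sobolev_norm n)) f l Fl"
  shows "((\<lambda>i. fcoeff (f i) k) \<longlongrightarrow> fcoeff l k) Fl"
proof (cases "k = 0")
  case True
  have l: "l \<in> sobolev_div0 n" and ev: "\<forall>\<^sub>F i in Fl. f i \<in> sobolev_div0 n"
    using assms unfolding limitin_sobolev by (blast, metis (no_types, lifting) eventually_mono zero_less_one)
  from ev have "\<forall>\<^sub>F i in Fl. fcoeff (f i) k = fcoeff l k"
    by eventually_elim (use l True in \<open>auto simp: sobolev_div0_iff sobolev0_iff\<close>)
  then show ?thesis by (rule tendsto_eventually)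
next
  case False
  let ?w = "norm (kvec k) powr n"
  have w: "?w > 0" using False by simp
  have l: "l \<in> sobolev_div0 n" using assms by (simp add: limitin_sobolev)
  show ?thesis
  proof (rule tendstoI)
    fix e :: real assume "e > 0"
    then have "?w * e > 0" using w by simp
    then have "\<forall>\<^sub>F i in Fl. f i \<in> sobolev_div0 n \<and> sobolev_norm n (f i - l) < ?w * e"
      using assms unfolding limitin_sobolev by blast
    then show "\<forall>\<^sub>F i in Fl. dist (fcoeff (f i) k) (fcoeff l k) < e"
    proof eventually_elim
      case (elim i)
      then have "weighted n (fcoeff (f i - l)) k < ?w * e"
        using weighted_le_sobolev_norm[OF sobolev_div0D[OF sobolev_div0_diff[OF _ l]], of "f i" k] by simp
      then show ?case using w by (simp add: weighted_def fcoeff_diff dist_norm)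
    qed
  qed
qed

lemma atin_top_of_set: "a \<in> S \<Longrightarrow> atin (top_of_set S) a = at a within S"
  unfolding filter_eq_iff eventually_atin eventually_at_topological openin_open by auto

text \<open>
  The fields \<open>heat t v\<close> are smooth for \<open>t > 0\<close> and converge to \<open>v\<close> as \<open>t\<close> tends to zero.
\<close>

lemma sobolev_dense:
  assumes "n2 < n1"
  shows "norm_topology (sobolev_div0 n2) (sobolev_norm n2) closure_of sobolev_div0 n1 = (sobolev_div0 n2 :: ('d::finite vfield) set)"
proof -
  have "\<exists>w\<in>sobolev_div0 n1. w \<in> sobolev_div0 n2 \<and> sobolev_norm n2 (v - w) < e"
    if v: "v \<in> sobolev_div0 n2" and e: "e > 0" for v :: "'d vfield" and e
  proof -
    have "limitin (norm_topology (sobolev_div0 n2) (sobolev_norm n2)) (\<lambda>t. heat t v) (heat 0 v) (at_right 0)"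
    proof -
      have "limitin (norm_topology (sobolev_div0 n2) (sobolev_norm n2)) (\<lambda>t. heat t v) (heat 0 v) (atin (top_of_set {0..}) 0)"
        using heat_continuous_map_time[OF v] unfolding continuous_map_atin by auto
      then have "limitin (norm_topology (sobolev_div0 n2) (sobolev_norm n2)) (\<lambda>t. heat t v) (heat 0 v) (at 0 within {0..})"
        by (simp add: atin_top_of_set)
      then show ?thesis
        by (simp add: at_within_Ici_at_right)
    qed
    then have "\<forall>\<^sub>F t in at_right 0. heat t v \<in> sobolev_div0 n2 \<and> sobolev_norm n2 (heat t v - v) < e"
      using e by (simp add: limitin_sobolev heat_0[OF v])
    then have "\<forall>\<^sub>F t in at_right 0. t > 0 \<and> heat t v \<in> sobolev_div0 n2 \<and> sobolev_norm n2 (heat t v - v) < e"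
      by (rule eventually_conj[OF eventually_at_right_less])
    then obtain t where t: "t > 0" "heat t v \<in> sobolev_div0 n2" "sobolev_norm n2 (heat t v - v) < e"
      using eventually_happens'[of "at_right (0::real)"] by auto
    obtain C where "multiplier_bound n2 n1 C (heat_symbol t :: int^'d \<Rightarrow> real)"
      using heat_symbol_smoothing[OF t(1) assms] by blast
    then have "heat t v \<in> sobolev_div0 n1" unfolding heat_def by (rule fmult(2)[OF _ v])
    then show ?thesis using t by (auto simp: sobolev_norm_minus_commute[of n2 v])
  qed
  then show ?thesis unfolding closure_of_sobolev by blast
qed

section \<open>The Laplacian generates the heat semigroup\<close>

lemma heat_difference_quotient:
  fixes l :: real assumes "l \<ge> 0"
  shows "((\<lambda>h. (exp (- h * l) - 1) / h + l) \<longlongrightarrow> 0) (at_right 0)"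
    and "h > 0 \<Longrightarrow> \<bar>(exp (- h * l) - 1) / h + l\<bar> \<le> l"
proof -
  have "((\<lambda>h. exp (- h * l)) has_field_derivative (exp (- 0 * l) * - l)) (at 0)"
    by (auto intro!: derivative_eq_intros)
  then have "((\<lambda>h. (exp (- h * l) - 1) / h) \<longlongrightarrow> - l) (at 0)"
    by (simp add: has_field_derivative_iff)
  then have "((\<lambda>h. (exp (- h * l) - 1) / h) \<longlongrightarrow> - l) (at_right 0)"
    by (rule filterlim_mono) (auto simp: at_le)
  then have "((\<lambda>h. (exp (- h * l) - 1) / h + l) \<longlongrightarrow> - l + l) (at_right 0)"
    by (intro tendsto_intros)
  then show "((\<lambda>h. (exp (- h * l) - 1) / h + l) \<longlongrightarrow> 0) (at_right 0)" by simp
  assume h: "h > 0"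
  have "exp (- h * l) - 1 \<ge> - h * l" using exp_ge_add_one_self[of "- h * l"] by simp
  then have "(exp (- h * l) - 1) / h \<ge> - l" using h by (simp add: pos_le_divide_eq mult.commute)
  moreover have "exp (- h * l) - 1 \<le> 0" using h assms by simp
  then have "(exp (- h * l) - 1) / h \<le> 0" using h by (simp add: divide_nonpos_pos)
  ultimately show "\<bar>(exp (- h * l) - 1) / h + l\<bar> \<le> l" by linarith
qed

text \<open>
  On the domain, the error of the difference quotient is a multiplier bounded by \<open>|k|\<^sup>2\<close> that tends to
  zero for each \<open>k\<close>.  Conversely, the limit of the difference quotients of \<open>x\<close> has the coefficients
  \<open>- |k|\<^sup>2 x\<^sub>k\<close>, and its membership in the space of order \<open>n\<close> puts \<open>x\<close> into that of order \<open>n + 2\<close>.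
\<close>

theorem generates_heat:
  "generates (sobolev_div0 n) (sobolev_norm n) (sobolev_div0 (n + 2)) (restrict laplacian (sobolev_div0 (n + 2)))
    (heat :: real \<Rightarrow> 'd::finite vfield \<Rightarrow> 'd vfield)"
  unfolding generates_def
proof (intro conjI ballI allI sc_semigroup_heat)
  show "sobolev_div0 (n + 2) \<subseteq> (sobolev_div0 n :: 'd vfield set)"
    using sobolev_inclusion(1)[of n "n + 2"] by auto
  fix x y :: "'d vfield" assume x: "x \<in> sobolev_div0 n"
  let ?T = "norm_topology (sobolev_div0 n) (sobolev_norm n)"
  let ?q = "\<lambda>h. (1 / h) *\<^sub>R (heat h x - x)"
  let ?m = "\<lambda>h k. (exp (- h * (norm (kvec k))\<^sup>2) - 1) / h + (norm (kvec (k :: int^'d)))\<^sup>2"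
  have q: "?q h \<in> sobolev_div0 n" if "h > 0" for h
    using that by (intro subspace_scale[OF subspace_sobolev_div0] sobolev_div0_diff heat_sobolev(2) x) auto
  have qk: "fcoeff (?q h) k = ((exp (- h * (norm (kvec k))\<^sup>2) - 1) / h) *\<^sub>R fcoeff x k" if "h > 0" for h k
    using that by (simp add: fcoeff_scaleR fcoeff_diff heat_sobolev(1)[OF _ x] heat_symbol_def
        scaleR_left_diff_distrib diff_divide_distrib scaleR_right_diff_distrib)
  show "limitin ?T ?q y (at_right 0) \<longleftrightarrow> x \<in> sobolev_div0 (n + 2) \<and> y = restrict laplacian (sobolev_div0 (n + 2)) x"
  proof
    assume "x \<in> sobolev_div0 (n + 2) \<and> y = restrict laplacian (sobolev_div0 (n + 2)) x"
    then have x2: "x \<in> sobolev_div0 (n + 2)" and y: "y = laplacian x" by auto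
    have mb: "multiplier_bound (n + 2) n 1 (?m h)" if "h > 0" for h
      unfolding multiplier_bound_def
    proof (intro conjI allI impI)
      fix k :: "int^'d" assume k: "k \<noteq> 0"
      have "\<bar>?m h k\<bar> * norm (kvec k) powr n \<le> (norm (kvec k))\<^sup>2 * norm (kvec k) powr n"
        by (intro mult_right_mono heat_difference_quotient(2) that) auto
      then show "\<bar>?m h k\<bar> * norm (kvec k) powr n \<le> 1 * norm (kvec k) powr (n + 2)"
        using k by (simp add: powr_add mult.commute)
    qed auto
    have lim0: "((\<lambda>h. sobolev_norm n (fmult (?m h) x)) \<longlongrightarrow> 0) (at_right 0)"
    proof (rule fmult_tendsto_0[OF x2])
      show "\<forall>\<^sub>F h in at_right 0. multiplier_bound (n + 2) n 1 (?m h)"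
        using eventually_at_right_less[of "0::real"] by eventually_elim (rule mb)
    qed (rule heat_difference_quotient, simp)
    have eq: "?q h - laplacian x = fmult (?m h) x" if h: "h > 0" for h
      by (rule vfield_eqI, simp only: fcoeff_diff qk[OF h] laplacian_sobolev(1)[OF x2] fmult(1)[OF mb[OF h] x2])
        (simp add: scaleR_left_distrib)
    have "((\<lambda>h. sobolev_norm n (?q h - laplacian x)) \<longlongrightarrow> 0) (at_right 0)"
    proof (rule Lim_transform_eventually[OF lim0])
      show "\<forall>\<^sub>F h in at_right 0. sobolev_norm n (fmult (?m h) x) = sobolev_norm n (?q h - laplacian x)"
        using eventually_at_right_less[of "0::real"] by eventually_elim (simp only: eq)
    qed
    then have lt: "\<forall>\<^sub>F h in at_right 0. sobolev_norm n (?q h - laplacian x) < e" if "e > 0" for e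
      by (rule order_tendstoD(2)) (rule that)
    have "\<forall>\<^sub>F h in at_right 0. ?q h \<in> sobolev_div0 n \<and> sobolev_norm n (?q h - laplacian x) < e" if e: "e > 0" for e
      using lt[OF e] eventually_at_right_less[of "0::real"]
    proof eventually_elim
      case (elim h)
      then show ?case using q[of h] by blast
    qed
    then show "limitin ?T ?q y (at_right 0)"
      unfolding limitin_sobolev y using laplacian_sobolev(2)[OF x2] by blast
  next
    assume lim: "limitin ?T ?q y (at_right 0)"
    have yk: "fcoeff y k = (- ((norm (kvec k))\<^sup>2)) *\<^sub>R fcoeff x k" for k
    proof (rule tendsto_unique[OF _ limitin_fcoeff[OF lim]])
      have "((\<lambda>h. ?m h k *\<^sub>R fcoeff x k - ((norm (kvec k))\<^sup>2) *\<^sub>R fcoeff x k) \<longlongrightarrow>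
          0 *\<^sub>R fcoeff x k - ((norm (kvec k))\<^sup>2) *\<^sub>R fcoeff x k) (at_right 0)"
        by (intro tendsto_intros heat_difference_quotient) simp
      then have "((\<lambda>h. ((exp (- h * (norm (kvec k))\<^sup>2) - 1) / h) *\<^sub>R fcoeff x k) \<longlongrightarrow>
          (- ((norm (kvec k))\<^sup>2)) *\<^sub>R fcoeff x k) (at_right 0)"
        by (simp add: scaleR_left_distrib)
      then show "((\<lambda>h. fcoeff (?q h) k) \<longlongrightarrow> (- ((norm (kvec k))\<^sup>2)) *\<^sub>R fcoeff x k) (at_right 0)"
        by (rule Lim_transform_eventually)
          (rule eventually_mono[OF eventually_at_right_less[of "0::real"]], rule qk[symmetric])
    qed simp
    have y: "y \<in> sobolev_div0 n" using lim by (simp add: limitin_sobolev)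
    have "weighted (n + 2) (fcoeff x) = weighted n (fcoeff y)"
    proof
      fix k show "weighted (n + 2) (fcoeff x) k = weighted n (fcoeff y) k"
        by (cases "k = 0") (simp_all add: weighted_def yk powr_add)
    qed
    then have x2: "x \<in> sobolev_div0 (n + 2)"
      using x y by (simp add: sobolev_div0_iff sobolev0_iff)
    moreover have "y = laplacian x"
      by (rule vfield_eqI) (simp add: yk laplacian_sobolev(1)[OF x2])
    ultimately show "x \<in> sobolev_div0 (n + 2) \<and> y = restrict laplacian (sobolev_div0 (n + 2)) x" by simp
  qed
qed

text \<open>
  For each \<open>e > 0\<close>, the last time in \<open>[0, T]\<close> at which \<open>|f t - f 0| \<le> e t\<close> must be \<open>T\<close>: the vanishing
  right derivative would carry the estimate beyond any earlier time.
\<close>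

lemma constant_if_right_derivative_0:
  fixes f :: "real \<Rightarrow> 'b::real_normed_vector"
  assumes cont: "continuous_on {0..} f"
    and der: "\<And>t. t \<ge> 0 \<Longrightarrow> ((\<lambda>h. (1 / h) *\<^sub>R (f (t + h) - f t)) \<longlongrightarrow> 0) (at_right 0)"
    and T: "T \<ge> 0"
  shows "f T = f 0"
proof -
  have le: "norm (f T - f 0) \<le> e * T" if e: "e > 0" for e
  proof -
    define S where "S = {t \<in> {0..T}. norm (f t - f 0) \<le> e * t}"
    define c where "c = Sup S"
    have ne: "0 \<in> S" using T by (simp add: S_def)
    have bdd: "bdd_above S" by (rule bdd_aboveI[of _ T]) (auto simp: S_def)
    have cl: "closed S"
    proof -
      have "continuous_on {0..T} (\<lambda>t. norm (f t - f 0) - e * t)"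
        by (intro continuous_intros continuous_on_subset[OF cont]) auto
      then have "closed ({0..T} \<inter> (\<lambda>t. norm (f t - f 0) - e * t) -` {..0})"
        by (rule continuous_closed_preimage) auto
      moreover have "{0..T} \<inter> (\<lambda>t. norm (f t - f 0) - e * t) -` {..0} = S" by (auto simp: S_def)
      ultimately show ?thesis by simp
    qed
    have c: "c \<in> S" unfolding c_def using closed_contains_Sup[OF _ bdd cl] ne by auto
    have "c = T"
    proof (rule ccontr)
      assume "c \<noteq> T"
      then have cT: "0 \<le> c" "c < T" using c by (auto simp: S_def)
      have "\<forall>\<^sub>F h in at_right 0. dist ((1 / h) *\<^sub>R (f (c + h) - f c)) 0 < e"
        using tendstoD[OF der[OF cT(1)] e] .
      moreover have "\<forall>\<^sub>F h in at_right 0. h < T - c"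
        using cT by (intro eventually_at_right_field[THEN iffD2] exI[of _ "T - c"]) auto
      moreover have "\<forall>\<^sub>F h in at_right (0::real). 0 < h" by (rule eventually_at_right_less)
      ultimately have ev: "\<forall>\<^sub>F h in at_right 0. 0 < h \<and> h < T - c \<and> dist ((1 / h) *\<^sub>R (f (c + h) - f c)) 0 < e"
        by eventually_elim auto
      then obtain h where h: "0 < h" "h < T - c" "norm ((1 / h) *\<^sub>R (f (c + h) - f c)) < e"
        using eventually_happens'[OF trivial_limit_at_right_real ev] unfolding dist_norm diff_0_right by blast
      then have "norm (f (c + h) - f c) < e * h" by (simp add: pos_divide_less_eq)
      moreover have "norm (f c - f 0) \<le> e * c" using c by (simp add: S_def)
      ultimately have "norm (f (c + h) - f 0) \<le> e * (c + h)"
        using norm_triangle_ineq[of "f (c + h) - f c" "f c - f 0"] by (simp add: algebra_simps)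
      then have "c + h \<in> S" using h cT by (simp add: S_def)
      then have "c + h \<le> c" unfolding c_def by (rule cSup_upper[OF _ bdd])
      then show False using h by simp
    qed
    then show ?thesis using c by (simp add: S_def)
  qed
  have "norm (f T - f 0) \<le> 0"
  proof (rule field_le_epsilon)
    fix e :: real assume e: "e > 0"
    have "norm (f T - f 0) \<le> e / (T + 1) * T" using e T by (intro le) simp
    also have "\<dots> \<le> e / (T + 1) * (T + 1)" using e T by (intro mult_left_mono) auto
    finally show "norm (f T - f 0) \<le> 0 + e" using T by simp
  qed
  then show ?thesis by simp
qed

text \<open>
  A semigroup generated by the Laplacian commutes with its generator, so every Fourier coefficient of
  an orbit starting in the domain solves \<open>c' = - |k|\<^sup>2 c\<close> from the right; density does the rest.
\<close>

theorem generates_unique: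
  fixes U :: "real \<Rightarrow> 'd::finite vfield \<Rightarrow> 'd vfield"
  assumes gen: "generates (sobolev_div0 n) (sobolev_norm n) (sobolev_div0 (n + 2)) (restrict laplacian (sobolev_div0 (n + 2))) U"
    and t: "t \<ge> 0" and v: "v \<in> sobolev_div0 n"
  shows "U t v = heat t v"
proof -
  let ?T = "norm_topology (sobolev_div0 n) (sobolev_norm n)"
  have sc: "sc_semigroup (sobolev_div0 n) (sobolev_norm n) U"
    and lim: "\<And>x y. x \<in> sobolev_div0 n \<Longrightarrow> limitin ?T (\<lambda>h. (1 / h) *\<^sub>R (U h x - x)) y (at_right 0)
      \<longleftrightarrow> x \<in> sobolev_div0 (n + 2) \<and> y = restrict laplacian (sobolev_div0 (n + 2)) x"
    using gen unfolding generates_def by blast+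
  have lin: "\<And>s. s \<ge> 0 \<Longrightarrow> linear_map_on (sobolev_div0 n) (sobolev_div0 n) (U s)"
    and bnd: "\<And>s. s \<ge> 0 \<Longrightarrow> \<exists>C. \<forall>x\<in>sobolev_div0 n. sobolev_norm n (U s x) \<le> C * sobolev_norm n x"
    and U0: "\<And>x. x \<in> sobolev_div0 n \<Longrightarrow> U 0 x = x"
    and Uadd: "\<And>s r x. s \<ge> 0 \<Longrightarrow> r \<ge> 0 \<Longrightarrow> x \<in> sobolev_div0 n \<Longrightarrow> U (s + r) x = U s (U r x)"
    and Ucont: "\<And>x. x \<in> sobolev_div0 n \<Longrightarrow> continuous_map (top_of_set {0..}) ?T (\<lambda>t. U t x)"
    using sc unfolding sc_semigroup_def by blast+
  have Umem: "U s x \<in> sobolev_div0 n" if "s \<ge> 0" "x \<in> sobolev_div0 n" for s x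
    using lin[OF that(1)] that(2) unfolding linear_map_on_def by blast
  have dom: "U t x = heat t x" if x2: "x \<in> sobolev_div0 (n + 2)" for x
  proof -
    have x: "x \<in> sobolev_div0 n" using sobolev_inclusion(1)[OF _ x2] by simp
    \<comment> \<open>\<open>U s\<close> is bounded and commutes with the difference quotients at \<open>x\<close>.\<close>
    have step: "limitin ?T (\<lambda>h. (1 / h) *\<^sub>R (U h (U s x) - U s x)) (laplacian (U s x)) (at_right 0)" if s: "s \<ge> 0" for s
    proof -
      obtain C where C: "\<And>y. y \<in> sobolev_div0 n \<Longrightarrow> sobolev_norm n (U s y) \<le> C * sobolev_norm n y"
        using bnd[OF s] by blast
      have Ax: "laplacian x \<in> sobolev_div0 n" by (rule laplacian_sobolev(2)[OF x2])
      have L: "limitin ?T (\<lambda>h. (1 / h) *\<^sub>R (U h x - x)) (laplacian x) (at_right 0)"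
        using lim[OF x] x2 by simp
      have "limitin ?T (\<lambda>h. (1 / h) *\<^sub>R (U h (U s x) - U s x)) (U s (laplacian x)) (at_right 0)"
        unfolding limitin_sobolev
      proof (intro conjI allI impI)
        show "U s (laplacian x) \<in> sobolev_div0 n" by (rule Umem[OF s Ax])
        fix e :: real assume e: "e > 0"
        have "e / (\<bar>C\<bar> + 1) > 0" using e by (simp add: add_nonneg_pos)
        with L have "\<forall>\<^sub>F h in at_right 0. (1 / h) *\<^sub>R (U h x - x) \<in> sobolev_div0 n \<and>
            sobolev_norm n ((1 / h) *\<^sub>R (U h x - x) - laplacian x) < e / (\<bar>C\<bar> + 1)"
          unfolding limitin_sobolev by blast
        moreover have "\<forall>\<^sub>F h in at_right (0::real). 0 < h" by (rule eventually_at_right_less)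
        ultimately show "\<forall>\<^sub>F h in at_right 0. (1 / h) *\<^sub>R (U h (U s x) - U s x) \<in> sobolev_div0 n \<and>
            sobolev_norm n ((1 / h) *\<^sub>R (U h (U s x) - U s x) - U s (laplacian x)) < e"
        proof eventually_elim
          case (elim h)
          let ?q = "(1 / h) *\<^sub>R (U h x - x)"
          have Uh: "U h x \<in> sobolev_div0 n" using elim by (intro Umem x) simp
          have d: "U h x - x \<in> sobolev_div0 n" by (rule sobolev_div0_diff[OF Uh x])
          have q: "?q \<in> sobolev_div0 n" using elim by simp
          have "U h (U s x) = U s (U h x)"
            using Uadd[of h s x] Uadd[of s h x] elim s x by (simp add: add.commute)
          then have eq: "(1 / h) *\<^sub>R (U h (U s x) - U s x) = U s ?q"
            using linear_map_on_diff[OF lin[OF s] Uh x] lin[OF s] d unfolding linear_map_on_def by simp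
          have "sobolev_norm n (U s ?q - U s (laplacian x)) = sobolev_norm n (U s (?q - laplacian x))"
            by (simp add: linear_map_on_diff[OF lin[OF s] q Ax])
          also have "\<dots> \<le> C * sobolev_norm n (?q - laplacian x)"
            by (rule C[OF sobolev_div0_diff[OF q Ax]])
          also have "\<dots> \<le> (\<bar>C\<bar> + 1) * sobolev_norm n (?q - laplacian x)"
            by (intro mult_right_mono sobolev_norm_nonneg) auto
          also have "\<dots> < e"
          proof -
            have "(\<bar>C\<bar> + 1) * sobolev_norm n (?q - laplacian x) < (\<bar>C\<bar> + 1) * (e / (\<bar>C\<bar> + 1))"
              using elim by (intro mult_strict_left_mono) (auto simp: add_nonneg_pos)
            also have "(\<bar>C\<bar> + 1) * (e / (\<bar>C\<bar> + 1)) = e" by simp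
            finally show ?thesis .
          qed
          finally show ?case unfolding eq using Umem[OF s q] by simp
        qed
      qed
      moreover from this have "U s x \<in> sobolev_div0 (n + 2)" "U s (laplacian x) = laplacian (U s x)"
        using lim[OF Umem[OF s x], of "U s (laplacian x)"] by auto
      ultimately show ?thesis by simp
    qed
    have dom2: "U s x \<in> sobolev_div0 (n + 2)" if "s \<ge> 0" for s
      using lim[OF Umem[OF that x]] step[OF that] by blast
    show ?thesis
    proof (rule vfield_eqI)
      fix k :: "int^'d"
      let ?l = "(norm (kvec k))\<^sup>2"
      define c where "c s = fcoeff (U s x) k" for s
      define g where "g s = exp (s * ?l) *\<^sub>R c s" for s
      have contc: "continuous_on {0..} c"
        unfolding continuous_on_def c_def
      proof
        fix s :: real assume "s \<in> {0..}"
        then have "limitin ?T (\<lambda>s. U s x) (U s x) (at s within {0..})"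
          using Ucont[OF x] unfolding continuous_map_atin by (simp add: atin_top_of_set)
        then show "((\<lambda>s. fcoeff (U s x) k) \<longlongrightarrow> fcoeff (U s x) k) (at s within {0..})"
          by (rule limitin_fcoeff)
      qed
      have contg: "continuous_on {0..} g" unfolding g_def by (intro continuous_intros contc)
      have derg: "((\<lambda>h. (1 / h) *\<^sub>R (g (s + h) - g s)) \<longlongrightarrow> 0) (at_right 0)" if s: "s \<ge> 0" for s
      proof -
        have 1: "((\<lambda>h. (1 / h) *\<^sub>R (c (s + h) - c s)) \<longlongrightarrow> (- ?l) *\<^sub>R c s) (at_right 0)"
        proof (rule Lim_transform_eventually)
          have "((\<lambda>h. fcoeff ((1 / h) *\<^sub>R (U h (U s x) - U s x)) k) \<longlongrightarrow> fcoeff (laplacian (U s x)) k) (at_right 0)"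
            by (rule limitin_fcoeff[OF step[OF s]])
          then show "((\<lambda>h. fcoeff ((1 / h) *\<^sub>R (U h (U s x) - U s x)) k) \<longlongrightarrow> (- ?l) *\<^sub>R c s) (at_right 0)"
            by (simp add: laplacian_sobolev(1)[OF dom2[OF s]] c_def)
          show "\<forall>\<^sub>F h in at_right 0. fcoeff ((1 / h) *\<^sub>R (U h (U s x) - U s x)) k = (1 / h) *\<^sub>R (c (s + h) - c s)"
            using eventually_at_right_less[of "0::real"]
          proof eventually_elim
            case (elim h)
            then show ?case using Uadd[of h s x] s x by (simp add: fcoeff_scaleR fcoeff_diff c_def add.commute)
          qed
        qed
        have "((\<lambda>h. exp (h * ?l)) has_field_derivative (exp (0 * ?l) * ?l)) (at 0)"
          by (auto intro!: derivative_eq_intros)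
        then have "((\<lambda>h. (exp (h * ?l) - 1) / h) \<longlongrightarrow> ?l) (at 0)"
          by (simp add: has_field_derivative_iff)
        then have 2: "((\<lambda>h. (exp (h * ?l) - 1) / h) \<longlongrightarrow> ?l) (at_right 0)"
          by (rule filterlim_mono) (auto simp: at_le)
        have 3: "((\<lambda>h. exp (h * ?l)) \<longlongrightarrow> exp (0 * ?l)) (at_right 0)"
          by (intro tendsto_intros)
        have "((\<lambda>h. exp (s * ?l) *\<^sub>R (exp (h * ?l) *\<^sub>R ((1 / h) *\<^sub>R (c (s + h) - c s)) + ((exp (h * ?l) - 1) / h) *\<^sub>R c s))
          \<longlongrightarrow> exp (s * ?l) *\<^sub>R (exp (0 * ?l) *\<^sub>R ((- ?l) *\<^sub>R c s) + ?l *\<^sub>R c s)) (at_right 0)"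
          by (intro tendsto_intros 1 2 3)
        moreover have "exp (s * ?l) *\<^sub>R (exp (h * ?l) *\<^sub>R ((1 / h) *\<^sub>R (c (s + h) - c s)) + ((exp (h * ?l) - 1) / h) *\<^sub>R c s)
          = (1 / h) *\<^sub>R (g (s + h) - g s)" for h
          by (simp add: g_def scaleR_right_diff_distrib scaleR_right_distrib scaleR_left_diff_distrib
              diff_divide_distrib exp_add distrib_right right_diff_distrib)
        ultimately show ?thesis by simp
      qed
      have "g t = g 0" by (rule constant_if_right_derivative_0[OF contg derg t])
      then have "exp (- t * ?l) *\<^sub>R g t = exp (- t * ?l) *\<^sub>R g 0" by simp
      then have "c t = exp (- t * ?l) *\<^sub>R c 0" by (simp add: g_def exp_add[symmetric])
      then show "fcoeff (U t x) k = fcoeff (heat t x) k"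
        by (simp add: c_def U0[OF x] heat_sobolev(1)[OF t x] heat_symbol_def)
    qed
  qed
  obtain C where C: "\<And>y. y \<in> sobolev_div0 n \<Longrightarrow> sobolev_norm n (U t y) \<le> C * sobolev_norm n y"
    using bnd[OF t] by blast
  have mem: "U t v \<in> sobolev_div0 n" "heat t v \<in> sobolev_div0 n" by (intro Umem t v heat_sobolev)+
  have "sobolev_norm n (U t v - heat t v) \<le> 0"
  proof (rule field_le_epsilon)
    fix e :: real assume e: "e > 0"
    then have "e / (\<bar>C\<bar> + 1) > 0" by (simp add: add_nonneg_pos)
    moreover have "v \<in> ?T closure_of sobolev_div0 (n + 2)" using v sobolev_dense[of n "n + 2", where 'd = 'd] by simp
    ultimately obtain x where x: "x \<in> sobolev_div0 (n + 2)" "x \<in> sobolev_div0 n" "sobolev_norm n (v - x) < e / (\<bar>C\<bar> + 1)"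
      unfolding closure_of_sobolev by blast
    have d: "v - x \<in> sobolev_div0 n" by (rule sobolev_div0_diff[OF v x(2)])
    have "U t v - heat t v = U t (v - x) - heat t (v - x)"
      using linear_map_on_diff[OF lin[OF t] v x(2)] dom[OF x(1)]
        linear_map_on_diff[OF fmult_linear_map[OF heat_symbol_bound_1[OF t]] v x(2)]
      by (simp add: heat_def)
    then have "sobolev_norm n (U t v - heat t v) \<le> sobolev_norm n (U t (v - x)) + sobolev_norm n (heat t (v - x))"
      using sobolev_add(2)[OF sobolev_div0D[OF Umem[OF t d]] sobolev_scaleR[OF sobolev_div0D[OF heat_sobolev(2)[OF t d]], of "-1"]]
      by (simp add: sobolev_norm_uminus)
    also have "\<dots> \<le> C * sobolev_norm n (v - x) + 1 * sobolev_norm n (v - x)"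
      by (intro add_mono C d heat_sobolev(3) t)
    also have "\<dots> \<le> (\<bar>C\<bar> + 1) * sobolev_norm n (v - x)"
      unfolding distrib_right by (intro add_mono mult_right_mono sobolev_norm_nonneg) auto
    also have "\<dots> \<le> (\<bar>C\<bar> + 1) * (e / (\<bar>C\<bar> + 1))" using x(3) by (intro mult_left_mono) auto
    also have "\<dots> = e" by simp
    finally show "sobolev_norm n (U t v - heat t v) \<le> 0 + e" by simp
  qed
  then have "sobolev_norm n (U t v - heat t v) = 0"
    using sobolev_norm_nonneg[of n "U t v - heat t v"] by (rule order_antisym)
  then have "U t v - heat t v = 0"
    by (rule sobolev_norm_eq_0[OF sobolev_div0D[OF sobolev_div0_diff[OF mem]]])
  then show ?thesis by simp
qed

section \<open>The function \<open>\<mu>\<^sub>\<omega>\<close>\<close>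

lemma mu_fun_eq: "mu_fun \<omega> t = (if t \<le> (1 + \<omega>) / 2
    then ((1 + \<omega>) / 2 / (exp 1 * t)) powr ((1 + \<omega>) / 2) * exp t else 1)"
  by (simp add: mu_fun_def mult.assoc)

lemma mu_fun_pos: "\<omega> > 0 \<Longrightarrow> t > 0 \<Longrightarrow> mu_fun \<omega> t > 0"
  by (simp add: mu_fun_eq)

lemma mu_fun_nonneg: "mu_fun \<omega> t \<ge> 0"
  by (simp add: mu_fun_eq)

text \<open>The two branches agree at \<open>t = (1 + \<omega>) / 2\<close>, so \<open>\<mu>\<^sub>\<omega>\<close> is the first one composed with \<open>min\<close>.\<close>

lemma continuous_on_mu_fun:
  assumes "\<omega> > 0" shows "continuous_on {0<..} (mu_fun \<omega>)"
proof -
  define a where "a = (1 + \<omega>) / 2"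
  have a: "a > 0" using assms by (simp add: a_def)
  have "mu_fun \<omega> t = (a / (exp 1 * min t a)) powr a * exp (min t a)" if "t > 0" for t
  proof (cases "t \<le> a")
    case False
    have "(a / (exp 1 * a)) powr a * exp a = 1"
      using a by (simp add: powr_def ln_div exp_minus)
    then show ?thesis using False by (simp add: mu_fun_eq a_def[symmetric] min_def)
  qed (simp add: mu_fun_eq a_def[symmetric] min_def)
  moreover have "continuous_on {0<..} (\<lambda>t. (a / (exp 1 * min t a)) powr a * exp (min t a))"
    using a by (intro continuous_intros) auto
  ultimately show ?thesis by (subst continuous_on_cong[OF refl]) auto
qed

lemma mu_fun_le:
  assumes "\<omega> > 0" "t > 0" "t \<le> (1 + \<omega>) / 2"
  shows "mu_fun \<omega> t \<le> ((1 + \<omega>) / 2) powr ((1 + \<omega>) / 2) * t powr (- ((1 + \<omega>) / 2))"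
proof -
  define a where "a = (1 + \<omega>) / 2"
  have a: "a > 0" using assms by (simp add: a_def)
  have "mu_fun \<omega> t = (a / (exp 1 * t)) powr a * exp t" using assms by (simp add: mu_fun_eq a_def)
  also have "\<dots> = a powr a * t powr (- a) * (exp (t - a))"
    using a assms by (simp add: powr_def ln_div ln_mult exp_diff exp_minus exp_add algebra_simps) (simp add: field_simps)
  also have "\<dots> \<le> a powr a * t powr (- a) * 1"
    using assms by (intro mult_left_mono) (auto simp: a_def)
  finally show ?thesis by (simp add: a_def)
qed

lemma mu_fun_bigo:
  assumes "\<omega> > 0"
  shows "mu_fun \<omega> \<in> O[at_right 0](\<lambda>t. 1 / t powr ((1 + \<omega>) / 2))"
proof (rule bigoI)
  have "\<forall>\<^sub>F t in at_right 0. t < (1 + \<omega>) / 2"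
    by (rule eventually_at_rightI[of 0 "(1 + \<omega>) / 2"]) (use assms in auto)
  with eventually_at_right_less[of "0::real"]
  show "\<forall>\<^sub>F t in at_right 0. norm (mu_fun \<omega> t) \<le> ((1 + \<omega>) / 2) powr ((1 + \<omega>) / 2) * norm (1 / t powr ((1 + \<omega>) / 2))"
  proof eventually_elim
    case (elim t)
    have "mu_fun \<omega> t \<le> ((1 + \<omega>) / 2) powr ((1 + \<omega>) / 2) * (1 / t powr ((1 + \<omega>) / 2))"
      unfolding powr_minus_divide[symmetric] by (rule mu_fun_le[OF assms]) (use elim in auto)
    moreover have "norm (1 / t powr ((1 + \<omega>) / 2)) = 1 / t powr ((1 + \<omega>) / 2)"
      by (simp only: real_norm_def abs_of_nonneg powr_ge_zero divide_nonneg_nonneg zero_le_one)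
    ultimately show ?case
      unfolding real_norm_def[of "mu_fun \<omega> t"] abs_of_nonneg[OF mu_fun_nonneg] by simp
  qed
qed

lemma mu_fun_measurable [measurable]: "mu_fun \<omega> \<in> borel_measurable borel"
  unfolding mu_fun_def by measurable

lemma integrable_powr_near_0:
  fixes a c :: real
  assumes "a < 1" "c \<ge> 0"
  shows "integrable lborel (\<lambda>u. indicator {0..c} u * u powr (- a))"
proof -
  have "(\<lambda>u. u powr (- a)) integrable_on {0..c}"
    using has_integral_powr_from_0[of "- a" c] assms by (auto simp: integrable_on_def)
  then have "(\<lambda>u. u powr (- a)) absolutely_integrable_on {0..c}"
    by (intro nonnegative_absolutely_integrable_1) auto
  then have "integrable lebesgue (\<lambda>u. indicator {0..c} u *\<^sub>R u powr (- a))"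
    by (simp add: set_integrable_def)
  then have "integrable lborel (\<lambda>u. indicator {0..c} u *\<^sub>R u powr (- a))"
    by (subst (asm) integrable_completion) measurable
  then show ?thesis by simp
qed

text \<open>
  The integrand is at most \<open>e\<^sup>-\<^sup>s + C (t - s)\<^sup>-\<^sup>a\<close>, the second term being present only for \<open>t - s \<le> a\<close>, where
  \<open>a = (1 + \<omega>) / 2 < 1\<close>; the integrals of both terms are bounded independently of \<open>t\<close>.
\<close>

lemma mu_fun_convolution:
  assumes \<omega>: "0 < \<omega>" "\<omega> < 1"
  obtains C where "\<And>t. t \<ge> 0 \<Longrightarrow> set_integrable lborel {0..t} (\<lambda>s. exp (- s) * mu_fun \<omega> (t - s))"
    "\<And>t. t \<ge> 0 \<Longrightarrow> (LBINT s:{0..t}. exp (- s) * mu_fun \<omega> (t - s)) \<le> C"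
proof -
  define a where "a = (1 + \<omega>) / 2"
  have a: "a > 0" "a < 1" using \<omega> by (auto simp: a_def)
  define H where "H u = indicator {0..a} u * u powr (- a)" for u :: real
  have H0: "H u \<ge> 0" for u by (simp add: H_def)
  have H: "integrable lborel H" unfolding H_def using a by (intro integrable_powr_near_0) auto
  define C where "C = 1 + a powr a * integral\<^sup>L lborel H"
  have main: "set_integrable lborel {0..t} (\<lambda>s. exp (- s) * mu_fun \<omega> (t - s)) \<and>
    (LBINT s:{0..t}. exp (- s) * mu_fun \<omega> (t - s)) \<le> C" if t: "t \<ge> 0" for t
  proof -
    let ?f = "\<lambda>s. indicator {0..t} s *\<^sub>R (exp (- s) * mu_fun \<omega> (t - s))"
    have E: "set_integrable lborel {0..t} (\<lambda>s. exp (- s))"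
      by (intro borel_integrable_atLeastAtMost' continuous_intros)
    have "((\<lambda>s. exp (- s)) has_integral (- exp (- t) - (- exp (- 0)))) {0..t}"
      by (rule fundamental_theorem_of_calculus[OF t])
        (auto intro!: derivative_eq_intros simp: has_real_derivative_iff_has_vector_derivative[symmetric])
    then have EI: "(LBINT s:{0..t}. exp (- s)) \<le> 1"
      unfolding set_borel_integral_eq_integral(2)[OF E] by (simp add: integral_unique)
    have Ht: "integrable lborel (\<lambda>s. H (t - s))" "integral\<^sup>L lborel (\<lambda>s. H (t - s)) = integral\<^sup>L lborel H"
      using lborel_integrable_real_affine[OF H, of "-1" t] lborel_integral_real_affine[of "-1" H t] by simp_all
    let ?g = "\<lambda>s. indicator {0..t} s *\<^sub>R exp (- s) + a powr a * H (t - s)"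
    have gi: "integrable lborel ?g"
      using E Ht(1) by (simp add: set_integrable_def)
    have le: "?f s \<le> ?g s" for s
    proof (cases "s \<in> {0..t}")
      case True
      have e: "0 < exp (- s)" "exp (- s) \<le> 1" using True by auto
      show ?thesis
      proof (cases "t - s \<le> a \<and> s < t")
        case small: True
        then have "mu_fun \<omega> (t - s) \<le> a powr a * H (t - s)"
          using mu_fun_le[of \<omega> "t - s"] \<omega> True by (simp add: a_def[symmetric] H_def)
        then have "exp (- s) * mu_fun \<omega> (t - s) \<le> 1 * (a powr a * H (t - s))"
          using e by (intro mult_mono mu_fun_nonneg) auto
        then have "exp (- s) * mu_fun \<omega> (t - s) \<le> exp (- s) + a powr a * H (t - s)"
          using e by linarith
        then show ?thesis using True by simp
      next
        case False
        then have "mu_fun \<omega> (t - s) \<le> 1" using True by (auto simp: mu_fun_eq a_def[symmetric])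
        then have "exp (- s) * mu_fun \<omega> (t - s) \<le> exp (- s) * 1"
          using e by (intro mult_left_mono) auto
        then show ?thesis using True H0[of "t - s"] by (simp add: add_increasing2)
      qed
    qed (simp add: H0)
    have fi: "integrable lborel ?f"
      by (rule Bochner_Integration.integrable_bound[OF gi])
        (use le in \<open>auto intro!: AE_I2 order_trans[OF _ abs_ge_self] simp: mu_fun_nonneg abs_mult\<close>)
    have "integral\<^sup>L lborel ?f \<le> integral\<^sup>L lborel ?g"
      by (rule Bochner_Integration.integral_mono[OF fi gi le])
    also have "\<dots> = (LBINT s:{0..t}. exp (- s)) + a powr a * integral\<^sup>L lborel H"
      using E Ht by (simp add: set_integrable_def set_lebesgue_integral_def)
    also have "\<dots> \<le> C" using EI by (simp add: C_def)
    finally show ?thesis using fi by (simp add: set_integrable_def set_lebesgue_integral_def)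
  qed
  show ?thesis using main by (intro that) blast+
qed

text \<open>
  The function \<open>y\<^sup>a e\<^sup>-\<^sup>t\<^sup>y\<close> with \<open>y = |k|\<^sup>2 \<ge> 1\<close> and \<open>a = (1 + \<omega>) / 2\<close> is largest at \<open>y = a / t\<close> if \<open>t \<le> a\<close>, and
  at \<open>y = 1\<close> otherwise.  This explains the two branches of \<open>\<mu>\<^sub>\<omega>\<close>.
\<close>

lemma heat_symbol_mu:
  assumes "\<omega> > 0" "t > 0"
  shows "multiplier_bound (- \<omega>) 1 (mu_fun \<omega> t * exp (- t)) (heat_symbol t)"
  unfolding multiplier_bound_def
proof (intro conjI allI impI)
  fix k :: "int^'a" assume k: "k \<noteq> 0"
  define a where "a = (1 + \<omega>) / 2"
  define y where "y = (norm (kvec k))\<^sup>2"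
  have a: "a > 0" using assms by (simp add: a_def)
  have y: "y \<ge> 1" unfolding y_def by (rule norm_kvec_sq_ge_1[OF k])
  have "y powr a * exp (- t * y) \<le> mu_fun \<omega> t * exp (- t)"
  proof (cases "t \<le> a")
    case True
    have "y powr a * exp (- t * y) \<le> (a / (exp 1 * t)) powr a"
      using a assms y by (intro powr_times_exp_le) auto
    also have "\<dots> = mu_fun \<omega> t * exp (- t)"
      using True by (simp add: mu_fun_eq a_def[symmetric] mult.assoc exp_add[symmetric])
    finally show ?thesis .
  next
    case False
    have "a * ln y \<le> a * (y - 1)" using a y by (intro mult_left_mono ln_le_minus_one) auto
    also have "\<dots> \<le> t * (y - 1)" using False y by (intro mult_right_mono) auto
    finally have "exp (a * ln y - t * y) \<le> exp (- t)" by (simp add: algebra_simps)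
    moreover have "y powr a * exp (- t * y) = exp (a * ln y - t * y)"
      using y by (simp add: powr_def exp_add[symmetric])
    moreover have "mu_fun \<omega> t = 1" using False by (simp add: mu_fun_eq a_def[symmetric])
    ultimately show ?thesis by simp
  qed
  then show "\<bar>heat_symbol t k\<bar> * norm (kvec k) powr 1 \<le> mu_fun \<omega> t * exp (- t) * norm (kvec k) powr (- \<omega>)"
    by (intro norm_kvec_powr_diff[OF k]) (simp add: heat_symbol_def y_def a_def)
qed (auto simp: heat_symbol_def mu_fun_nonneg)

section \<open>The quadratic term\<close>

lemma norm_fcoeff_le_weighted_1:
  assumes "v \<in> sobolev_div0 1" shows "norm (fcoeff v k) \<le> weighted 1 (fcoeff v) k"
proof (cases "k = 0")
  case True
  then show ?thesis using assms by (simp add: sobolev_div0_iff sobolev0_iff weighted_0)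
next
  case False
  then have "1 * norm (fcoeff v k) \<le> norm (kvec k) * norm (fcoeff v k)"
    using norm_kvec_ge_1 by (intro mult_right_mono) auto
  then show ?thesis by (simp add: weighted_def)
qed

lemma square_summableI:
  assumes v: "v \<in> sobolev_div0 1" and le: "\<And>k. norm (dcoeff T k) \<le> weighted 1 (fcoeff v) k"
  shows "square_summable T"
  unfolding square_summable_def
proof (intro exI allI impI)
  fix G :: "(int^'a) set" assume G: "finite G"
  have "(\<Sum>k\<in>G. (norm (dcoeff T k))\<^sup>2) \<le> (\<Sum>k\<in>G. (weighted 1 (fcoeff v) k)\<^sup>2)"
    by (intro sum_mono power_mono le) auto
  also have "\<dots> = (L2_set (weighted 1 (fcoeff v)) G)\<^sup>2"
    by (simp add: L2_set_def sum_nonneg)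
  also have "\<dots> \<le> (sobolev_norm 1 v)\<^sup>2"
    by (intro power_mono L2_set_le_sobolev_norm sobolev_div0D v G) auto
  finally show "(\<Sum>k\<in>G. (norm (dcoeff T k))\<^sup>2) \<le> (sobolev_norm 1 v)\<^sup>2" .
qed

lemma square_summable_component: "v \<in> sobolev_div0 1 \<Longrightarrow> square_summable (v $ s)"
  using Finite_Cartesian_Product.norm_nth_le[of "fcoeff v _" s] norm_fcoeff_le_weighted_1[of v]
  by (intro square_summableI[of v]) (auto simp: fcoeff_nth intro: order_trans)

lemma square_summable_derivative:
  assumes w: "w \<in> sobolev_div0 1" shows "square_summable (distr_deriv s (w $ r))"
proof (rule square_summableI[OF w])
  fix k
  have "norm (dcoeff (distr_deriv s (w $ r)) k) = \<bar>real_of_int (k $ s)\<bar> * norm (fcoeff w k $ r)"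
    by (simp add: dcoeff_distr_deriv norm_mult fcoeff_nth)
  also have "\<dots> \<le> norm (kvec k) * norm (fcoeff w k)"
    by (intro mult_mono abs_component_le_norm_kvec Finite_Cartesian_Product.norm_nth_le) auto
  finally show "norm (dcoeff (distr_deriv s (w $ r)) k) \<le> weighted 1 (fcoeff w) k"
    by (simp add: weighted_def)
qed

text \<open>
  The coefficients of \<open>v \<cdot> \<partial>w\<close> with the frequencies of \<open>w\<close> restricted to a ball; the factor \<open>\<i>\<close> and the
  vector \<open>p\<close> come from the derivative.
\<close>

definition advection_partial :: "'d::finite vfield \<Rightarrow> 'd vfield \<Rightarrow> nat \<Rightarrow> int^'d \<Rightarrow> complex^'d" where
  "advection_partial v w n k = (\<Sum>p\<in>freq_ball n.
     (of_real ((2 * pi) powr (- real CARD('d) / 2)) * (\<i> * cdot (kvecC p) (fcoeff v (k - p)))) *s fcoeff w p)"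

lemma advection_partial_tendsto:
  fixes v w :: "'d::finite vfield"
  assumes v: "v \<in> sobolev_div0 1" and w: "w \<in> sobolev_div0 1"
  shows "(\<lambda>n. advection_partial v w n k) \<longlonglongrightarrow> fcoeff (advection v w) k"
proof (rule vec_tendstoI)
  fix r
  let ?c = "of_real ((2 * pi) powr (- real CARD('d) / 2)) :: complex"
  have "(\<lambda>n. \<Sum>s\<in>UNIV. ?c * (\<Sum>p\<in>freq_ball n. dcoeff (v $ s) (k - p) * dcoeff (distr_deriv s (w $ r)) p))
    \<longlonglongrightarrow> (\<Sum>s\<in>UNIV. dcoeff (distr_mult (v $ s) (distr_deriv s (w $ r))) k)"
    by (intro tendsto_sum product_of_square_summable(2) square_summable_component square_summable_derivative v w)
  moreover have "(\<Sum>s\<in>UNIV. ?c * (\<Sum>p\<in>freq_ball n. dcoeff (v $ s) (k - p) * dcoeff (distr_deriv s (w $ r)) p))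
    = advection_partial v w n k $ r" for n
  proof -
    have "(\<Sum>s\<in>UNIV. ?c * (\<Sum>p\<in>freq_ball n. dcoeff (v $ s) (k - p) * dcoeff (distr_deriv s (w $ r)) p))
      = (\<Sum>p\<in>freq_ball n. \<Sum>s\<in>UNIV. ?c * (dcoeff (v $ s) (k - p) * dcoeff (distr_deriv s (w $ r)) p))"
      unfolding sum_distrib_left by (rule sum.swap)
    also have "\<dots> = (\<Sum>p\<in>freq_ball n. (?c * (\<i> * cdot (kvecC p) (fcoeff v (k - p)))) * fcoeff w p $ r)"
      unfolding dcoeff_distr_deriv cdot_def kvecC_def fcoeff_nth sum_distrib_left sum_distrib_right
      by (intro sum.cong refl) (simp add: mult_ac)
    finally show ?thesis by (simp add: advection_partial_def)
  qed
  moreover have "(\<Sum>s\<in>UNIV. dcoeff (distr_mult (v $ s) (distr_deriv s (w $ r))) k) = fcoeff (advection v w) k $ r"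
    by (simp add: fcoeff_nth advection_def dcoeff_sum)
  ultimately show "(\<lambda>n. advection_partial v w n k $ r) \<longlonglongrightarrow> fcoeff (advection v w) k $ r" by simp
qed

lemma norm_kvecC: "norm (kvecC k) = norm (kvec k)"
  by (simp add: norm_vec_def kvecC_def L2_set_def)

lemma norm_cdot_le: "norm (cdot a b) \<le> norm a * norm b"
proof -
  have "norm (cdot a b) \<le> (\<Sum>r\<in>UNIV. norm (a $ r * b $ r))"
    unfolding cdot_def by (rule norm_sum)
  also have "\<dots> = (\<Sum>r\<in>UNIV. \<bar>norm (a $ r)\<bar> * \<bar>norm (b $ r)\<bar>)" by (simp add: norm_mult)
  also have "\<dots> \<le> norm a * norm b" unfolding norm_vec_def by (rule L2_set_mult_ineq)
  finally show ?thesis .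
qed

lemma norm_vector_scale: "norm ((c::complex) *s x) = norm c * norm x"
  by (simp add: norm_vec_def norm_mult L2_set_right_distrib)

lemma norm_advection_partial_le:
  fixes v w :: "'d::finite vfield"
  assumes v: "v \<in> sobolev_div0 1"
  shows "norm (advection_partial v w n k) \<le> (2 * pi) powr (- real CARD('d) / 2) *
    (\<Sum>p\<in>freq_ball n. weighted 1 (fcoeff v) (k - p) / norm (kvec (k - p)) * weighted 1 (fcoeff w) p)"
  unfolding advection_partial_def sum_distrib_left
proof (rule sum_norm_le)
  fix p
  let ?c = "(2 * pi) powr (- real CARD('d) / 2)"
  have a: "norm (fcoeff v (k - p)) = weighted 1 (fcoeff v) (k - p) / norm (kvec (k - p))"
    using v by (cases "k = p") (auto simp: weighted_def sobolev_div0_iff sobolev0_iff)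
  have "norm ((of_real ?c * (\<i> * cdot (kvecC p) (fcoeff v (k - p)))) *s fcoeff w p)
    = ?c * (norm (cdot (kvecC p) (fcoeff v (k - p))) * norm (fcoeff w p))"
    by (simp add: norm_vector_scale norm_mult)
  also have "\<dots> \<le> ?c * ((norm (kvec p) * norm (fcoeff v (k - p))) * norm (fcoeff w p))"
    using norm_cdot_le[of "kvecC p" "fcoeff v (k - p)"] unfolding norm_kvecC
    by (intro mult_left_mono mult_right_mono) auto
  also have "\<dots> = ?c * (weighted 1 (fcoeff v) (k - p) / norm (kvec (k - p)) * weighted 1 (fcoeff w) p)"
    by (subst a) (simp add: weighted_def[of 1 "fcoeff w" p] mult_ac)
  finally show "norm ((of_real ?c * (\<i> * cdot (kvecC p) (fcoeff v (k - p)))) *s fcoeff w p)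
    \<le> ?c * (weighted 1 (fcoeff v) (k - p) / norm (kvec (k - p)) * weighted 1 (fcoeff w) p)" .
qed

text \<open>
  At \<open>k = 0\<close> the factor \<open>p \<cdot> v\<^sub>-\<^sub>p\<close> vanishes because \<open>v\<close> is divergence free.
\<close>

lemma advection_mean_0:
  assumes v: "v \<in> sobolev_div0 1" and w: "w \<in> sobolev_div0 1"
  shows "fcoeff (advection v w) 0 = 0"
proof -
  have "cdot (kvecC p) (fcoeff v (- p)) = - cdot (kvecC (- p)) (fcoeff v (- p))" for p
    by (simp add: cdot_def kvecC_def sum_negf)
  then have "cdot (kvecC p) (fcoeff v (- p)) = 0" for p
    using v by (simp add: sobolev_div0_iff)
  then have "advection_partial v w n 0 = 0" for n by (simp add: advection_partial_def)
  then show ?thesis using advection_partial_tendsto[OF v w, of 0] by (simp add: LIMSEQ_const_iff)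
qed

section \<open>The Leray projection\<close>

lemma cdot_kvecC_self: "cdot (kvecC k) (kvecC k) = of_real ((norm (kvec k))\<^sup>2)"
  by (simp add: cdot_def kvecC_def norm_vec_def L2_set_def sum_nonneg power2_eq_square)

lemma cdot_vector_scale: "cdot a (c *s b) = c * cdot a b"
  by (simp add: cdot_def sum_distrib_left mult_ac)

lemma cdot_leray_symbol: "cdot (kvecC k) (leray_symbol k c) = 0"
proof (cases "k = 0")
  case True
  then show ?thesis by (simp add: cdot_def kvecC_def)
next
  case False
  then show ?thesis
    by (simp add: leray_symbol_def cdot_diff cdot_vector_scale cdot_kvecC_self del: of_real_power)
qed

text \<open>
  The symbol is the orthogonal projection of \<open>\<complex>\<^sup>d\<close> along the real vector \<open>k\<close>.
\<close>

lemma norm_leray_symbol_le: "norm (leray_symbol k c) \<le> norm c"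
proof (cases "k = 0")
  case False
  define \<alpha> where "\<alpha> = cdot (kvecC k) c / of_real ((norm (kvec k))\<^sup>2)"
  let ?L = "leray_symbol k c" and ?p = "\<alpha> *s kvecC k"
  have c: "c = ?L + ?p" using False by (simp add: leray_symbol_def \<alpha>_def)
  have "?L \<bullet> ?p = (\<Sum>r\<in>UNIV. Re (?L $ r * cnj (\<alpha> * of_int (k $ r))))"
    by (simp add: inner_vec_def inner_complex_def kvecC_def)
  also have "\<dots> = Re (cnj \<alpha> * cdot (kvecC k) ?L)"
    unfolding Re_sum[symmetric] by (simp add: cdot_def kvecC_def sum_distrib_left mult_ac)
  also have "\<dots> = 0" by (simp add: cdot_leray_symbol)
  finally have "(norm (?L + ?p))\<^sup>2 = (norm ?L)\<^sup>2 + (norm ?p)\<^sup>2"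
    by (intro norm_add_Pythagorean) (simp add: orthogonal_def)
  then have "(norm c)\<^sup>2 = (norm ?L)\<^sup>2 + (norm ?p)\<^sup>2" using c by simp
  then have "(norm ?L)\<^sup>2 \<le> (norm c)\<^sup>2" by simp
  then show ?thesis by (rule power2_le_imp_le) simp
qed (simp add: leray_symbol_def)

lemma leray_symbol_add: "leray_symbol k (b + c) = leray_symbol k b + leray_symbol k c"
  by (simp add: leray_symbol_def cdot_add vec_eq_iff add_divide_distrib algebra_simps)

lemma leray_symbol_scaleR: "leray_symbol k (x *\<^sub>R c) = x *\<^sub>R leray_symbol k c"
  by (simp add: leray_symbol_def cdot_scaleR vec_eq_iff scaleR_right_diff_distrib)
    (simp add: scaleR_conv_of_real algebra_simps)

lemma fcoeff_leray: "fcoeff (leray u) k = leray_symbol k (fcoeff u k)"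
  unfolding leray_def
proof (rule fcoeff_fseries)
  obtain C m where C: "\<And>k. norm (fcoeff u k) \<le> C * (1 + norm (kvec k)) ^ m"
    using admissible_fcoeff[of u] unfolding admissible_def by blast
  have "leray_symbol (- k) (fcoeff u (- k)) $ r = cnj (leray_symbol k (fcoeff u k) $ r)" for k r
  proof -
    have "cdot (kvecC (- k)) (fcoeff u (- k)) = - cnj (cdot (kvecC k) (fcoeff u k))"
      by (simp add: cdot_def kvecC_def fcoeff_uminus_index sum_negf)
    then show ?thesis
      using fcoeff_uminus_index[of u 0 r]
      by (cases "k = 0") (simp_all add: leray_symbol_def fcoeff_uminus_index[of u k] kvecC_def)
  qed
  then show "admissible (\<lambda>k. leray_symbol k (fcoeff u k))"
    unfolding admissible_def using order_trans[OF norm_leray_symbol_le C] by blast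
qed

definition quadratic_term :: "'d::finite vfield \<Rightarrow> 'd vfield \<Rightarrow> 'd vfield" where
  "quadratic_term v w = - leray (advection v w)"

lemma fcoeff_quadratic_term: "fcoeff (quadratic_term v w) k = - leray_symbol k (fcoeff (advection v w) k)"
  by (simp add: quadratic_term_def fcoeff_uminus fcoeff_leray)

text \<open>
  The finite lattice sums of the partial convolutions obey \<open>convolution_estimate\<close>, with \<open>|h| |v\<^sub>h|\<close> and
  \<open>|p| |w\<^sub>p|\<close> in the roles of \<open>a\<close> and \<open>b\<close>; the bounds persist in the limit.
\<close>

theorem quadratic_term_bound:
  fixes v w :: "'d::finite vfield"
  assumes \<omega>: "\<omega> \<ge> 0" "2 * \<omega> + 2 > real CARD('d)"
    and K: "\<And>k::int^'d. k \<noteq> 0 \<Longrightarrow> Ksum \<omega> k \<le> K0"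
    and v: "v \<in> sobolev_div0 1" and w: "w \<in> sobolev_div0 1"
  shows "quadratic_term v w \<in> sobolev_div0 (- \<omega>)"
    and "sobolev_norm (- \<omega>) (quadratic_term v w)
      \<le> (2 * pi) powr (- real CARD('d) / 2) * sqrt K0 * sobolev_norm 1 v * sobolev_norm 1 w"
proof -
  let ?c = "(2 * pi) powr (- real CARD('d) / 2)"
  let ?B = "?c * sqrt K0 * sobolev_norm 1 v * sobolev_norm 1 w"
  let ?P = "quadratic_term v w"
  have L2: "L2_set (weighted (- \<omega>) (fcoeff ?P)) F \<le> ?B" if F: "finite F" for F
  proof -
    have F': "finite (F - {0})" "0 \<notin> F - {0}" using F by auto
    have partial: "L2_set (weighted (- \<omega>) (advection_partial v w n)) (F - {0}) \<le> ?B" for n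
    proof -
      let ?g = "\<lambda>k. norm (kvec k) powr (- \<omega>) *
        (\<Sum>p\<in>freq_ball n. weighted 1 (fcoeff v) (k - p) / norm (kvec (k - p)) * weighted 1 (fcoeff w) p)"
      have "L2_set (weighted (- \<omega>) (advection_partial v w n)) (F - {0}) \<le> L2_set (\<lambda>k. ?c * ?g k) (F - {0})"
      proof (rule L2_set_mono)
        fix k
        have "norm (kvec k) powr (- \<omega>) * norm (advection_partial v w n k) \<le> norm (kvec k) powr (- \<omega>) *
            (?c * (\<Sum>p\<in>freq_ball n. weighted 1 (fcoeff v) (k - p) / norm (kvec (k - p)) * weighted 1 (fcoeff w) p))"
          by (intro mult_left_mono norm_advection_partial_le v) auto
        then show "weighted (- \<omega>) (advection_partial v w n) k \<le> ?c * ?g k"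
          by (simp only: weighted_def[of "- \<omega>"] mult.left_commute[of ?c])
      qed (rule weighted_nonneg)
      also have "\<dots> = ?c * L2_set ?g (F - {0})" by (simp add: L2_set_right_distrib)
      also have "\<dots> \<le> ?c * (sqrt K0 * sobolev_norm 1 v * sobolev_norm 1 w)"
        by (intro mult_left_mono convolution_estimate[OF \<omega> K _ _ _ _ _ F' finite_freq_ball])
          (auto intro: L2_set_le_sobolev_norm sobolev_div0D v w weighted_nonneg weighted_0)
      finally show ?thesis by (simp add: mult.assoc)
    qed
    have "L2_set (weighted (- \<omega>) (fcoeff ?P)) F = L2_set (weighted (- \<omega>) (fcoeff ?P)) (F - {0})"
      unfolding L2_set_def using F
      by (intro arg_cong[where f = sqrt] sum.mono_neutral_right) (auto simp: weighted_0)
    also have "\<dots> \<le> L2_set (weighted (- \<omega>) (fcoeff (advection v w))) (F - {0})"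
    proof (rule L2_set_mono)
      show "weighted (- \<omega>) (fcoeff ?P) k \<le> weighted (- \<omega>) (fcoeff (advection v w)) k" for k
        unfolding weighted_def fcoeff_quadratic_term norm_minus_cancel
        by (intro mult_left_mono norm_leray_symbol_le) auto
    qed (rule weighted_nonneg)
    also have "\<dots> \<le> ?B"
    proof (rule tendsto_upperbound)
      show "(\<lambda>n. L2_set (weighted (- \<omega>) (advection_partial v w n)) (F - {0}))
        \<longlonglongrightarrow> L2_set (weighted (- \<omega>) (fcoeff (advection v w))) (F - {0})"
        unfolding L2_set_def weighted_def by (intro tendsto_intros advection_partial_tendsto v w)
      show "\<forall>\<^sub>F n in sequentially. L2_set (weighted (- \<omega>) (advection_partial v w n)) (F - {0}) \<le> ?B"
        by (intro always_eventually allI partial)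
    qed simp
    finally show ?thesis .
  qed
  have "fcoeff ?P 0 = 0"
    by (simp add: fcoeff_quadratic_term leray_symbol_def advection_mean_0[OF v w])
  moreover have "cdot (kvecC k) (fcoeff ?P k) = 0" for k
    using cdot_scaleR[of "kvecC k" "-1" "leray_symbol k (fcoeff (advection v w) k)"]
    by (simp add: fcoeff_quadratic_term cdot_leray_symbol)
  ultimately show "?P \<in> sobolev_div0 (- \<omega>)"
    using L2 by (auto simp: sobolev_div0_iff sobolev0_iff)
  show "sobolev_norm (- \<omega>) ?P \<le> ?B" by (rule sobolev_norm_L2(2)[OF L2])
qed

lemma advection_partial_linear:
  fixes u v w :: "'d::finite vfield"
  shows "advection_partial (u + v) w n k = advection_partial u w n k + advection_partial v w n k"
    and "advection_partial u (v + w) n k = advection_partial u v n k + advection_partial u w n k"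
    and "advection_partial (x *\<^sub>R v) w n k = x *\<^sub>R advection_partial v w n k"
    and "advection_partial v (x *\<^sub>R w) n k = x *\<^sub>R advection_partial v w n k"
  by (simp_all add: advection_partial_def vec_eq_iff fcoeff_add fcoeff_scaleR cdot_add cdot_scaleR
      sum.distrib[symmetric] sum_distrib_left scaleR_sum_right algebra_simps)
    (simp_all add: scaleR_conv_of_real mult_ac)

lemma quadratic_term_linear:
  fixes u v w :: "'d::finite vfield"
  assumes u: "u \<in> sobolev_div0 1" and v: "v \<in> sobolev_div0 1" and w: "w \<in> sobolev_div0 1"
  shows "quadratic_term (u + v) w = quadratic_term u w + quadratic_term v w"
    and "quadratic_term u (v + w) = quadratic_term u v + quadratic_term u w"
    and "quadratic_term (x *\<^sub>R v) w = x *\<^sub>R quadratic_term v w"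
    and "quadratic_term v (x *\<^sub>R w) = x *\<^sub>R quadratic_term v w"
proof -
  note lim = advection_partial_tendsto
  note add = subspace_add[OF subspace_sobolev_div0] and scale = subspace_scale[OF subspace_sobolev_div0]
  have 1: "fcoeff (advection (u + v) w) k = fcoeff (advection u w) k + fcoeff (advection v w) k" for k
    by (rule LIMSEQ_unique[OF lim[OF add[OF u v] w, unfolded advection_partial_linear]
          tendsto_add[OF lim[OF u w] lim[OF v w]]])
  have 2: "fcoeff (advection u (v + w)) k = fcoeff (advection u v) k + fcoeff (advection u w) k" for k
    by (rule LIMSEQ_unique[OF lim[OF u add[OF v w], unfolded advection_partial_linear]
          tendsto_add[OF lim[OF u v] lim[OF u w]]])
  have 3: "fcoeff (advection (x *\<^sub>R v) w) k = x *\<^sub>R fcoeff (advection v w) k" for k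
    by (rule LIMSEQ_unique[OF lim[OF scale[OF v] w, unfolded advection_partial_linear]
          tendsto_scaleR[OF tendsto_const lim[OF v w]]])
  have 4: "fcoeff (advection v (x *\<^sub>R w)) k = x *\<^sub>R fcoeff (advection v w) k" for k
    by (rule LIMSEQ_unique[OF lim[OF v scale[OF w], unfolded advection_partial_linear]
          tendsto_scaleR[OF tendsto_const lim[OF v w]]])
  note rules = fcoeff_quadratic_term fcoeff_add fcoeff_scaleR leray_symbol_add leray_symbol_scaleR
  show "quadratic_term (u + v) w = quadratic_term u w + quadratic_term v w"
    by (rule vfield_eqI) (simp add: rules 1)
  show "quadratic_term u (v + w) = quadratic_term u v + quadratic_term u w"
    by (rule vfield_eqI) (simp add: rules 2)
  show "quadratic_term (x *\<^sub>R v) w = x *\<^sub>R quadratic_term v w"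
    by (rule vfield_eqI) (simp add: rules 3)
  show "quadratic_term v (x *\<^sub>R w) = x *\<^sub>R quadratic_term v w"
    by (rule vfield_eqI) (simp add: rules 4)
qed

lemma bilinear_map_on_quadratic_term:
  assumes "\<And>v w :: 'd::finite vfield. v \<in> sobolev_div0 1 \<Longrightarrow> w \<in> sobolev_div0 1 \<Longrightarrow> quadratic_term v w \<in> Z"
  shows "bilinear_map_on (sobolev_div0 1) (sobolev_div0 1) (Z :: 'd vfield set) quadratic_term"
  unfolding bilinear_map_on_def linear_map_on_def
  using assms by (auto simp: quadratic_term_linear)

lemma continuous_map_quadratic_term:
  fixes K :: real
  assumes mem: "\<And>v w :: 'd::finite vfield. v \<in> sobolev_div0 1 \<Longrightarrow> w \<in> sobolev_div0 1 \<Longrightarrow> quadratic_term v w \<in> sobolev_div0 m"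
    and bnd: "\<And>v w :: 'd vfield. v \<in> sobolev_div0 1 \<Longrightarrow> w \<in> sobolev_div0 1 \<Longrightarrow>
      sobolev_norm m (quadratic_term v w) \<le> K * sobolev_norm 1 v * sobolev_norm 1 w"
    and K: "K > 0"
  shows "continuous_map (prod_topology (norm_topology (sobolev_div0 1) (sobolev_norm 1)) (norm_topology (sobolev_div0 1) (sobolev_norm 1)))
    (norm_topology (sobolev_div0 m :: 'd vfield set) (sobolev_norm m)) (\<lambda>(v, w). quadratic_term v w)"
proof (rule continuous_map_to_sobolev_prod[where d = "\<lambda>v w. sobolev_norm 1 (v - w)"], unfold topspace_sobolev)
  interpret Metric_space "sobolev_div0 1" "\<lambda>v w :: 'd vfield. sobolev_norm 1 (v - w)"
    by (rule Metric_space_sobolev)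
  show "openin (norm_topology (sobolev_div0 1) (sobolev_norm 1)) {w' \<in> sobolev_div0 1. sobolev_norm 1 (w' - w) < \<delta>}"
    if "w \<in> sobolev_div0 1" for w :: "'d vfield" and \<delta>
  proof -
    have "{w' \<in> sobolev_div0 1. sobolev_norm 1 (w' - w) < \<delta>} = mball w \<delta>"
      using that by (auto simp: sobolev_norm_minus_commute[of 1 w])
    then show ?thesis unfolding norm_topology_def by simp
  qed
  show "sobolev_norm 1 (w - w) = 0" for w :: "'d vfield" by simp
  show "quadratic_term v w \<in> sobolev_div0 m" if "v \<in> sobolev_div0 1" "w \<in> sobolev_div0 1" for v w :: "'d vfield"
    using that by (rule mem)
  fix v w :: "'d vfield" and e :: real
  assume v: "v \<in> sobolev_div0 1" and w: "w \<in> sobolev_div0 1" and e: "e > 0"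
  define A where "A = K * (sobolev_norm 1 v + sobolev_norm 1 w + 1)"
  have A: "A > 0" unfolding A_def using K sobolev_norm_nonneg[of 1 v] sobolev_norm_nonneg[of 1 w] by simp
  define \<delta> where "\<delta> = min 1 (e / A)"
  have \<delta>: "\<delta> > 0" "\<delta> \<le> 1" "\<delta> \<le> e / A" using A e by (auto simp: \<delta>_def)
  have "sobolev_norm m (quadratic_term v' w' - quadratic_term v w) < e"
    if v': "v' \<in> sobolev_div0 1" and w': "w' \<in> sobolev_div0 1"
      and close: "sobolev_norm 1 (v' - v) < \<delta>" "sobolev_norm 1 (w' - w) < \<delta>" for v' w'
  proof -
    have dv: "v' - v \<in> sobolev_div0 1" and dw: "w' - w \<in> sobolev_div0 1"
      by (intro sobolev_div0_diff v v' w w')+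
    have eq: "quadratic_term v' w' - quadratic_term v w = quadratic_term (v' - v) w' + quadratic_term v (w' - w)"
      using quadratic_term_linear(1)[OF dv v w'] quadratic_term_linear(2)[OF v dw w] by simp
    have "sobolev_norm 1 w' \<le> sobolev_norm 1 (w' - w) + sobolev_norm 1 w"
      using sobolev_add(2)[OF sobolev_div0D[OF dw] sobolev_div0D[OF w]] by simp
    then have w1: "sobolev_norm 1 w' \<le> sobolev_norm 1 w + 1" using close \<delta> by simp
    have "sobolev_norm m (quadratic_term v' w' - quadratic_term v w)
      \<le> sobolev_norm m (quadratic_term (v' - v) w') + sobolev_norm m (quadratic_term v (w' - w))"
      unfolding eq by (intro sobolev_add(2) sobolev_div0D mem dv w' v dw)
    also have "\<dots> \<le> K * sobolev_norm 1 (v' - v) * sobolev_norm 1 w' + K * sobolev_norm 1 v * sobolev_norm 1 (w' - w)"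
      by (intro add_mono bnd dv w' v dw)
    also have "\<dots> \<le> K * sobolev_norm 1 (v' - v) * (sobolev_norm 1 w + 1) + K * sobolev_norm 1 v * \<delta>"
      using K close w1 by (intro add_mono mult_left_mono mult_nonneg_nonneg sobolev_norm_nonneg) auto
    also have "\<dots> < K * \<delta> * (sobolev_norm 1 w + 1) + K * sobolev_norm 1 v * \<delta>"
    proof -
      have "K * sobolev_norm 1 (v' - v) * (sobolev_norm 1 w + 1) < K * \<delta> * (sobolev_norm 1 w + 1)"
        using K close sobolev_norm_nonneg[of 1 w] by (intro mult_strict_right_mono mult_strict_left_mono) auto
      then show ?thesis by simp
    qed
    also have "\<dots> = A * \<delta>" by (simp add: A_def algebra_simps)
    also have "\<dots> \<le> A * (e / A)" using A \<delta> by (intro mult_left_mono) auto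
    also have "\<dots> = e" using A by simp
    finally show ?thesis .
  qed
  then show "\<exists>\<delta>>0. \<forall>v'\<in>sobolev_div0 1. \<forall>w'\<in>sobolev_div0 1. sobolev_norm 1 (v' - v) < \<delta> \<longrightarrow>
      sobolev_norm 1 (w' - w) < \<delta> \<longrightarrow> sobolev_norm m (quadratic_term v' w' - quadratic_term v w) < e"
    using \<delta>(1) by blast
qed

section \<open>The functional setting of the Navier-Stokes equations\<close>

lemma sc_semigroup_cong:
  assumes V: "sc_semigroup X nrm V" and X: "subspace X"
    and eq: "\<And>t v. t \<ge> 0 \<Longrightarrow> v \<in> X \<Longrightarrow> U t v = V t v"
  shows "sc_semigroup X nrm U"
  unfolding sc_semigroup_def
proof (intro conjI allI impI ballI)
  have Vt: "linear_map_on X X (V t)" if "t \<ge> 0" for t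
    using V that unfolding sc_semigroup_def by blast
  have mem: "V t v \<in> X" if "t \<ge> 0" "v \<in> X" for t v
    using Vt[OF that(1)] that(2) unfolding linear_map_on_def by blast
  show "U 0 v = v" if "v \<in> X" for v
    using V that eq[of 0 v] unfolding sc_semigroup_def by simp
  show "U (s + t) v = U s (U t v)" if "0 \<le> s" "0 \<le> t" "v \<in> X" for s t v
    using V that eq[of "s + t" v] eq[of t v] eq[of s "V t v"] mem[of t v] unfolding sc_semigroup_def by simp
  show "continuous_map (top_of_set {0..}) (norm_topology X nrm) (\<lambda>t. U t v)" if "v \<in> X" for v
  proof (rule continuous_map_eq)
    show "continuous_map (top_of_set {0..}) (norm_topology X nrm) (\<lambda>t. V t v)"
      using V that unfolding sc_semigroup_def by blast
  qed (use that eq in simp)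
  fix t :: real assume t: "0 \<le> t"
  show "\<exists>C. \<forall>v\<in>X. nrm (U t v) \<le> C * nrm v"
    using V t eq unfolding sc_semigroup_def by simp
  show "linear_map_on X X (U t)"
    using Vt[OF t] eq[OF t] subspace_add[OF X] subspace_scale[OF X]
    unfolding linear_map_on_def by (simp add: image_subset_iff)
qed

lemma linear_map_on_restrict:
  assumes "linear_map_on X Y L" "subspace X" shows "linear_map_on X Y (restrict L X)"
  using assms subspace_add[OF assms(2)] subspace_scale[OF assms(2)]
  unfolding linear_map_on_def by (simp add: image_subset_iff)

text \<open>
  Stated for any family \<open>U\<close> that agrees with the heat semigroup at nonnegative times, since a generated
  semigroup is determined only there.
\<close>

lemma heat_decay:
  assumes U: "\<And>t v. t \<ge> 0 \<Longrightarrow> v \<in> sobolev_div0 n \<Longrightarrow> U t v = heat t (v :: 'd::finite vfield)"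
  shows "\<forall>t\<ge>0. U t ` sobolev_div0 n \<subseteq> sobolev_div0 n"
    and "continuous_map (prod_topology (norm_topology (sobolev_div0 n) (sobolev_norm n)) (top_of_set {0..}))
      (norm_topology (sobolev_div0 n) (sobolev_norm n)) (\<lambda>(v, t). U t v)"
    and "sc_semigroup (sobolev_div0 n) (sobolev_norm n) U"
    and "\<forall>t\<ge>0. \<forall>v\<in>sobolev_div0 n. sobolev_norm n (U t v) \<le> exp (- t) * sobolev_norm n v"
proof -
  show "\<forall>t\<ge>0. U t ` sobolev_div0 n \<subseteq> sobolev_div0 n"
    using U heat_sobolev(2) by (auto simp: image_subset_iff)
  show "continuous_map (prod_topology (norm_topology (sobolev_div0 n) (sobolev_norm n)) (top_of_set {0..}))
      (norm_topology (sobolev_div0 n) (sobolev_norm n)) (\<lambda>(v, t). U t v)"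
  proof (rule continuous_map_eq)
    show "continuous_map (prod_topology (norm_topology (sobolev_div0 n) (sobolev_norm n)) (top_of_set {0..}))
      (norm_topology (sobolev_div0 n) (sobolev_norm n)) (\<lambda>(v :: 'd vfield, t). heat t v)"
      by (rule heat_continuous_map) (auto intro!: exI[of _ 1] heat_symbol_bound_1)
  qed (auto simp: topspace_sobolev U)
  show "sc_semigroup (sobolev_div0 n) (sobolev_norm n) U"
    by (rule sc_semigroup_cong[OF sc_semigroup_heat subspace_sobolev_div0]) (rule U)
  show "\<forall>t\<ge>0. \<forall>v\<in>sobolev_div0 n. sobolev_norm n (U t v) \<le> exp (- t) * sobolev_norm n v"
  proof (intro allI impI ballI)
    fix t :: real and v :: "'d vfield" assume t: "0 \<le> t" and v: "v \<in> sobolev_div0 n"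
    show "sobolev_norm n (U t v) \<le> exp (- t) * sobolev_norm n v"
      using fmult(3)[OF heat_symbol_bound[OF t] v] by (simp add: U t v heat_def)
  qed
qed

lemma heat_smoothing:
  assumes \<omega>: "\<omega> > 0" and U: "\<And>t v. t \<ge> 0 \<Longrightarrow> v \<in> sobolev_div0 (- \<omega>) \<Longrightarrow> U t v = heat t (v :: 'd::finite vfield)"
  shows "\<forall>t>0. U t ` sobolev_div0 (- \<omega>) \<subseteq> sobolev_div0 1"
    and "continuous_map (prod_topology (norm_topology (sobolev_div0 (- \<omega>)) (sobolev_norm (- \<omega>))) (top_of_set {0<..}))
      (norm_topology (sobolev_div0 1) (sobolev_norm 1)) (\<lambda>(v, t). U t v)"
    and "\<forall>t>0. \<forall>v\<in>sobolev_div0 (- \<omega>). sobolev_norm 1 (U t v) \<le> mu_fun \<omega> t * exp (- t) * sobolev_norm (- \<omega>) v"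
proof -
  show "\<forall>t>0. U t ` sobolev_div0 (- \<omega>) \<subseteq> sobolev_div0 1"
    using U fmult(2)[OF heat_symbol_mu[OF \<omega>]] by (auto simp: image_subset_iff heat_def)
  show "continuous_map (prod_topology (norm_topology (sobolev_div0 (- \<omega>)) (sobolev_norm (- \<omega>))) (top_of_set {0<..}))
      (norm_topology (sobolev_div0 1) (sobolev_norm 1)) (\<lambda>(v, t). U t v)"
  proof (rule continuous_map_eq)
    show "continuous_map (prod_topology (norm_topology (sobolev_div0 (- \<omega>)) (sobolev_norm (- \<omega>))) (top_of_set {0<..}))
      (norm_topology (sobolev_div0 1) (sobolev_norm 1)) (\<lambda>(v :: 'd vfield, t). heat t v)"
    proof (rule heat_continuous_map)
      fix t :: real assume t: "t \<in> {0<..}"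
      obtain C where C: "\<And>s. s \<ge> t / 2 \<Longrightarrow> multiplier_bound (- \<omega>) 1 C (heat_symbol s :: int^'d \<Rightarrow> real)"
        using heat_symbol_smoothing[of "t / 2" "- \<omega>" 1] t \<omega> by auto
      have "multiplier_bound (- \<omega>) 1 C (heat_symbol s :: int^'d \<Rightarrow> real)" if "\<bar>s - t\<bar> < t / 2" for s
        using that unfolding abs_less_iff by (intro C) linarith
      then show "\<exists>C \<delta>. 0 < \<delta> \<and> (\<forall>s\<in>{0<..}. \<bar>s - t\<bar> < \<delta> \<longrightarrow> multiplier_bound (- \<omega>) 1 C (heat_symbol s :: int^'d \<Rightarrow> real))"
        using t by (intro exI[of _ C] exI[of _ "t / 2"]) auto
    qed
  qed (auto simp: topspace_sobolev U)
  show "\<forall>t>0. \<forall>v\<in>sobolev_div0 (- \<omega>). sobolev_norm 1 (U t v) \<le> mu_fun \<omega> t * exp (- t) * sobolev_norm (- \<omega>) v"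
  proof (intro allI impI ballI)
    fix t :: real and v :: "'d vfield" assume t: "0 < t" and v: "v \<in> sobolev_div0 (- \<omega>)"
    show "sobolev_norm 1 (U t v) \<le> mu_fun \<omega> t * exp (- t) * sobolev_norm (- \<omega>) v"
      using fmult(3)[OF heat_symbol_mu[OF \<omega> t] v] t by (simp add: U v heat_def)
  qed
qed

lemma densely_embedded_sobolev:
  assumes "n2 < n1"
  shows "densely_embedded (sobolev_div0 n1 :: 'd::finite vfield set) (sobolev_norm n1) (sobolev_div0 n2) (sobolev_norm n2)"
  unfolding densely_embedded_def
  using sobolev_inclusion[of n2 n1] assms
  by (auto intro!: subspace_sobolev_div0 continuous_map_inclusion_sobolev simp: sobolev_dense)

lemma laplacian_norm:
  assumes "v \<in> sobolev_div0 (n + 2)" shows "sobolev_norm n (laplacian v) = sobolev_norm (n + 2) v"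
proof -
  have "norm (kvec k) powr (2 * n) * (norm (fcoeff (laplacian v) k))\<^sup>2
    = norm (kvec k) powr (2 * (n + 2)) * (norm (fcoeff v k))\<^sup>2" for k
  proof -
    have "weighted n (fcoeff (laplacian v)) k = weighted (n + 2) (fcoeff v) k"
      by (cases "k = 0") (simp_all add: weighted_def laplacian_sobolev(1)[OF assms] powr_add)
    then show ?thesis unfolding weighted_square by simp
  qed
  then show ?thesis by (simp add: sobolev_norm_def)
qed

theorem proposition6p1:
  fixes \<omega> B N K :: real
    and \<mu> :: "real \<Rightarrow> real"
    and Fp F Fm :: "('d::finite vfield) set"
    and np n nm :: "'d vfield \<Rightarrow> real"
    and A :: "'d vfield \<Rightarrow> 'd vfield"
    and P :: "'d vfield \<Rightarrow> 'd vfield \<Rightarrow> 'd vfield"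
  assumes dim: "(CARD('d) = 2 \<and> \<omega> \<in> {0<..<1}) \<or> (CARD('d) = 3 \<and> \<omega> \<in> {1/2<..<1})"
    and Fp: "Fp = sobolev_div0 (2 - \<omega>)" "np = sobolev_norm (2 - \<omega>)"
    and F: "F = sobolev_div0 1" "n = sobolev_norm 1"
    and Fm: "Fm = sobolev_div0 (- \<omega>)" "nm = sobolev_norm (- \<omega>)"
    and A: "A = restrict laplacian Fp"
    and P: "P = (\<lambda>v w. - leray (advection v w))"
    and B: "B = 1"
    and mu: "\<mu> = mu_fun \<omega>"
    and N: "0 < N" "(SUP t\<in>{0..}. LBINT s:{0..t}. exp (- s) * \<mu> (t - s)) \<le> N"
    and K: "0 < K"
      "1 / (2 * pi) powr (real CARD('d) / 2) * sqrt (SUP k\<in>UNIV - {0 :: int ^ 'd}. Ksum \<omega> k) \<le> K"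
  shows "
    \<comment> \<open>the two suprema above are finite\<close>
    bdd_above ((\<lambda>t. LBINT s:{0..t}. exp (- s) * \<mu> (t - s)) ` {0..}) \<and>
    (\<forall>k :: int ^ 'd. k \<noteq> 0 \<longrightarrow>
       (\<lambda>h. 1 / (norm (kvec h) powr (2 * \<omega>) * (norm (kvec (k - h)))\<^sup>2)) summable_on (UNIV - {0, k})) \<and>
    bdd_above (Ksum \<omega> ` (UNIV - {0 :: int ^ 'd})) \<and>
    \<comment> \<open>(1)\<close>
    banach_space_on Fp np \<and> banach_space_on F n \<and> banach_space_on Fm nm \<and>
    densely_embedded Fp np F n \<and> densely_embedded F n Fm nm \<and>
    \<comment> \<open>(2)\<close>
    linear_map_on Fp Fm A \<and>
    equivalent_norms_on Fp np (\<lambda>v. nm v + nm (A v)) \<and>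
    \<comment> \<open>(3)\<close>
    norm_topology Fm nm closure_of Fp = Fm \<and>
    (\<exists>U. generates Fm nm Fp A U) \<and>
    \<comment> \<open>(4), where \<open>U t\<close> is the operator \<open>exp (t A)\<close>\<close>
    (\<forall>U. generates Fm nm Fp A U \<longrightarrow>
       (\<forall>t\<ge>0. U t ` F \<subseteq> F) \<and>
       continuous_map (prod_topology (norm_topology F n) (top_of_set {0..})) (norm_topology F n)
         (\<lambda>(v, t). U t v) \<and>
       sc_semigroup F n U \<and>
       (\<forall>t\<ge>0. \<forall>v\<in>F. n (U t v) \<le> exp (- B * t) * n v)) \<and>
    \<comment> \<open>(5)\<close>
    (\<forall>U. generates Fm nm Fp A U \<longrightarrow>
       (\<forall>t>0. U t ` Fm \<subseteq> F) \<and>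
       continuous_map (prod_topology (norm_topology Fm nm) (top_of_set {0<..})) (norm_topology F n)
         (\<lambda>(v, t). U t v) \<and>
       (\<forall>t>0. \<forall>v\<in>Fm. n (U t v) \<le> \<mu> t * exp (- B * t) * nm v)) \<and>
    continuous_on {0<..} \<mu> \<and> (\<forall>t>0. 0 < \<mu> t) \<and>
    (\<exists>\<epsilon>\<in>{0..<1}. \<mu> \<in> O[at_right 0](\<lambda>t. 1 / t powr \<epsilon>)) \<and>
    (\<forall>t\<ge>0. set_integrable lborel {0..t} (\<lambda>s. exp (- B * s) * \<mu> (t - s)) \<and>
       (LBINT s:{0..t}. exp (- B * s) * \<mu> (t - s)) \<le> N) \<and>
    \<comment> \<open>(6); its first clause says that every product in \<open>v \<cdot> \<partial>w\<close> is well defined\<close>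
    (\<forall>v\<in>F. \<forall>w\<in>F. \<forall>r s. \<exists>!R. is_product (v $ s) (distr_deriv s (w $ r)) R) \<and>
    bilinear_map_on F F Fm P \<and>
    continuous_map (prod_topology (norm_topology F n) (norm_topology F n)) (norm_topology Fm nm)
       (\<lambda>(v, w). P v w) \<and>
    (\<forall>v\<in>F. \<forall>w\<in>F. nm (P v w) \<le> K * n v * n w)"
proof -
  have \<omega>: "0 < \<omega>" "\<omega> < 1" "\<omega> \<ge> 0" "2 * \<omega> + 2 > real CARD('d)"
    using dim by auto
  \<comment> \<open>The order of the domain of the Laplacian exceeds that of the ambient space by two.\<close>
  have shift: "2 - \<omega> = - \<omega> + 2" by simp
  note Fp' = Fp[unfolded shift]
  let ?m = "- \<omega>"
  have P': "P = quadratic_term" by (simp add: P quadratic_term_def[abs_def])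
  have Bt: "- B * t = - t" for t by (simp add: B)
  obtain C where C: "\<And>t. t \<ge> 0 \<Longrightarrow> set_integrable lborel {0..t} (\<lambda>s. exp (- s) * \<mu> (t - s))"
    "\<And>t. t \<ge> 0 \<Longrightarrow> (LBINT s:{0..t}. exp (- s) * \<mu> (t - s)) \<le> C"
    unfolding mu using mu_fun_convolution[OF \<omega>(1,2)] by blast
  have bddI: "bdd_above ((\<lambda>t. LBINT s:{0..t}. exp (- s) * \<mu> (t - s)) ` {0..})"
    by (rule bdd_aboveI2[of _ _ C]) (use C in auto)
  have bddK: "bdd_above (Ksum \<omega> ` (UNIV - {0 :: int ^ 'd}))"
    by (rule bdd_aboveI2) (rule Ksum_summable_and_bound(2)[OF \<omega>(3,4)])
  have Kle: "Ksum \<omega> k \<le> (SUP k\<in>UNIV - {0 :: int ^ 'd}. Ksum \<omega> k)" if "k \<noteq> 0" for k :: "int^'d"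
    using that by (intro cSUP_upper bddK) auto
  have unique: "U t v = heat t v" if "generates Fm nm Fp A U" "t \<ge> 0" "v \<in> Fm" for U t v
    using generates_unique[of ?m U t v] that unfolding A Fp' Fm by simp
  have F_Fm: "F \<subseteq> Fm" using sobolev_inclusion(1)[of ?m 1] \<omega> unfolding F Fm by auto
  note qmem = quadratic_term_bound(1)[OF \<omega>(3,4) Kle]
  have qbound: "sobolev_norm ?m (quadratic_term v w) \<le> K * sobolev_norm 1 v * sobolev_norm 1 w"
    if v: "v \<in> sobolev_div0 1" and w: "w \<in> sobolev_div0 1" for v w :: "'d vfield"
  proof -
    have "(2 * pi) powr (- real CARD('d) / 2) * sqrt (SUP k\<in>UNIV - {0 :: int ^ 'd}. Ksum \<omega> k) \<le> K"
      using K(2) powr_minus_divide[of "2 * pi" "real CARD('d) / 2"] by simp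
    then have "(2 * pi) powr (- real CARD('d) / 2) * sqrt (SUP k\<in>UNIV - {0 :: int ^ 'd}. Ksum \<omega> k)
        * sobolev_norm 1 v * sobolev_norm 1 w \<le> K * sobolev_norm 1 v * sobolev_norm 1 w"
      by (intro mult_right_mono sobolev_norm_nonneg)
    then show ?thesis using quadratic_term_bound(2)[OF \<omega>(3,4) Kle v w] by linarith
  qed
  show ?thesis
  proof (intro conjI)
    show "\<forall>k :: int ^ 'd. k \<noteq> 0 \<longrightarrow>
       (\<lambda>h. 1 / (norm (kvec h) powr (2 * \<omega>) * (norm (kvec (k - h)))\<^sup>2)) summable_on (UNIV - {0, k})"
      using Ksum_summable_and_bound(1)[OF \<omega>(3,4)] by blast
    show "banach_space_on Fp np" "banach_space_on F n" "banach_space_on Fm nm"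
      unfolding Fp F Fm by (rule banach_space_sobolev)+
    show "densely_embedded Fp np F n" "densely_embedded F n Fm nm"
      unfolding Fp F Fm using \<omega> by (auto intro: densely_embedded_sobolev)
    show "linear_map_on Fp Fm A"
      unfolding A Fp' Fm laplacian_eq_fmult[abs_def]
      by (intro linear_map_on_restrict subspace_sobolev_div0 fmult_linear_map[OF laplacian_bound])
    show "equivalent_norms_on Fp np (\<lambda>v. nm v + nm (A v))"
      unfolding equivalent_norms_on_def
    proof (rule exI[of _ 1], rule conjI[OF zero_less_one], rule exI[of _ 2], intro conjI ballI)
      fix v assume v: "v \<in> Fp"
      have "nm (A v) = np v" using v laplacian_norm[of v ?m] by (simp add: A Fp' Fm)
      moreover have "nm v \<le> np v" using v sobolev_inclusion(2)[of ?m "?m + 2" v] by (simp add: Fp' Fm)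
      moreover have "0 \<le> nm v" by (simp add: Fm sobolev_norm_nonneg)
      ultimately show "1 * np v \<le> nm v + nm (A v)" "nm v + nm (A v) \<le> 2 * np v" by auto
    qed auto
    show "norm_topology Fm nm closure_of Fp = Fm" unfolding Fp Fm by (rule sobolev_dense) simp
    show "\<exists>U. generates Fm nm Fp A U" unfolding A Fp' Fm using generates_heat by blast
    show "\<forall>U. generates Fm nm Fp A U \<longrightarrow>
       (\<forall>t\<ge>0. U t ` F \<subseteq> F) \<and>
       continuous_map (prod_topology (norm_topology F n) (top_of_set {0..})) (norm_topology F n)
         (\<lambda>(v, t). U t v) \<and>
       sc_semigroup F n U \<and>
       (\<forall>t\<ge>0. \<forall>v\<in>F. n (U t v) \<le> exp (- B * t) * n v)"
    proof (intro allI impI)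
      fix U assume "generates Fm nm Fp A U"
      then have U: "\<And>t v. t \<ge> 0 \<Longrightarrow> v \<in> sobolev_div0 1 \<Longrightarrow> U t v = heat t v"
        using unique F_Fm F by blast
      show "(\<forall>t\<ge>0. U t ` F \<subseteq> F) \<and>
       continuous_map (prod_topology (norm_topology F n) (top_of_set {0..})) (norm_topology F n)
         (\<lambda>(v, t). U t v) \<and>
       sc_semigroup F n U \<and>
       (\<forall>t\<ge>0. \<forall>v\<in>F. n (U t v) \<le> exp (- B * t) * n v)"
        unfolding Bt F by (intro conjI heat_decay U)
    qed
    show "\<forall>U. generates Fm nm Fp A U \<longrightarrow>
       (\<forall>t>0. U t ` Fm \<subseteq> F) \<and>
       continuous_map (prod_topology (norm_topology Fm nm) (top_of_set {0<..})) (norm_topology F n)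
         (\<lambda>(v, t). U t v) \<and>
       (\<forall>t>0. \<forall>v\<in>Fm. n (U t v) \<le> \<mu> t * exp (- B * t) * nm v)"
    proof (intro allI impI)
      fix U assume "generates Fm nm Fp A U"
      then have U: "\<And>t v. t \<ge> 0 \<Longrightarrow> v \<in> sobolev_div0 ?m \<Longrightarrow> U t v = heat t v"
        using unique Fm by blast
      show "(\<forall>t>0. U t ` Fm \<subseteq> F) \<and>
       continuous_map (prod_topology (norm_topology Fm nm) (top_of_set {0<..})) (norm_topology F n)
         (\<lambda>(v, t). U t v) \<and>
       (\<forall>t>0. \<forall>v\<in>Fm. n (U t v) \<le> \<mu> t * exp (- B * t) * nm v)"
        unfolding Bt F Fm mu by (intro conjI heat_smoothing \<omega> U)
    qed
    show "continuous_on {0<..} \<mu>" unfolding mu by (rule continuous_on_mu_fun[OF \<omega>(1)])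
    show "\<forall>t>0. 0 < \<mu> t" unfolding mu using mu_fun_pos[OF \<omega>(1)] by blast
    show "\<exists>\<epsilon>\<in>{0..<1}. \<mu> \<in> O[at_right 0](\<lambda>t. 1 / t powr \<epsilon>)"
      unfolding mu using mu_fun_bigo[OF \<omega>(1)] \<omega> by (intro bexI[of _ "(1 + \<omega>) / 2"]) auto
    show "\<forall>t\<ge>0. set_integrable lborel {0..t} (\<lambda>s. exp (- B * s) * \<mu> (t - s)) \<and>
       (LBINT s:{0..t}. exp (- B * s) * \<mu> (t - s)) \<le> N"
      unfolding Bt using C(1) cSUP_upper[OF _ bddI] N(2) by (auto intro: order_trans)
    show "\<forall>v\<in>F. \<forall>w\<in>F. \<forall>r s. \<exists>!R. is_product (v $ s) (distr_deriv s (w $ r)) R"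
      unfolding F by (intro ballI allI product_of_square_summable(1) square_summable_component square_summable_derivative)
    show "bilinear_map_on F F Fm P"
      unfolding P' F Fm by (rule bilinear_map_on_quadratic_term) (rule qmem)
    show "continuous_map (prod_topology (norm_topology F n) (norm_topology F n)) (norm_topology Fm nm) (\<lambda>(v, w). P v w)"
      unfolding P' F Fm by (rule continuous_map_quadratic_term[OF qmem qbound K(1)])
    show "\<forall>v\<in>F. \<forall>w\<in>F. nm (P v w) \<le> K * n v * n w"
      unfolding P' F Fm using qbound by blast
  qed (rule bddI bddK)+
qed

end
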